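(* There exists a function $\beta:\mathbb{N}\to\mathbb{N}$ such that for every positive integer $n$, every integral polyhedron $P\subseteq\mathbb{R}^n$ containing an integer point in its relative interior, and every relaxation $Q$ of $P$, the $\beta(n)$-th Chvátal–Gomory closure $Q^{(\beta(n))}$ is contained in the affine hull $\operatorname{aff}(P)$.
   Context: For a polyhedron $Q\subseteq\mathbb{R}^n$, its integer hull is $Q_I:=\operatorname{conv}(Q\cap\mathbb{Z}^n)$; $Q$ is integral if $Q=Q_I$. Given an integral polyhedron $P\subseteq\mathbb{R}^n$, a relaxation of $P$ is a rational polyhedron $Q\subseteq\mathbb{R}^n$ with $Q\cap\mathbb{Z}^n=P\cap\mathbb{Z}^n$. An inequality $cx\le\lfloor\delta\rfloor$ is a Chvátal–Gomory (CG) inequality for $Q$ if $c\in\mathbb{Z}^n$ and $cx\le\delta$ is valid for $Q$. The CG closure $Q'$ is the set of points of $Q$ satisfying all CG inequalities for $Q$; $Q^{(0)}:=Q$ and $Q^{(k)}:=(Q^{(k-1)})'$. $\operatorname{aff}(S)$ denotes the smallest affine set containing $S$. *)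

theory Defs
  imports Complex_Main
begin

text \<open>Points of R^n are represented as functions nat => real vanishing at all
  coordinates i >= n (the dimension n varies inside the statement).\<close>

definition Rn :: "nat \<Rightarrow> (nat \<Rightarrow> real) set" where
  "Rn n = {x. \<forall>i\<ge>n. x i = 0}"

definition Zn :: "nat \<Rightarrow> (nat \<Rightarrow> real) set" where
  "Zn n = {x \<in> Rn n. \<forall>i<n. x i \<in> \<int>}"

definition dotn :: "nat \<Rightarrow> (nat \<Rightarrow> real) \<Rightarrow> (nat \<Rightarrow> real) \<Rightarrow> real" where
  "dotn n c x = (\<Sum>i<n. c i * x i)"

definition conv :: "(nat \<Rightarrow> real) set \<Rightarrow> (nat \<Rightarrow> real) set" where
  "conv S = {(\<lambda>i. \<Sum>y\<in>F. u y * y i) | F u. finite F \<and> F \<subseteq> S \<and> F \<noteq> {} \<and>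
              (\<forall>y\<in>F. 0 \<le> u y) \<and> sum u F = 1}"

definition aff :: "(nat \<Rightarrow> real) set \<Rightarrow> (nat \<Rightarrow> real) set" where
  "aff S = {(\<lambda>i. \<Sum>y\<in>F. u y * y i) | F u. finite F \<and> F \<subseteq> S \<and> F \<noteq> {} \<and> sum u F = 1}"

definition relint :: "nat \<Rightarrow> (nat \<Rightarrow> real) set \<Rightarrow> (nat \<Rightarrow> real) set" where
  "relint n S = {x \<in> S. \<exists>e>0. \<forall>y\<in>aff S. (\<Sum>i<n. (y i - x i)^2) < e^2 \<longrightarrow> y \<in> S}"

definition polyhedron :: "nat \<Rightarrow> (nat \<Rightarrow> real) set \<Rightarrow> bool" where
  "polyhedron n S \<longleftrightarrow> (\<exists>(m::nat) (A::nat \<Rightarrow> nat \<Rightarrow> real) (b::nat \<Rightarrow> real).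
      S = {x \<in> Rn n. \<forall>j<m. dotn n (A j) x \<le> b j})"

definition rational_polyhedron :: "nat \<Rightarrow> (nat \<Rightarrow> real) set \<Rightarrow> bool" where
  "rational_polyhedron n S \<longleftrightarrow> (\<exists>(m::nat) (A::nat \<Rightarrow> nat \<Rightarrow> real) (b::nat \<Rightarrow> real).
      (\<forall>j<m. b j \<in> \<rat> \<and> (\<forall>i<n. A j i \<in> \<rat>)) \<and>
      S = {x \<in> Rn n. \<forall>j<m. dotn n (A j) x \<le> b j})"

definition integer_hull :: "nat \<Rightarrow> (nat \<Rightarrow> real) set \<Rightarrow> (nat \<Rightarrow> real) set" where
  "integer_hull n Q = conv (Q \<inter> Zn n)"

definition integral_polyhedron :: "nat \<Rightarrow> (nat \<Rightarrow> real) set \<Rightarrow> bool" where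
  "integral_polyhedron n P \<longleftrightarrow> polyhedron n P \<and> P = integer_hull n P"

definition relaxation :: "nat \<Rightarrow> (nat \<Rightarrow> real) set \<Rightarrow> (nat \<Rightarrow> real) set \<Rightarrow> bool" where
  "relaxation n P Q \<longleftrightarrow> rational_polyhedron n Q \<and> Q \<inter> Zn n = P \<inter> Zn n"

definition cg_closure :: "nat \<Rightarrow> (nat \<Rightarrow> real) set \<Rightarrow> (nat \<Rightarrow> real) set" where
  "cg_closure n Q = {x \<in> Q. \<forall>(c::nat \<Rightarrow> real) (\<delta>::real). (\<forall>i<n. c i \<in> \<int>) \<longrightarrow>
      (\<forall>y\<in>Q. dotn n c y \<le> \<delta>) \<longrightarrow> dotn n c x \<le> of_int \<lfloor>\<delta>\<rfloor>}"

definition cg_iter :: "nat \<Rightarrow> nat \<Rightarrow> (nat \<Rightarrow> real) set \<Rightarrow> (nat \<Rightarrow> real) set" where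
  "cg_iter n k Q = (cg_closure n ^^ k) Q"

end

theory Submission
  imports Defs
begin

text \<open>After translation, \<open>0\<close> is an integer point in the relative interior of \<open>P\<close>. Unless \<open>P\<close> is
  full-dimensional, it suffices to find an integral \<open>c \<noteq> 0\<close> vanishing on \<open>P\<close> such that \<open>|cx|\<close> is bounded
  on \<open>Q\<close> by a function of \<open>n\<close>: the slices \<open>cx = j\<close> with \<open>j \<noteq> 0\<close> contain no integer points, have bounded rank,
  and can be removed one after another until \<open>Q\<close> lies in the hyperplane \<open>cx = 0\<close>; then induct on \<open>n\<close>.
  Unbounded \<open>Q\<close> are projected along an integral ray, which lowers \<open>n\<close> as well.

  To find \<open>c\<close> for bounded \<open>Q\<close>, the flatness theorem yields some direction \<open>c\<close> in which \<open>Q\<close> is thin. If \<open>c\<close> is not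
  constant on \<open>P\<close>, intersect with \<open>cx = 0\<close>. The vertices of \<open>P\<close> have bounded \<open>c\<close>-values, so the section of \<open>P\<close>
  is generated by points of bounded denominator and still contains \<open>0\<close> in its relative interior; by
  induction the section of \<open>Q\<close> is thin in a direction vanishing on the section of \<open>P\<close>, and this direction
  extends to one vanishing on \<open>P\<close>.\<close>

section \<open>Vectors and rational polyhedra\<close>

text \<open>No bound on the size of \<open>Q\<close> or of its coefficients is available, so every
  constant has to come from flatness in dimension \<open>n\<close>. The obstacle is that a section
  of \<open>P\<close> loses integrality, hence a statement about integral \<open>P\<close> cannot
  serve as its own induction hypothesis. The induction is run on \<open>slab_bound n N W\<close>
  instead: a set \<open>X\<close> of points with common denominator \<open>N\<close> stands for
  \<open>P\<close>, and each section replaces \<open>N\<close> by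
  \<open>N * fact (2 * N * w)\<close>. What remains of the relation between \<open>P\<close> and
  \<open>Q\<close> is that \<open>X\<close> is balanced around the origin and that the integer
  points of \<open>Q\<close> are annihilated by every integral functional that annihilates
  \<open>X\<close>. Flatness is a theorem on sets without integer points, whereas \<open>Q\<close>
  contains some; they lie in a lattice hyperplane as soon as a nonzero integral functional vanishes
  on \<open>X\<close>, and a sublattice coset off that hyperplane restores the hypothesis. The
  bounded rank of the slices is the theorem that polyhedra without integer points are emptied after
  a number of rounds depending only on \<open>n\<close>; it follows from flatness too.\<close>

definition lincomb :: "real \<Rightarrow> (nat \<Rightarrow> real) \<Rightarrow> real \<Rightarrow> (nat \<Rightarrow> real) \<Rightarrow> nat \<Rightarrow> real" where
  "lincomb s x t y = (\<lambda>i. s * x i + t * y i)"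

definition unit_vec :: "nat \<Rightarrow> nat \<Rightarrow> real" where
  "unit_vec k = (\<lambda>i. if i = k then 1 else 0)"

lemma dotn_commute: "dotn n c x = dotn n x c"
  by (simp add: dotn_def mult.commute)

lemma dotn_lincomb: "dotn n c (lincomb s x t y) = s * dotn n c x + t * dotn n c y"
  by (simp add: dotn_def lincomb_def sum_distrib_left sum.distrib[symmetric] algebra_simps)

lemma dotn_lincomb_left: "dotn n (lincomb s x t y) c = s * dotn n x c + t * dotn n y c"
  by (metis dotn_commute dotn_lincomb)

lemma dotn_scale: "dotn n c (\<lambda>i. s * x i) = s * dotn n c x"
  by (simp add: dotn_def sum_distrib_left algebra_simps)

lemma dotn_scale_left: "dotn n (\<lambda>i. s * x i) c = s * dotn n x c"
  by (metis dotn_commute dotn_scale)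

lemma dotn_Suc: "dotn (Suc n) c x = dotn n c x + c n * x n"
  by (simp add: dotn_def)

lemma dotn_upd [simp]: "dotn n c (x(n := t)) = dotn n c x" "dotn n (c(n := t)) x = dotn n c x"
  by (simp_all add: dotn_def)

lemma dotn_zero [simp]: "dotn n c (\<lambda>_. 0) = 0" "dotn n (\<lambda>_. 0) c = 0"
  by (simp_all add: dotn_def)

lemma dotn_unit_vec: "k < n \<Longrightarrow> dotn n (unit_vec k) x = x k"
  by (simp add: dotn_def unit_vec_def if_distrib[where f = "\<lambda>a. a * _"] sum.delta cong: if_cong)

lemma dotn_Ints: "c \<in> Zn n \<Longrightarrow> x \<in> Zn n \<Longrightarrow> dotn n c x \<in> \<int>"
  by (auto simp: dotn_def Zn_def intro!: Ints_sum Ints_mult)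

lemma zero_in_Rn [simp]: "(\<lambda>_. 0) \<in> Rn n"
  by (simp add: Rn_def)

lemma zero_in_Zn [simp]: "(\<lambda>_. 0) \<in> Zn n"
  by (simp add: Zn_def)

lemma Zn_subset_Rn: "Zn n \<subseteq> Rn n"
  by (auto simp: Zn_def)

lemma Zn_iff: "x \<in> Zn n \<longleftrightarrow> x \<in> Rn n \<and> (\<forall>i. x i \<in> \<int>)"
proof -
  have "x i \<in> \<int>" if "\<forall>i\<ge>n. x i = 0" "\<forall>i<n. x i \<in> \<int>" for i
    using that by (cases "i < n") auto
  then show ?thesis by (auto simp: Zn_def Rn_def)
qed

lemma unit_vec_in_Zn: "k < n \<Longrightarrow> unit_vec k \<in> Zn n"
  by (auto simp: Zn_def Rn_def unit_vec_def)

lemma lincomb_in_Rn: "x \<in> Rn n \<Longrightarrow> y \<in> Rn n \<Longrightarrow> lincomb s x t y \<in> Rn n"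
  by (simp add: Rn_def lincomb_def)

lemma lincomb_in_Zn:
  "x \<in> Zn n \<Longrightarrow> y \<in> Zn n \<Longrightarrow> s \<in> \<int> \<Longrightarrow> t \<in> \<int> \<Longrightarrow> lincomb s x t y \<in> Zn n"
  by (simp add: Zn_iff lincomb_in_Rn) (simp add: lincomb_def)

lemma Rn_Suc_iff: "x \<in> Rn (Suc n) \<longleftrightarrow> x(n := 0) \<in> Rn n"
  unfolding Rn_def by (auto simp: Suc_le_eq)

lemma Rn_upd: "x \<in> Rn n \<Longrightarrow> x(n := t) \<in> Rn (Suc n)"
  by (auto simp: Rn_def)

lemma Rn_at: "x \<in> Rn n \<Longrightarrow> x n = 0"
  by (auto simp: Rn_def)

lemma Rn_mono: "x \<in> Rn n \<Longrightarrow> x \<in> Rn (Suc n)"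
  by (auto simp: Rn_def)

lemma Zn_mono: "x \<in> Zn n \<Longrightarrow> x \<in> Zn (Suc n)"
  by (auto simp: Zn_iff Rn_mono)

lemma Zn_upd: "x \<in> Zn n \<Longrightarrow> t \<in> \<int> \<Longrightarrow> x(n := t) \<in> Zn (Suc n)"
  by (auto simp: Zn_iff Rn_upd)

lemma Zn_drop: "x \<in> Zn (Suc n) \<Longrightarrow> x(n := 0) \<in> Zn n"
  by (auto simp: Zn_iff Rn_Suc_iff)

lemma Rn_zero_iff: "x \<in> Rn 0 \<longleftrightarrow> x = (\<lambda>_. 0)"
  by (auto simp: Rn_def)

text \<open>Functionals are arbitrary functions, while transposed maps are controlled only on
  \<open>Rn n\<close>; truncation moves a functional there without changing its values under
  \<open>dotn n\<close>.\<close>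

definition trunc :: "nat \<Rightarrow> (nat \<Rightarrow> real) \<Rightarrow> nat \<Rightarrow> real" where
  "trunc n a = (\<lambda>i. if i < n then a i else 0)"

lemma trunc_in_Rn: "trunc n a \<in> Rn n"
  by (simp add: trunc_def Rn_def)

lemma dotn_trunc: "dotn n (trunc n a) x = dotn n a x"
  by (simp add: dotn_def trunc_def)

section \<open>Rational polyhedra as finite systems of inequalities\<close>

definition sols :: "nat \<Rightarrow> ((nat \<Rightarrow> real) \<times> real) set \<Rightarrow> (nat \<Rightarrow> real) set" where
  "sols n S = {x \<in> Rn n. \<forall>p\<in>S. dotn n (fst p) x \<le> snd p}"

definition rat_ineq :: "nat \<Rightarrow> (nat \<Rightarrow> real) \<times> real \<Rightarrow> bool" where
  "rat_ineq n p \<longleftrightarrow> (\<forall>i<n. fst p i \<in> \<rat>) \<and> snd p \<in> \<rat>"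

lemma rational_polyhedron_iff:
  "rational_polyhedron n Q \<longleftrightarrow> (\<exists>S. finite S \<and> (\<forall>p\<in>S. rat_ineq n p) \<and> Q = sols n S)"
    (is "?L \<longleftrightarrow> ?R")
proof
  assume ?L
  then obtain m A b where *: "\<forall>j<m. b j \<in> \<rat> \<and> (\<forall>i<n. A j i \<in> \<rat>)"
    "Q = {x \<in> Rn n. \<forall>j<(m::nat). dotn n (A j) x \<le> b j}"
    unfolding rational_polyhedron_def by blast
  let ?S = "(\<lambda>j. (A j, b j)) ` {..<m}"
  have "finite ?S" "\<forall>p\<in>?S. rat_ineq n p" "Q = sols n ?S"
    using * by (auto simp: rat_ineq_def sols_def)
  then show ?R by blast
next
  assume ?R
  then obtain S where S: "finite S" "\<forall>p\<in>S. rat_ineq n p" "Q = sols n S" by blast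
  obtain m :: nat and f where f: "S = f ` {i. i < m}"
    using finite_imp_nat_seg_image_inj_on[OF S(1)] by blast
  have "(\<forall>j<m. snd (f j) \<in> \<rat> \<and> (\<forall>i<n. fst (f j) i \<in> \<rat>)) \<and>
      Q = {x \<in> Rn n. \<forall>j<m. dotn n (fst (f j)) x \<le> snd (f j)}"
    using S f by (auto simp: rat_ineq_def sols_def)
  then show ?L
    unfolding rational_polyhedron_def
    by (intro exI[of _ m] exI[of _ "\<lambda>j. fst (f j)"] exI[of _ "\<lambda>j. snd (f j)"])
qed

lemma rational_polyhedronI:
  "finite S \<Longrightarrow> \<forall>p\<in>S. rat_ineq n p \<Longrightarrow> Q = sols n S \<Longrightarrow> rational_polyhedron n Q"
  unfolding rational_polyhedron_iff by blast

lemma rational_polyhedronE: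
  assumes "rational_polyhedron n Q"
  obtains S where "finite S" "\<forall>p\<in>S. rat_ineq n p" "Q = sols n S"
  using assms unfolding rational_polyhedron_iff by blast

lemma rational_polyhedron_subset: "rational_polyhedron n Q \<Longrightarrow> Q \<subseteq> Rn n"
  unfolding rational_polyhedron_def by auto

lemma rational_polyhedron_Int_sols:
  assumes "rational_polyhedron n Q" "finite E" "\<forall>p\<in>E. rat_ineq n p"
  shows "rational_polyhedron n (Q \<inter> sols n E)"
proof -
  obtain S where "finite S" "\<forall>p\<in>S. rat_ineq n p" "Q = sols n S"
    using assms(1) by (rule rational_polyhedronE)
  then show ?thesis
    using assms by (intro rational_polyhedronI[of "S \<union> E"]) (auto simp: sols_def)
qed

definition convexn :: "(nat \<Rightarrow> real) set \<Rightarrow> bool" where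
  "convexn K \<longleftrightarrow> (\<forall>x\<in>K. \<forall>y\<in>K. \<forall>s\<ge>0. \<forall>t\<ge>0. s + t = 1 \<longrightarrow> lincomb s x t y \<in> K)"

lemma convexnD:
  "convexn K \<Longrightarrow> x \<in> K \<Longrightarrow> y \<in> K \<Longrightarrow> s \<ge> 0 \<Longrightarrow> t \<ge> 0 \<Longrightarrow> s + t = 1 \<Longrightarrow> lincomb s x t y \<in> K"
  unfolding convexn_def by blast

lemma convexn_sols: "convexn (sols n S)"
proof -
  have "s * dotn n a x + t * dotn n a y \<le> b"
    if "0 \<le> s" "0 \<le> t" "s + t = 1" "dotn n a x \<le> b" "dotn n a y \<le> b" for a b s t x y
  proof -
    have "s * dotn n a x + t * dotn n a y \<le> s * b + t * b"
      using that by (intro add_mono mult_left_mono)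
    also have "\<dots> = b" using that by (metis distrib_right mult_1)
    finally show ?thesis .
  qed
  then show ?thesis
    by (auto simp: convexn_def sols_def dotn_lincomb lincomb_in_Rn)
qed

lemma rational_polyhedron_convexn: "rational_polyhedron n Q \<Longrightarrow> convexn Q"
  by (metis rational_polyhedronE convexn_sols)

section \<open>Fourier--Motzkin elimination\<close>

definition fm_pair ::
  "nat \<Rightarrow> (nat \<Rightarrow> real) \<times> real \<Rightarrow> (nat \<Rightarrow> real) \<times> real \<Rightarrow> (nat \<Rightarrow> real) \<times> real" where
  "fm_pair n p q =
     (lincomb (- fst q n) (fst p) (fst p n) (fst q), - fst q n * snd p + fst p n * snd q)"

definition fm_elim :: "nat \<Rightarrow> ((nat \<Rightarrow> real) \<times> real) set \<Rightarrow> ((nat \<Rightarrow> real) \<times> real) set" where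
  "fm_elim n S = {p \<in> S. fst p n = 0} \<union>
     (\<lambda>(p, q). fm_pair n p q) ` ({p \<in> S. fst p n > 0} \<times> {q \<in> S. fst q n < 0})"

lemma finite_fm_elim: "finite S \<Longrightarrow> finite (fm_elim n S)"
  by (simp add: fm_elim_def)

lemma fm_elim_coeff: "p \<in> fm_elim n S \<Longrightarrow> fst p n = 0"
  by (auto simp: fm_elim_def fm_pair_def lincomb_def)

lemma fm_elim_rat:
  assumes "\<forall>p\<in>S. rat_ineq (Suc n) p" shows "\<forall>p\<in>fm_elim n S. rat_ineq n p"
proof -
  have "rat_ineq n (fm_pair n p q)" if "p \<in> S" "q \<in> S" for p q
    using assms that by (simp add: fm_pair_def rat_ineq_def lincomb_def)
  then show ?thesis
    using assms by (auto simp: fm_elim_def rat_ineq_def simp del: split_paired_All)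
qed

lemma fm_elim_sound:
  assumes "x \<in> Rn n" "x(n := t) \<in> sols (Suc n) S"
  shows "x \<in> sols n (fm_elim n S)"
proof -
  have *: "dotn n (fst p) x + fst p n * t \<le> snd p" if "p \<in> S" for p
    using assms(2) that by (auto simp: sols_def dotn_Suc)
  have "dotn n (fst (fm_pair n p q)) x \<le> snd (fm_pair n p q)"
    if "p \<in> S" "q \<in> S" "fst p n > 0" "fst q n < 0" for p q
  proof -
    have "- fst q n * (dotn n (fst p) x + fst p n * t) + fst p n * (dotn n (fst q) x + fst q n * t)
       \<le> - fst q n * snd p + fst p n * snd q"
      using that * by (intro add_mono mult_left_mono) auto
    then show ?thesis
      by (simp add: fm_pair_def dotn_lincomb_left algebra_simps)
  qed
  moreover have "dotn n (fst p) x \<le> snd p" if "p \<in> S" "fst p n = 0" for p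
    using *[OF that(1)] that by simp
  ultimately show ?thesis
    using assms(1) by (auto simp: sols_def fm_elim_def)
qed

text \<open>The combined inequalities say that each lower bound on the eliminated coordinate is at
  most each upper bound. The rationality clause lets rational points be built up one coordinate at a
  time.\<close>

lemma fm_elim_complete:
  assumes "finite S" "x \<in> sols n (fm_elim n S)"
  shows "\<exists>t. x(n := t) \<in> sols (Suc n) S \<and>
    ((\<forall>p\<in>S. rat_ineq (Suc n) p) \<longrightarrow> (\<forall>i<n. x i \<in> \<rat>) \<longrightarrow> t \<in> \<rat>)"
proof -
  define P where "P = {p \<in> S. fst p n > 0}"
  define N where "N = {p \<in> S. fst p n < 0}"
  define g where "g = (\<lambda>p. (snd p - dotn n (fst p) x) / fst p n)"
  have fin: "finite P" "finite N" using assms(1) by (simp_all add: P_def N_def)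
  have PN: "g q \<le> g p" if "p \<in> P" "q \<in> N" for p q
  proof -
    have s: "fst p n > 0" "fst q n < 0" using that by (auto simp: P_def N_def)
    have "fm_pair n p q \<in> fm_elim n S"
      using that by (force simp: fm_elim_def P_def N_def)
    then have "dotn n (fst (fm_pair n p q)) x \<le> snd (fm_pair n p q)"
      using assms(2) by (auto simp: sols_def)
    then have "fst p n * (dotn n (fst q) x - snd q) \<le> - fst q n * (snd p - dotn n (fst p) x)"
      by (simp add: fm_pair_def dotn_lincomb_left algebra_simps)
    then show ?thesis
      using s by (simp add: g_def divide_simps) (simp add: algebra_simps)
  qed
  \<comment> \<open>Taking one of the finitely many bounds, or 0 if there is none, is what makes
    \<open>t\<close> rational for rational data.\<close>
  define t where "t = (if P \<noteq> {} then Min (g ` P) else if N \<noteq> {} then Max (g ` N) else 0)"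
  have tP: "t \<le> g p" if "p \<in> P" for p
    using that fin by (auto simp: t_def)
  have tN: "g q \<le> t" if "q \<in> N" for q
    using that fin PN by (auto simp: t_def)
  have "dotn (Suc n) (fst p) (x(n := t)) \<le> snd p" if "p \<in> S" for p
  proof -
    have pS: "p \<in> S" by (fact that)
    consider "p \<in> P" | "p \<in> N" | "p \<in> fm_elim n S" "fst p n = 0"
    proof (cases "fst p n" "0 :: real" rule: linorder_cases)
      case less
      then show ?thesis using that(2) pS by (simp add: N_def)
    next
      case equal
      then show ?thesis using that(3) pS by (simp add: fm_elim_def)
    next
      case greater
      then show ?thesis using that(1) pS by (simp add: P_def)
    qed
    then show ?thesis
    proof cases
      case 1
      then have "fst p n > 0" by (simp add: P_def)
      then show ?thesis using tP[OF 1] by (simp add: g_def dotn_Suc field_simps)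
    next
      case 2
      then have "fst p n < 0" by (simp add: N_def)
      then show ?thesis using tN[OF 2] by (simp add: g_def dotn_Suc field_simps)
    next
      case 3
      then show ?thesis using assms(2) by (auto simp: dotn_Suc sols_def)
    qed
  qed
  moreover have "x(n := t) \<in> Rn (Suc n)"
    using assms(2) by (auto simp: sols_def Rn_upd)
  moreover have "t \<in> \<rat>" if r: "\<forall>p\<in>S. rat_ineq (Suc n) p" "\<forall>i<n. x i \<in> \<rat>"
  proof -
    have "g p \<in> \<rat>" if "p \<in> S" for p
    proof -
      have "dotn n (fst p) x \<in> \<rat>"
        using r that by (auto simp: dotn_def rat_ineq_def intro!: Rats_sum)
      then show ?thesis
        using r(1) that by (auto simp: g_def rat_ineq_def)
    qed
    moreover have "t \<in> g ` S \<or> t = 0"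
    proof -
      have "P \<noteq> {} \<Longrightarrow> Min (g ` P) \<in> g ` P" "N \<noteq> {} \<Longrightarrow> Max (g ` N) \<in> g ` N"
        using fin by (simp_all add: Min_in Max_in)
      moreover have "g ` P \<subseteq> g ` S" "g ` N \<subseteq> g ` S" by (auto simp: P_def N_def)
      ultimately show ?thesis unfolding t_def by (metis subsetD)
    qed
    ultimately show ?thesis by auto
  qed
  ultimately show ?thesis by (auto simp: sols_def)
qed

lemma rational_polyhedron_projection:
  assumes "rational_polyhedron (Suc n) Q"
  shows "rational_polyhedron n {x \<in> Rn n. \<exists>t. x(n := t) \<in> Q}"
proof -
  obtain S where S: "finite S" "\<forall>p\<in>S. rat_ineq (Suc n) p" "Q = sols (Suc n) S"
    using assms by (rule rational_polyhedronE)
  have "{x \<in> Rn n. \<exists>t. x(n := t) \<in> Q} = sols n (fm_elim n S)" (is "?L = ?R")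
  proof
    show "?L \<subseteq> ?R" unfolding S(3) by (blast intro: fm_elim_sound)
    have "?R \<subseteq> Rn n" by (auto simp: sols_def)
    then show "?R \<subseteq> ?L" unfolding S(3) using fm_elim_complete[OF S(1)] by blast
  qed
  then show ?thesis
    using S by (intro rational_polyhedronI[of "fm_elim n S"]) (auto simp: finite_fm_elim fm_elim_rat)
qed

lemma sols_rational_point:
  assumes "finite S" "\<forall>p\<in>S. rat_ineq n p" "sols n S \<noteq> {}"
  shows "\<exists>x\<in>sols n S. \<forall>i. x i \<in> \<rat>"
  using assms
proof (induction n arbitrary: S)
  case 0
  then show ?case by (force simp: sols_def Rn_def)
next
  case (Suc n)
  obtain x where x: "x \<in> sols (Suc n) S" using Suc.prems by blast
  then have "x(n := 0) \<in> sols n (fm_elim n S)"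
    by (intro fm_elim_sound[of _ _ "x n"]) (auto simp: sols_def Rn_Suc_iff)
  then obtain y where y: "y \<in> sols n (fm_elim n S)" "\<forall>i. y i \<in> \<rat>"
    using Suc.IH[of "fm_elim n S"] Suc.prems finite_fm_elim fm_elim_rat by blast
  then obtain t where "y(n := t) \<in> sols (Suc n) S" "t \<in> \<rat>"
    using fm_elim_complete[OF Suc.prems(1) y(1)] Suc.prems(2) by blast
  then show ?case
    using y by (intro bexI[of _ "y(n := t)"]) auto
qed

section \<open>Farkas' lemma\<close>

inductive_set ineq_cone :: "((nat \<Rightarrow> real) \<times> real) set \<Rightarrow> ((nat \<Rightarrow> real) \<times> real) set"
  for S where
  zero: "((\<lambda>_. 0), 0) \<in> ineq_cone S"
| add: "p \<in> ineq_cone S \<Longrightarrow> q \<in> S \<Longrightarrow> t \<ge> 0 \<Longrightarrow>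
    (lincomb 1 (fst p) t (fst q), snd p + t * snd q) \<in> ineq_cone S"

lemma ineq_cone_valid:
  assumes "p \<in> ineq_cone S" "x \<in> sols n S" shows "dotn n (fst p) x \<le> snd p"
  using assms
proof induction
  case (add p q t)
  then have "t * dotn n (fst q) x \<le> t * snd q" by (auto simp: sols_def intro!: mult_left_mono)
  then show ?case using add by (simp add: dotn_lincomb_left)
qed auto

lemma ineq_cone_fm_elim: "p \<in> ineq_cone (fm_elim n S) \<Longrightarrow> p \<in> ineq_cone S \<and> fst p n = 0"
proof (induction rule: ineq_cone.induct)
  case (add p q t)
  consider "q \<in> S" | p' q' where "q = fm_pair n p' q'" "p' \<in> S" "q' \<in> S" "fst p' n > 0" "fst q' n < 0"
    using add.hyps by (auto simp: fm_elim_def)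
  then have "(lincomb 1 (fst p) t (fst q), snd p + t * snd q) \<in> ineq_cone S"
  proof cases
    case 1
    then show ?thesis using add by (blast intro: ineq_cone.add)
  next
    case 2
    define r where "r = (lincomb 1 (fst p) (t * - fst q' n) (fst p'), snd p + t * - fst q' n * snd p')"
    have "r \<in> ineq_cone S"
      unfolding r_def using 2 add by (intro ineq_cone.add) (auto simp: mult_nonneg_nonpos)
    then have "(lincomb 1 (fst r) (t * fst p' n) (fst q'), snd r + t * fst p' n * snd q') \<in> ineq_cone S"
      using 2 add by (intro ineq_cone.add) auto
    also have "(lincomb 1 (fst r) (t * fst p' n) (fst q'), snd r + t * fst p' n * snd q')
        = (lincomb 1 (fst p) t (fst q), snd p + t * snd q)"
      by (auto simp: r_def 2 lincomb_def fm_pair_def algebra_simps)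
    finally show ?thesis .
  qed
  then show ?case
    using add fm_elim_coeff[OF add.hyps(2)] by (simp add: lincomb_def)
qed (auto intro: ineq_cone.zero)

text \<open>Eliminate all variables: an infeasible system in dimension zero contains an inequality
  that reads \<open>0 \<le> b\<close> with \<open>b < 0\<close>, and each elimination step forms
  only nonnegative combinations of the given inequalities.\<close>

lemma farkas:
  assumes "finite S" "sols n S = {}"
  shows "\<exists>p\<in>ineq_cone S. (\<forall>i<n. fst p i = 0) \<and> snd p < 0"
  using assms
proof (induction n arbitrary: S)
  case 0
  then obtain p where "p \<in> S" "snd p < 0"
    by (force simp: sols_def dotn_def Rn_zero_iff)
  then show ?case
    using ineq_cone.add[OF ineq_cone.zero, of p S 1]
    by (intro bexI[of _ "(lincomb 1 (\<lambda>_. 0) 1 (fst p), snd p)"]) auto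
next
  case (Suc n)
  have "sols n (fm_elim n S) = {}"
    using fm_elim_complete[OF Suc.prems(1)] Suc.prems(2) by blast
  then obtain p where "p \<in> ineq_cone (fm_elim n S)" "\<forall>i<n. fst p i = 0" "snd p < 0"
    using Suc.IH[of "fm_elim n S"] finite_fm_elim[OF Suc.prems(1)] by blast
  then show ?case
    using ineq_cone_fm_elim less_Suc_eq by metis
qed

lemma ineq_cone_insert:
  assumes "p \<in> ineq_cone (insert q S)"
  shows "\<exists>r\<in>ineq_cone S. \<exists>t\<ge>0. fst p = lincomb 1 (fst r) t (fst q) \<and> snd p = snd r + t * snd q"
  using assms
proof induction
  case zero
  show ?case by (intro bexI[OF _ ineq_cone.zero] exI[of _ 0]) (auto simp: lincomb_def)
next
  case (add p q' t)
  then obtain r u where r: "r \<in> ineq_cone S" "u \<ge> 0" "fst p = lincomb 1 (fst r) u (fst q)"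
    "snd p = snd r + u * snd q" by blast
  show ?case
  proof (cases "q' = q")
    case True
    then show ?thesis
      using r add.hyps by (intro bexI[OF _ r(1)] exI[of _ "u + t"]) (auto simp: lincomb_def algebra_simps)
  next
    case False
    then have "q' \<in> S" using add.hyps by blast
    then show ?thesis
      using r add.hyps by (intro bexI[OF _ ineq_cone.add[OF r(1) \<open>q' \<in> S\<close> add.hyps(3)]] exI[of _ u])
        (auto simp: lincomb_def algebra_simps)
  qed
qed

text \<open>Of the multipliers in Farkas' lemma only those of the two extra inequalities are kept; the
  others are summarised by the validity of the resulting inequality on \<open>Q\<close>.\<close>

lemma farkas_two:
  assumes "rational_polyhedron n Q"
    and "\<And>x. x \<in> Q \<Longrightarrow> dotn n c1 x \<ge> d1 \<Longrightarrow> dotn n c2 x \<ge> d2 \<Longrightarrow> False"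
  shows "\<exists>s\<ge>0. \<exists>t\<ge>0. \<exists>e>0. \<forall>x\<in>Q. s * dotn n c1 x + t * dotn n c2 x \<le> s * d1 + t * d2 - e"
proof -
  obtain S where S: "finite S" "Q = sols n S" using assms(1) by (metis rational_polyhedronE)
  define q where "q = ((\<lambda>i. - c1 i), - d1)"
  define r where "r = ((\<lambda>i. - c2 i), - d2)"
  have neg: "dotn n (\<lambda>i. - c i) x = - dotn n c x" for c x
    by (simp add: dotn_def sum_negf)
  have "sols n (insert q (insert r S)) = {}"
    using assms(2) unfolding S(2) by (force simp: sols_def q_def r_def neg)
  then obtain p where p: "p \<in> ineq_cone (insert q (insert r S))" "\<forall>i<n. fst p i = 0" "snd p < 0"
    using farkas[of "insert q (insert r S)" n] S(1) by blast
  obtain p1 s where p1: "p1 \<in> ineq_cone (insert r S)" "s \<ge> 0" "fst p = lincomb 1 (fst p1) s (fst q)"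
    "snd p = snd p1 + s * snd q" using ineq_cone_insert[OF p(1)] by blast
  obtain p2 t where p2: "p2 \<in> ineq_cone S" "t \<ge> 0" "fst p1 = lincomb 1 (fst p2) t (fst r)"
    "snd p1 = snd p2 + t * snd r" using ineq_cone_insert[OF p1(1)] by blast
  have "s * dotn n c1 x + t * dotn n c2 x \<le> s * d1 + t * d2 - (- snd p)" if "x \<in> Q" for x
  proof -
    have "dotn n (fst p) x = 0" using p(2) by (simp add: dotn_def)
    then have "dotn n (fst p2) x = s * dotn n c1 x + t * dotn n c2 x"
      by (simp add: p1 p2 dotn_lincomb_left q_def r_def neg)
    moreover have "dotn n (fst p2) x \<le> snd p2"
      using ineq_cone_valid[OF p2(1)] that S(2) by blast
    ultimately show ?thesis
      by (simp add: p1 p2 q_def r_def)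
  qed
  then show ?thesis using p1(2) p2(2) p(3) by (metis neg_0_less_iff_less)
qed

text \<open>A linear functional attains its supremum on a nonempty polyhedron if it is bounded
  above, so a strict bound leaves a gap. This gap is what allows rounding once a face has become
  empty.\<close>

lemma farkas_one:
  assumes "rational_polyhedron n Q" and "\<And>x. x \<in> Q \<Longrightarrow> dotn n c x < d"
  shows "\<exists>d'<d. \<forall>x\<in>Q. dotn n c x \<le> d'"
proof -
  obtain s t e where *: "s \<ge> 0" "t \<ge> 0" "e > 0"
    "\<And>x. x \<in> Q \<Longrightarrow> s * dotn n c x + t * dotn n c x \<le> s * d + t * d - e"
    using farkas_two[OF assms(1), where ?c1.0 = c and ?d1.0 = d and ?c2.0 = c and ?d2.0 = d] assms(2) by (metis linorder_not_less)
  show ?thesis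
  proof (cases "s + t = 0")
    \<comment> \<open>Vanishing multipliers leave \<open>0 \<le> - e\<close> at every point of
      \<open>Q\<close>, so there is no such point.\<close>
    case True
    then have "Q = {}" using * by (force simp: add_nonneg_eq_0_iff)
    then show ?thesis by (metis empty_iff lt_ex)
  next
    case False
    then have pos: "s + t > 0" using * by linarith
    have "dotn n c x \<le> d - e / (s + t)" if "x \<in> Q" for x
      using *(4)[OF that] pos by (simp add: field_simps)
    then show ?thesis using pos * by (intro exI[of _ "d - e / (s + t)"]) auto
  qed
qed

section \<open>Boundedness and integral rays\<close>

definition boundedn :: "nat \<Rightarrow> (nat \<Rightarrow> real) set \<Rightarrow> bool" where
  "boundedn n K \<longleftrightarrow> (\<forall>c. \<exists>B. \<forall>x\<in>K. \<bar>dotn n c x\<bar> \<le> B)"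

lemma unit_vec_rat: "unit_vec j i \<in> \<rat>"
  by (simp add: unit_vec_def)

lemma boundednI:
  assumes "\<And>i. i < n \<Longrightarrow> \<exists>B. \<forall>x\<in>K. \<bar>x i\<bar> \<le> B"
  shows "boundedn n K"
proof -
  obtain B where B: "\<And>i x. i < n \<Longrightarrow> x \<in> K \<Longrightarrow> \<bar>x i\<bar> \<le> B i" using assms by metis
  have "\<bar>dotn n c x\<bar> \<le> (\<Sum>i<n. \<bar>c i\<bar> * B i)" if "x \<in> K" for c x
    unfolding dotn_def using B that
    by (intro order_trans[OF sum_abs] sum_mono) (auto simp: abs_mult intro!: mult_left_mono)
  then show ?thesis unfolding boundedn_def by blast
qed

text \<open>The ray is a rational solution of the homogeneous system together with
  \<open>c r \<ge> 1\<close>. If that system were infeasible, a Farkas certificate would express a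
  positive multiple of \<open>c\<close> through the constraints and bound \<open>c\<close> on the
  polyhedron.\<close>

lemma sols_unbounded_rational_ray:
  assumes "finite S" "\<forall>p\<in>S. rat_ineq n p" "\<forall>i<n. c i \<in> \<rat>"
    and unb: "\<not> (\<exists>B. \<forall>x\<in>sols n S. dotn n c x \<le> B)"
  shows "\<exists>r\<in>Rn n. (\<forall>i. r i \<in> \<rat>) \<and> dotn n c r \<ge> 1 \<and> (\<forall>p\<in>S. dotn n (fst p) r \<le> 0)"
proof -
  let ?S0 = "(\<lambda>p. (fst p, 0)) ` S"
  let ?T = "insert ((\<lambda>i. - c i), -1) ?S0"
  have neg: "dotn n (\<lambda>i. - c i) x = - dotn n c x" for x
    by (simp add: dotn_def sum_negf)
  have T: "finite ?T" "\<forall>p\<in>?T. rat_ineq n p" using assms by (auto simp: rat_ineq_def)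
  have "sols n ?T \<noteq> {}"
  proof
    assume "sols n ?T = {}"
    then obtain p where p: "p \<in> ineq_cone ?T" "\<forall>i<n. fst p i = 0" "snd p < 0"
      using farkas[OF T(1)] by blast
    obtain q t where q: "q \<in> ineq_cone ?S0" "t \<ge> 0" "fst p = lincomb 1 (fst q) t (\<lambda>i. - c i)"
      "snd p = snd q - t" using ineq_cone_insert[OF p(1)] by auto
    \<comment> \<open>The multipliers of the homogeneous system, applied to the original one,
      produce some right-hand side \<open>b\<close>. Since \<open>snd p = - t < 0\<close>, dividing
      by \<open>t\<close> bounds \<open>c\<close> by \<open>b / t\<close>.\<close>
    have "snd q = 0 \<and> (\<exists>b. (fst q, b) \<in> ineq_cone S)"
      using q(1)
    proof induction
      case zero
      then show ?case using ineq_cone.zero by auto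
    next
      case (add q q' t)
      then obtain b b' where "(fst q, b) \<in> ineq_cone S" "(fst q', b') \<in> S" "snd q' = 0"
        by force
      then show ?case using ineq_cone.add[of "(fst q, b)" S "(fst q', b')" t] add by auto
    qed
    then obtain b where b: "snd q = 0" "(fst q, b) \<in> ineq_cone S" by blast
    have "dotn n c x \<le> b / t" if "x \<in> sols n S" for x
    proof -
      have "dotn n (fst p) x = 0" using p(2) by (simp add: dotn_def)
      then have "t * dotn n c x = dotn n (fst q) x" by (simp add: q dotn_lincomb_left neg)
      also have "\<dots> \<le> b" using ineq_cone_valid[OF b(2) that] by simp
      finally show ?thesis using q b p(3) by (simp add: field_simps)
    qed
    then show False using unb by blast
  qed
  then obtain r where r: "r \<in> sols n ?T" "\<forall>i. r i \<in> \<rat>"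
    using sols_rational_point[OF T] by blast
  then show ?thesis by (intro bexI[of _ r]) (auto simp: sols_def neg)
qed

lemma clear_denominators:
  fixes r :: "nat \<Rightarrow> real"
  assumes "\<forall>i<n. r i \<in> \<rat>"
  shows "\<exists>k::nat. k > 0 \<and> (\<forall>i<n. real k * r i \<in> \<int>)"
  using assms
proof (induction n)
  case (Suc n)
  then obtain k :: nat where k: "k > 0" "\<forall>i<n. real k * r i \<in> \<int>" by auto
  obtain a b where ab: "r n = of_int a / of_int b" "b > 0"
    using Suc.prems by (metis Rats_cases' lessI)
  have b: "real (nat b) = of_int b" using ab by simp
  have "real (k * nat b) * r i \<in> \<int>" if "i < Suc n" for i
  proof (cases "i = n")
    case True
    then show ?thesis using ab b by simp
  next
    case False
    then have "real k * r i \<in> \<int>" using k that by auto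
    then have "of_int b * (real k * r i) \<in> \<int>" by (rule Ints_mult[OF Ints_of_int])
    moreover have "real (k * nat b) * r i = of_int b * (real k * r i)" using b by simp
    ultimately show ?thesis by (simp only:)
  qed
  then show ?case using k ab by (intro exI[of _ "k * nat b"]) auto
qed auto

lemma bounded_or_integral_ray:
  assumes "rational_polyhedron n Q"
  shows "boundedn n Q \<or> (\<exists>r\<in>Zn n. r \<noteq> (\<lambda>_. 0) \<and> (\<forall>x\<in>Q. \<forall>t\<ge>0. lincomb 1 x t r \<in> Q))"
proof (rule disjCI)
  obtain S where S: "finite S" "\<forall>p\<in>S. rat_ineq n p" "Q = sols n S"
    using assms by (rule rational_polyhedronE)
  assume no_ray: "\<not> (\<exists>r\<in>Zn n. r \<noteq> (\<lambda>_. 0) \<and> (\<forall>x\<in>Q. \<forall>t\<ge>0. lincomb 1 x t r \<in> Q))"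
  have bd: "\<exists>B. \<forall>x\<in>Q. dotn n c x \<le> B" if c: "\<forall>i<n. c i \<in> \<rat>" for c
  proof (rule ccontr)
    assume "\<not> (\<exists>B. \<forall>x\<in>Q. dotn n c x \<le> B)"
    then obtain r where r: "r \<in> Rn n" "\<forall>i. r i \<in> \<rat>" "dotn n c r \<ge> 1" "\<forall>p\<in>S. dotn n (fst p) r \<le> 0"
      using sols_unbounded_rational_ray[OF S(1,2) c] unfolding S(3) by blast
    obtain k :: nat where k: "k > 0" "\<forall>i<n. real k * r i \<in> \<int>"
      using clear_denominators r(2) by blast
    define z where "z = (\<lambda>i. real k * r i)"
    have "z \<in> Zn n" using k r by (auto simp: Zn_def z_def Rn_def)
    moreover have "dotn n c z \<noteq> 0"
      using k r by (simp add: z_def dotn_scale)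
    then have "z \<noteq> (\<lambda>_. 0)" by auto
    moreover have "lincomb 1 x t z \<in> Q" if "x \<in> Q" "t \<ge> 0" for x t
    proof -
      have "t * (real k * dotn n (fst p) r) \<le> 0" if "p \<in> S" for p
        using r(4) \<open>t \<ge> 0\<close> that by (intro mult_nonneg_nonpos) auto
      then show ?thesis
        using that \<open>z \<in> Zn n\<close> Zn_subset_Rn unfolding S(3) sols_def
        by (force simp: dotn_lincomb z_def dotn_scale intro!: lincomb_in_Rn)
    qed
    ultimately show False using no_ray by blast
  qed
  show "boundedn n Q"
  proof (rule boundednI)
    fix i assume i: "i < n"
    obtain B1 where B1: "\<forall>x\<in>Q. dotn n (unit_vec i) x \<le> B1"
      using bd[of "unit_vec i"] unit_vec_rat by auto
    have "\<forall>j<n. - unit_vec i j \<in> \<rat>" using unit_vec_rat by auto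
    then obtain B2 where B2: "\<forall>x\<in>Q. dotn n (\<lambda>j. - unit_vec i j) x \<le> B2"
      using bd[of "\<lambda>j. - unit_vec i j"] by auto
    have "dotn n (\<lambda>j. - unit_vec i j) x = - x i" for x
      using i dotn_unit_vec[of i n x] by (simp add: dotn_def sum_negf)
    then show "\<exists>B. \<forall>x\<in>Q. \<bar>x i\<bar> \<le> B"
      using B1 B2 i by (intro exI[of _ "max B1 B2"]) (force simp: dotn_unit_vec)
  qed
qed

section \<open>Reductions by finitely many Chvatal--Gomory cuts per round\<close>

definition cg_cut :: "nat \<Rightarrow> (nat \<Rightarrow> real) set \<Rightarrow> (nat \<Rightarrow> real) \<times> real \<Rightarrow> bool" where
  "cg_cut n Q p \<longleftrightarrow> fst p \<in> Zn n \<and> snd p \<in> \<int> \<and> (\<exists>\<delta><snd p + 1. \<forall>x\<in>Q. dotn n (fst p) x \<le> \<delta>)"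

definition cut_off ::
  "nat \<Rightarrow> ((nat \<Rightarrow> real) \<times> real) set \<Rightarrow> (nat \<Rightarrow> real) set \<Rightarrow> (nat \<Rightarrow> real) set" where
  "cut_off n E Q = {x \<in> Q. \<forall>p\<in>E. dotn n (fst p) x \<le> snd p}"

text \<open>Using finitely many cuts per round keeps every intermediate set a rational polyhedron, so the
  polyhedrality of the Chvatal--Gomory closure itself is never needed.\<close>

primrec cg_red :: "nat \<Rightarrow> nat \<Rightarrow> (nat \<Rightarrow> real) set \<Rightarrow> (nat \<Rightarrow> real) set \<Rightarrow> bool" where
  "cg_red n 0 Q C \<longleftrightarrow> Q \<subseteq> C"
| "cg_red n (Suc k) Q C \<longleftrightarrow>
     (\<exists>E. finite E \<and> (\<forall>p\<in>E. cg_cut n Q p) \<and> cg_red n k (cut_off n E Q) C)"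

declare cg_red.simps(2) [simp del]

lemma cg_red_SucI:
  "finite E \<Longrightarrow> (\<And>p. p \<in> E \<Longrightarrow> cg_cut n Q p) \<Longrightarrow> cg_red n k (cut_off n E Q) C \<Longrightarrow> cg_red n (Suc k) Q C"
  by (auto simp: cg_red.simps(2))

lemma cg_red_SucE:
  assumes "cg_red n (Suc k) Q C"
  obtains E where "finite E" "\<forall>p\<in>E. cg_cut n Q p" "cg_red n k (cut_off n E Q) C"
  using assms by (auto simp: cg_red.simps(2))

lemma cg_cut_mono: "cg_cut n Q p \<Longrightarrow> Q' \<subseteq> Q \<Longrightarrow> cg_cut n Q' p"
  unfolding cg_cut_def by blast

lemma cut_off_mono: "Q' \<subseteq> Q \<Longrightarrow> cut_off n E Q' \<subseteq> cut_off n E Q"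
  by (auto simp: cut_off_def)

lemma cut_off_subset: "cut_off n E Q \<subseteq> Q"
  by (auto simp: cut_off_def)

lemma cut_off_rational_polyhedron:
  assumes "rational_polyhedron n Q" "finite E" "\<forall>p\<in>E. cg_cut n Q p"
  shows "rational_polyhedron n (cut_off n E Q)"
proof -
  have "\<forall>p\<in>E. rat_ineq n p"
    using assms(3) Ints_subset_Rats by (force simp: cg_cut_def rat_ineq_def Zn_iff)
  moreover have "cut_off n E Q = Q \<inter> sols n E"
    using rational_polyhedron_subset[OF assms(1)] by (auto simp: cut_off_def sols_def)
  ultimately show ?thesis
    using rational_polyhedron_Int_sols assms by simp
qed

lemma cut_off_Zn:
  assumes "\<forall>p\<in>E. cg_cut n Q p"
  shows "cut_off n E Q \<inter> Zn n = Q \<inter> Zn n"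
proof -
  have "dotn n (fst p) x \<le> snd p" if px: "p \<in> E" "x \<in> Q" "x \<in> Zn n" for p x
  proof -
    obtain a b where "dotn n (fst p) x = of_int a" "snd p = of_int b"
      using assms px dotn_Ints[of "fst p" n x] by (auto simp: cg_cut_def elim!: Ints_cases)
    moreover have "dotn n (fst p) x < snd p + 1" using assms px by (force simp: cg_cut_def)
    ultimately show ?thesis using of_int_less_iff[of a "b + 1", where ?'a = real] by simp
  qed
  then show ?thesis by (auto simp: cut_off_def)
qed

lemma cg_red_mono:
  assumes "cg_red n k Q C" "Q' \<subseteq> Q" "C \<subseteq> C'" shows "cg_red n k Q' C'"
  using assms
proof (induction k arbitrary: Q Q')
  case (Suc k)
  obtain E where E: "finite E" "\<forall>p\<in>E. cg_cut n Q p" "cg_red n k (cut_off n E Q) C"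
    by (rule cg_red_SucE[OF Suc.prems(1)])
  have "cg_red n k (cut_off n E Q') C'"
    by (rule Suc.IH[OF E(3) cut_off_mono[OF Suc.prems(2)] Suc.prems(3)])
  then show ?case using E Suc.prems(2) cg_cut_mono by (intro cg_red_SucI[of E]) auto
qed auto

lemma cg_red_Int: "cg_red n k Q C \<Longrightarrow> cg_red n k Q (C \<inter> Q)"
proof (induction k arbitrary: Q)
  case (Suc k)
  obtain E where E: "finite E" "\<forall>p\<in>E. cg_cut n Q p" "cg_red n k (cut_off n E Q) C"
    by (rule cg_red_SucE[OF Suc.prems])
  then have "cg_red n k (cut_off n E Q) (C \<inter> cut_off n E Q)" using Suc.IH by blast
  then have "cg_red n k (cut_off n E Q) (C \<inter> Q)"
    using cut_off_subset[of n E Q] by (auto intro: cg_red_mono)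
  then show ?case using E by (intro cg_red_SucI[of E]) auto
qed auto

lemma cg_red_triv: "Q \<subseteq> C \<Longrightarrow> cg_red n k Q C"
proof (induction k)
  case (Suc k)
  then show ?case by (intro cg_red_SucI[of "{}"]) (auto simp: cut_off_def)
qed simp

lemma cg_red_empty: "cg_red n k {} C"
  by (simp add: cg_red_triv)

lemma cg_red_le:
  assumes "cg_red n k Q C" "k \<le> k'" shows "cg_red n k' Q C"
  using assms
proof (induction k arbitrary: k' Q)
  case 0
  then have "Q \<subseteq> C" by simp
  then show ?case by (rule cg_red_triv)
next
  case (Suc k)
  obtain E where E: "finite E" "\<forall>p\<in>E. cg_cut n Q p" "cg_red n k (cut_off n E Q) C"
    by (rule cg_red_SucE[OF Suc.prems(1)])
  obtain l where l: "k' = Suc l" "k \<le> l" using Suc.prems(2) by (metis Suc_le_D Suc_le_mono)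
  show ?case unfolding l(1) using E Suc.IH[OF E(3) l(2)] by (intro cg_red_SucI[of E]) auto
qed

text \<open>The polyhedron reached after \<open>k\<close> rounds has no name in
  \<open>cg_red\<close>, so the second stage is required for every \<open>R\<close> with the
  properties that cuts preserve: rationality, containment in \<open>Q\<close>, and the integer
  points.\<close>

lemma cg_red_trans:
  assumes "rational_polyhedron n Q" "cg_red n k Q C"
    and "\<And>R. rational_polyhedron n R \<Longrightarrow> R \<subseteq> Q \<Longrightarrow> R \<subseteq> C \<Longrightarrow> R \<inter> Zn n = Q \<inter> Zn n \<Longrightarrow> cg_red n l R D"
  shows "cg_red n (k + l) Q D"
  using assms
proof (induction k arbitrary: Q)
  case (Suc k)
  obtain E where E: "finite E" "\<forall>p\<in>E. cg_cut n Q p" "cg_red n k (cut_off n E Q) C"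
    by (rule cg_red_SucE[OF Suc.prems(2)])
  have "cg_red n (k + l) (cut_off n E Q) D"
  proof (rule Suc.IH[OF cut_off_rational_polyhedron[OF Suc.prems(1) E(1,2)] E(3)])
    fix R
    assume "rational_polyhedron n R" "R \<subseteq> cut_off n E Q" "R \<subseteq> C" "R \<inter> Zn n = cut_off n E Q \<inter> Zn n"
    then show "cg_red n l R D"
      using cut_off_Zn[OF E(2)] cut_off_subset[of n E Q] by (intro Suc.prems(3)) auto
  qed
  then show ?case unfolding add_Suc using E by (intro cg_red_SucI[of E]) auto
qed simp

section \<open>From rounds of cuts to iterated closures\<close>

lemma cg_closure_mono: "Q' \<subseteq> Q \<Longrightarrow> cg_closure n Q' \<subseteq> cg_closure n Q"
  unfolding cg_closure_def by blast

lemma cg_closure_subset_cut_off: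
  assumes "\<forall>p\<in>E. cg_cut n Q p" shows "cg_closure n Q \<subseteq> cut_off n E Q"
proof
  fix x assume x: "x \<in> cg_closure n Q"
  have "dotn n (fst p) x \<le> snd p" if pE: "p \<in> E" for p
  proof -
    obtain \<delta> where d: "\<delta> < snd p + 1" "\<forall>y\<in>Q. dotn n (fst p) y \<le> \<delta>" "\<forall>i<n. fst p i \<in> \<int>" "snd p \<in> \<int>"
      using assms pE by (auto simp: cg_cut_def Zn_iff)
    then have "dotn n (fst p) x \<le> of_int \<lfloor>\<delta>\<rfloor>" using x by (simp add: cg_closure_def)
    also obtain m where "snd p = of_int m" using d by (auto elim: Ints_cases)
    then have "of_int \<lfloor>\<delta>\<rfloor> \<le> snd p" using d(1) by simp linarith
    finally show ?thesis .
  qed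
  then show "x \<in> cut_off n E Q" using x by (auto simp: cut_off_def cg_closure_def)
qed

lemma cg_red_cg_iter: "cg_red n k Q C \<Longrightarrow> cg_iter n k Q \<subseteq> C"
proof (induction k arbitrary: Q)
  case (Suc k)
  obtain E where E: "\<forall>p\<in>E. cg_cut n Q p" "cg_red n k (cut_off n E Q) C"
    by (rule cg_red_SucE[OF Suc.prems])
  have mono: "(cg_closure n ^^ j) A \<subseteq> (cg_closure n ^^ j) B" if "A \<subseteq> B" for j A B
    by (induction j) (auto simp: that dest: subsetD[OF cg_closure_mono])
  have "cg_iter n (Suc k) Q = cg_iter n k (cg_closure n Q)"
    by (simp add: cg_iter_def funpow_swap1)
  also have "\<dots> \<subseteq> cg_iter n k (cut_off n E Q)"
    unfolding cg_iter_def by (rule mono[OF cg_closure_subset_cut_off[OF E(1)]])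
  also have "\<dots> \<subseteq> C" by (rule Suc.IH[OF E(2)])
  finally show ?case .
qed (simp add: cg_iter_def)

subsection \<open>Faces\<close>

text \<open>The cut is rotated about the face. Farkas yields a real multiple \<open>s / t\<close> of
  the face inequality whose sum with \<open>p\<close> is valid on all of \<open>Q\<close>. Rounding
  the multiple up to an integer keeps validity because \<open>c0 x \<le> d0\<close>, makes the
  coefficients integral, and changes nothing on the face.\<close>

lemma lift_cg_cut:
  assumes Q: "rational_polyhedron n Q" and c0: "c0 \<in> Zn n" "d0 \<in> \<int>"
    and valid: "\<And>x. x \<in> Q \<Longrightarrow> dotn n c0 x \<le> d0"
    and p: "cg_cut n {x \<in> Q. dotn n c0 x = d0} p"
  shows "\<exists>q. cg_cut n Q q \<and>
    (\<forall>x. dotn n c0 x = d0 \<longrightarrow> dotn n (fst q) x \<le> snd q \<longrightarrow> dotn n (fst p) x \<le> snd p)"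
proof -
  obtain \<delta> where d: "fst p \<in> Zn n" "snd p \<in> \<int>" "\<delta> < snd p + 1"
    "\<And>x. x \<in> Q \<Longrightarrow> dotn n c0 x = d0 \<Longrightarrow> dotn n (fst p) x \<le> \<delta>"
    using p by (auto simp: cg_cut_def)
  \<comment> \<open>Above \<open>\<delta>\<close>, so that no point of the face reaches
    \<open>\<delta>'\<close> and Farkas applies; below \<open>snd p + 1\<close>, so that the lifted
    inequality still rounds as desired.\<close>
  define \<delta>' where "\<delta>' = (\<delta> + snd p + 1) / 2"
  have d': "\<delta> < \<delta>'" "\<delta>' < snd p + 1" using d(3) by (auto simp: \<delta>'_def)
  have infeasible: False if "x \<in> Q" "d0 \<le> dotn n c0 x" "\<delta>' \<le> dotn n (fst p) x" for x
    using valid[OF that(1)] d(4)[OF that(1)] d'(1) that by auto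
  have "\<exists>s\<ge>0. \<exists>t\<ge>0. \<exists>e>0. \<forall>x\<in>Q. s * dotn n c0 x + t * dotn n (fst p) x \<le> s * d0 + t * \<delta>' - e"
    by (rule farkas_two[OF Q]) (rule infeasible)
  then obtain s t e where f: "s \<ge> 0" "t \<ge> 0" "e > 0"
    "\<And>x. x \<in> Q \<Longrightarrow> s * dotn n c0 x + t * dotn n (fst p) x \<le> s * d0 + t * \<delta>' - e"
    by auto
  show ?thesis
  proof (cases "t = 0")
    \<comment> \<open>A certificate without weight on \<open>p\<close> shows that the face is empty.
      Then \<open>c0 x \<le> d0 - 1\<close> is itself a cut, and it excludes the whole
      hyperplane.\<close>
    case True
    have "dotn n c0 x < d0" if "x \<in> Q" for x
      using f(4)[OF that] f(3) valid[OF that] True by (cases "dotn n c0 x = d0") auto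
    then obtain d1 where "d1 < d0" "\<forall>x\<in>Q. dotn n c0 x \<le> d1" using farkas_one[OF Q] by blast
    then show ?thesis
      using c0 by (intro exI[of _ "(c0, d0 - 1)"]) (auto simp: cg_cut_def)
  next
    case False
    then have t: "t > 0" using f by simp
    define k :: real where "k = of_int \<lceil>s / t\<rceil>"
    have k: "k \<in> \<int>" "k \<ge> s / t" by (auto simp: k_def)
    let ?q = "(lincomb 1 (fst p) k c0, snd p + k * d0)"
    have "dotn n (fst p) x + k * dotn n c0 x \<le> \<delta>' + k * d0" if "x \<in> Q" for x
    proof -
      have "t * (dotn n (fst p) x + s / t * dotn n c0 x) \<le> t * (\<delta>' + s / t * d0)"
        using f(4)[OF that] f(3) t by (simp add: algebra_simps)
      then have "dotn n (fst p) x + s / t * dotn n c0 x \<le> \<delta>' + s / t * d0"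
        using t by simp
      moreover have "(k - s / t) * dotn n c0 x \<le> (k - s / t) * d0"
        using k valid[OF that] by (intro mult_left_mono) auto
      ultimately show ?thesis by (simp add: algebra_simps)
    qed
    then have "cg_cut n Q ?q"
      using d d' k c0 unfolding cg_cut_def
      by (auto simp: dotn_lincomb_left intro!: lincomb_in_Zn exI[of _ "\<delta>' + k * d0"])
    then show ?thesis
      by (intro exI[of _ ?q]) (simp add: dotn_lincomb_left)
  qed
qed

text \<open>Rounds on the face are lifted cut by cut. What the lifted cuts leave on the hyperplane
  is contained in what the original round leaves, so the number of rounds does not grow.\<close>

lemma cg_red_face:
  assumes "rational_polyhedron n Q" and c0: "c0 \<in> Zn n" "d0 \<in> \<int>"
    and "\<And>x. x \<in> Q \<Longrightarrow> dotn n c0 x \<le> d0"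
    and "cg_red n k {x \<in> Q. dotn n c0 x = d0} C"
  shows "cg_red n k Q {x. dotn n c0 x = d0 \<longrightarrow> x \<in> C}"
  using assms(1,4,5)
proof (induction k arbitrary: Q)
  case (Suc k)
  let ?F = "{x \<in> Q. dotn n c0 x = d0}"
  obtain E where E: "finite E" "\<forall>p\<in>E. cg_cut n ?F p" "cg_red n k (cut_off n E ?F) C"
    using Suc.prems(3) by (rule cg_red_SucE)
  have "\<forall>p\<in>E. \<exists>q. cg_cut n Q q \<and>
      (\<forall>x. dotn n c0 x = d0 \<longrightarrow> dotn n (fst q) x \<le> snd q \<longrightarrow> dotn n (fst p) x \<le> snd p)"
    using lift_cg_cut[OF Suc.prems(1) c0 Suc.prems(2)] E(2) by blast
  then obtain g where g: "\<And>p. p \<in> E \<Longrightarrow> cg_cut n Q (g p)"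
    "\<And>p x. p \<in> E \<Longrightarrow> dotn n c0 x = d0 \<Longrightarrow> dotn n (fst (g p)) x \<le> snd (g p) \<Longrightarrow> dotn n (fst p) x \<le> snd p"
    by metis
  have gE: "finite (g ` E)" "\<forall>p\<in>g ` E. cg_cut n Q p" using E g by auto
  have "{x \<in> cut_off n (g ` E) Q. dotn n c0 x = d0} \<subseteq> cut_off n E ?F"
    using g(2) by (auto simp: cut_off_def)
  then have "cg_red n k {x \<in> cut_off n (g ` E) Q. dotn n c0 x = d0} C"
    by (rule cg_red_mono[OF E(3) _ order_refl])
  then have "cg_red n k (cut_off n (g ` E) Q) {x. dotn n c0 x = d0 \<longrightarrow> x \<in> C}"
    using Suc.prems(2) cut_off_subset[of n "g ` E" Q]
    by (intro Suc.IH[OF cut_off_rational_polyhedron[OF Suc.prems(1) gE]]) auto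
  then show ?case using gE by (intro cg_red_SucI[of "g ` E"]) auto
qed auto

text \<open>After \<open>k\<close> rounds the face \<open>c0 x = d0\<close> is gone, hence
  \<open>c0\<close> stays below \<open>d0\<close> by a positive gap, and one more round lowers the
  bound to the next integer.\<close>

lemma cg_red_push:
  assumes Q: "rational_polyhedron n Q" and c0: "c0 \<in> Zn n" "d0 \<in> \<int>"
    and "\<And>x. x \<in> Q \<Longrightarrow> dotn n c0 x \<le> d0"
    and "cg_red n k {x \<in> Q. dotn n c0 x = d0} {}"
  shows "cg_red n (Suc k) Q {x. dotn n c0 x \<le> d0 - 1}"
proof -
  have "cg_red n (k + 1) Q {x. dotn n c0 x \<le> d0 - 1}"
  proof (rule cg_red_trans[OF Q cg_red_face[OF assms]])
    fix R assume R: "rational_polyhedron n R" "R \<subseteq> Q" "R \<subseteq> {x. dotn n c0 x = d0 \<longrightarrow> x \<in> {}}"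
    then have "dotn n c0 x < d0" if "x \<in> R" for x
      using assms(4)[of x] that by (auto simp: order_less_le)
    then obtain d1 where "d1 < d0" "\<forall>x\<in>R. dotn n c0 x \<le> d1" using farkas_one[OF R(1)] by blast
    then have "cg_cut n R (c0, d0 - 1)" using c0 by (auto simp: cg_cut_def)
    then show "cg_red n 1 R {x. dotn n c0 x \<le> d0 - 1}"
      unfolding One_nat_def by (intro cg_red_SucI[of "{(c0, d0 - 1)}"]) (auto simp: cut_off_def)
  qed
  then show ?thesis by simp
qed

lemma cg_red_push_iter:
  assumes Q: "rational_polyhedron n Q" and c0: "c0 \<in> Zn n" "d0 \<in> \<int>"
    and "\<And>x. x \<in> Q \<Longrightarrow> dotn n c0 x \<le> d0 + real m"
    and "\<And>j. d0 < j \<Longrightarrow> j \<in> \<int> \<Longrightarrow> cg_red n k {x \<in> Q. dotn n c0 x = j} {}"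
  shows "cg_red n (m * Suc k) Q {x. dotn n c0 x \<le> d0}"
  using Q assms(4,5)
proof (induction m arbitrary: Q)
  case (Suc m)
  have "cg_red n (Suc k) Q {x. dotn n c0 x \<le> d0 + real (Suc m) - 1}"
    using Suc.prems c0 by (intro cg_red_push) auto
  then have "cg_red n (Suc k + m * Suc k) Q {x. dotn n c0 x \<le> d0}"
  proof (rule cg_red_trans[OF Suc.prems(1)])
    fix R assume R: "rational_polyhedron n R" "R \<subseteq> Q" "R \<subseteq> {x. dotn n c0 x \<le> d0 + real (Suc m) - 1}"
    have "cg_red n k {x \<in> R. dotn n c0 x = j} {}" if "d0 < j" "j \<in> \<int>" for j
      using Suc.prems(3)[OF that] R(2) by (auto intro: cg_red_mono)
    then show "cg_red n (m * Suc k) R {x. dotn n c0 x \<le> d0}"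
      using R by (intro Suc.IH) auto
  qed
  then show ?case by (simp only: mult_Suc)
qed auto

subsection \<open>Integral affine maps\<close>

text \<open>Phrased through functionals instead of a matrix, because this is what pulls cuts back to
  cuts: the right-hand side is merely shifted by the integer \<open>z\<close>.\<close>

definition integral_affine :: "nat \<Rightarrow> nat \<Rightarrow> ((nat \<Rightarrow> real) \<Rightarrow> nat \<Rightarrow> real) \<Rightarrow> bool" where
  "integral_affine m n \<psi> \<longleftrightarrow>
     (\<forall>c\<in>Zn n. \<exists>c'\<in>Zn m. \<exists>z\<in>\<int>. \<forall>x\<in>Rn m. dotn n c (\<psi> x) = dotn m c' x + z)"

lemma cg_red_pullback:
  assumes \<psi>: "integral_affine m n \<psi>" and "cg_red n k Q C"
  shows "cg_red m k {x \<in> Rn m. \<psi> x \<in> Q} {x. \<psi> x \<in> C}"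
  using assms(2)
proof (induction k arbitrary: Q)
  case (Suc k)
  obtain E where E: "finite E" "\<forall>p\<in>E. cg_cut n Q p" "cg_red n k (cut_off n E Q) C"
    by (rule cg_red_SucE[OF Suc.prems])
  let ?Q = "{x \<in> Rn m. \<psi> x \<in> Q}"
  have "\<exists>q. cg_cut m ?Q q \<and> (\<forall>x\<in>Rn m. dotn m (fst q) x \<le> snd q \<longleftrightarrow> dotn n (fst p) (\<psi> x) \<le> snd p)"
    if pE: "p \<in> E" for p
  proof -
    obtain \<delta> where d: "fst p \<in> Zn n" "snd p \<in> \<int>" "\<delta> < snd p + 1" "\<forall>x\<in>Q. dotn n (fst p) x \<le> \<delta>"
      using E(2) pE by (auto simp: cg_cut_def)
    obtain c' z where c': "c' \<in> Zn m" "z \<in> \<int>" "\<And>x. x \<in> Rn m \<Longrightarrow> dotn n (fst p) (\<psi> x) = dotn m c' x + z"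
      using \<psi> d(1) unfolding integral_affine_def by blast
    have "dotn m c' x \<le> \<delta> - z" if "x \<in> ?Q" for x
    proof -
      have "dotn n (fst p) (\<psi> x) \<le> \<delta>" using d(4) that by auto
      then show ?thesis using c'(3)[of x] that by auto
    qed
    then have "cg_cut m ?Q (c', snd p - z)"
      using c' d unfolding cg_cut_def by (auto intro!: exI[of _ "\<delta> - z"])
    then show ?thesis
      by (intro exI[of _ "(c', snd p - z)"]) (auto simp: c'(3))
  qed
  then have "\<forall>p\<in>E. \<exists>q. cg_cut m ?Q q \<and>
      (\<forall>x\<in>Rn m. dotn m (fst q) x \<le> snd q \<longleftrightarrow> dotn n (fst p) (\<psi> x) \<le> snd p)"
    by blast
  from bchoice[OF this] obtain g where g: "\<And>p. p \<in> E \<Longrightarrow> cg_cut m ?Q (g p)"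
    "\<And>p x. p \<in> E \<Longrightarrow> x \<in> Rn m \<Longrightarrow> dotn m (fst (g p)) x \<le> snd (g p) \<longleftrightarrow> dotn n (fst p) (\<psi> x) \<le> snd p"
    by blast
  have "cut_off m (g ` E) ?Q = {x \<in> Rn m. \<psi> x \<in> cut_off n E Q}"
    using g(2) by (auto simp: cut_off_def)
  then have "cg_red m k (cut_off m (g ` E) ?Q) {x. \<psi> x \<in> C}"
    using Suc.IH[OF E(3)] by simp
  then show ?case using E(1) g(1) by (intro cg_red_SucI[of "g ` E"]) auto
qed auto

lemma integral_affine_drop: "integral_affine (Suc n) n (\<lambda>x. x(n := 0))"
proof -
  have "dotn n c (x(n := 0)) = dotn (Suc n) c x + 0" if "c \<in> Zn n" for c x
    using that by (simp add: dotn_Suc Zn_iff Rn_at)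
  then show ?thesis unfolding integral_affine_def by (metis Ints_0 Zn_mono)
qed

lemma integral_affine_translate:
  assumes "z \<in> Zn n" shows "integral_affine n n (\<lambda>x. lincomb 1 x (-1) z)"
proof -
  have "dotn n c (lincomb 1 x (-1) z) = dotn n c x + - dotn n c z" for c x
    by (simp add: dotn_lincomb)
  then show ?thesis
    using assms unfolding integral_affine_def by (metis Ints_minus dotn_Ints)
qed

text \<open>\<open>Q\<close> lies in the preimage of its projection, and a cut of the projection is
  a cut of \<open>Q\<close> that ignores the last coordinate.\<close>

lemma cg_red_project:
  assumes "cg_red n k {x \<in> Rn n. \<exists>t. x(n := t) \<in> Q} C" "Q \<subseteq> Rn (Suc n)"
  shows "cg_red (Suc n) k Q {x. x(n := 0) \<in> C}"
proof (rule cg_red_mono[OF cg_red_pullback[OF integral_affine_drop assms(1)]])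
  have "(x(n := 0))(n := x n) \<in> Q" if "x \<in> Q" for x using that by simp
  then show "Q \<subseteq> {x \<in> Rn (Suc n). x(n := 0) \<in> {x \<in> Rn n. \<exists>t. x(n := t) \<in> Q}}"
    using assms(2) Rn_Suc_iff by blast
qed auto

lemma cg_red_slice:
  assumes "cg_red n k {x \<in> Rn n. x(n := j) \<in> Q} C" "Q \<subseteq> Rn (Suc n)"
  shows "cg_red (Suc n) k {x \<in> Q. x n = j} {x. x(n := 0) \<in> C}"
proof (rule cg_red_mono[OF cg_red_pullback[OF integral_affine_drop assms(1)]])
  have "x(n := 0, n := j) \<in> Q" if "x \<in> Q" "x n = j" for x using that by auto
  then show "{x \<in> Q. x n = j} \<subseteq> {x \<in> Rn (Suc n). x(n := 0) \<in> {x \<in> Rn n. x(n := j) \<in> Q}}"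
    using assms(2) Rn_Suc_iff by blast
qed auto

lemma rational_polyhedron_slice:
  assumes "rational_polyhedron (Suc n) Q" "j \<in> \<rat>"
  shows "rational_polyhedron n {x \<in> Rn n. x(n := j) \<in> Q}"
proof -
  obtain S where S: "finite S" "\<forall>p\<in>S. rat_ineq (Suc n) p" "Q = sols (Suc n) S"
    using assms by (blast elim: rational_polyhedronE)
  let ?g = "\<lambda>p. (fst p, snd p - fst p n * j)"
  have "{x \<in> Rn n. x(n := j) \<in> Q} = sols n (?g ` S)"
    unfolding S(3) by (auto simp: sols_def dotn_Suc Rn_upd algebra_simps)
  then show ?thesis
    using S assms(2) by (intro rational_polyhedronI[of "?g ` S"]) (auto simp: rat_ineq_def)
qed

section \<open>Unimodular maps\<close>

definition preserves_grids :: "nat \<Rightarrow> ((nat \<Rightarrow> real) \<Rightarrow> nat \<Rightarrow> real) \<Rightarrow> bool" where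
  "preserves_grids n h \<longleftrightarrow> (\<forall>x\<in>Rn n. h x \<in> Rn n \<and> ((\<forall>i. x i \<in> \<int>) \<longrightarrow> (\<forall>i. h x i \<in> \<int>)) \<and>
     ((\<forall>i. x i \<in> \<rat>) \<longrightarrow> (\<forall>i. h x i \<in> \<rat>)))"

text \<open>\<open>f'\<close> is the inverse of \<open>f\<close>, and \<open>t\<close>, \<open>t'\<close> are the transposes of \<open>f\<close>, \<open>f'\<close>. Carrying all four maps
  makes the notion visibly closed under composition, inversion and transposition.\<close>

definition unimod where
  "unimod n f f' t t' \<longleftrightarrow>
     preserves_grids n f \<and> preserves_grids n f' \<and> preserves_grids n t \<and> preserves_grids n t' \<and>
     (\<forall>x\<in>Rn n. f (f' x) = x \<and> f' (f x) = x \<and> t (t' x) = x \<and> t' (t x) = x) \<and>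
     (\<forall>a\<in>Rn n. \<forall>x\<in>Rn n. dotn n a (f x) = dotn n (t a) x \<and> dotn n a (f' x) = dotn n (t' a) x)"

lemma unimod_inverse: "unimod n f f' t t' \<Longrightarrow> unimod n f' f t' t"
  by (simp add: unimod_def)

lemma unimod_transpose: "unimod n f f' t t' \<Longrightarrow> unimod n t t' f f'"
  unfolding unimod_def by (metis dotn_commute)

lemma unimod_comp:
  assumes "unimod n f f' t t'" "unimod n g g' u u'"
  shows "unimod n (f \<circ> g) (g' \<circ> f') (u \<circ> t) (t' \<circ> u')"
  using assms by (simp add: unimod_def preserves_grids_def)

lemma
  assumes "unimod n f f' t t'"
  shows unimod_Rn: "x \<in> Rn n \<Longrightarrow> f x \<in> Rn n"
    and unimod_Zn: "x \<in> Zn n \<Longrightarrow> f x \<in> Zn n"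
    and unimod_rat: "x \<in> Rn n \<Longrightarrow> (\<forall>i. x i \<in> \<rat>) \<Longrightarrow> f x i \<in> \<rat>"
    and unimod_left_inv: "x \<in> Rn n \<Longrightarrow> f' (f x) = x"
    and unimod_right_inv: "x \<in> Rn n \<Longrightarrow> f (f' x) = x"
    and unimod_adjoint: "a \<in> Rn n \<Longrightarrow> x \<in> Rn n \<Longrightarrow> dotn n a (f x) = dotn n (t a) x"
  using assms by (auto simp: unimod_def preserves_grids_def Zn_iff)

lemma unimod_id: "unimod n (\<lambda>x. x) (\<lambda>x. x) (\<lambda>x. x) (\<lambda>x. x)"
  by (simp add: unimod_def preserves_grids_def)

section \<open>Elementary unimodular maps and Euclid's algorithm\<close>

definition shear :: "nat \<Rightarrow> nat \<Rightarrow> real \<Rightarrow> (nat \<Rightarrow> real) \<Rightarrow> nat \<Rightarrow> real" where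
  "shear i j k x = x(i := x i + k * x j)"

lemma dotn_upd_at:
  assumes "i < n" shows "dotn n a (x(i := y)) = dotn n a x + a i * (y - x i)"
proof -
  have "a l * (x(i := y)) l = a l * x l + (if l = i then a i * (y - x i) else 0)" for l
    by (simp add: algebra_simps)
  then have "dotn n a (x(i := y)) = dotn n a x + (\<Sum>l<n. if l = i then a i * (y - x i) else 0)"
    unfolding dotn_def by (simp only: sum.distrib)
  then show ?thesis using assms by simp
qed

lemma unimod_shear:
  assumes "i < n" "j < n" "i \<noteq> j" "k \<in> \<int>"
  shows "unimod n (shear i j k) (shear i j (- k)) (shear j i k) (shear j i (- k))"
proof -
  have inv: "shear i j l (shear i j (- l) x) = x" "shear i j (- l) (shear i j l x) = x"
    if "i \<noteq> j" for i j l x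
    using that by (auto simp: shear_def)
  have "k \<in> \<rat>" using assms(4) Ints_subset_Rats by blast
  then have "preserves_grids n (shear i j l)" if "i < n" "l = k \<or> l = - k" for i j l
    using assms that by (auto simp: preserves_grids_def shear_def Rn_def)
  moreover have "dotn n a (shear i j l x) = dotn n (shear j i l a) x" if "i < n" "j < n" for i j l a x
  proof -
    have "dotn n a (shear i j l x) = dotn n a x + a i * (l * x j)"
      using that by (simp add: shear_def dotn_upd_at)
    also have "\<dots> = dotn n x (shear j i l a)"
      using that by (simp add: shear_def dotn_upd_at dotn_commute[of n a])
    finally show ?thesis by (simp add: dotn_commute)
  qed
  ultimately show ?thesis
    using assms unfolding unimod_def by (auto simp: inv)
qed

definition neg_at :: "nat \<Rightarrow> (nat \<Rightarrow> real) \<Rightarrow> nat \<Rightarrow> real" where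
  "neg_at i x = x(i := - x i)"

lemma unimod_neg_at:
  assumes "i < n" shows "unimod n (neg_at i) (neg_at i) (neg_at i) (neg_at i)"
proof -
  have "preserves_grids n (neg_at i)"
    using assms by (auto simp: preserves_grids_def neg_at_def Rn_def)
  moreover have "dotn n a (neg_at i x) = dotn n (neg_at i a) x" for a x
  proof -
    have "dotn n b (neg_at i y) = dotn n b y - 2 * (b i * y i)" for b y
      using dotn_upd_at[OF assms, of b y "- y i"] by (simp add: neg_at_def algebra_simps)
    then have "dotn n a (neg_at i x) = dotn n x (neg_at i a)"
      by (simp add: dotn_commute[of n a x] mult.commute)
    then show ?thesis by (simp add: dotn_commute[of n x])
  qed
  ultimately show ?thesis by (simp add: unimod_def neg_at_def)
qed

text \<open>Euclid's algorithm: of two nonzero entries the smaller is added to or subtracted from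
  the larger, which lowers the integer sum of absolute values. The last surviving entry is moved to
  position \<open>n\<close> and made positive.\<close>

lemma unimod_reduce_vector:
  assumes "r \<in> Zn (Suc n)" "r \<noteq> (\<lambda>_. 0)"
  shows "\<exists>f f' t t' g. unimod (Suc n) f f' t t' \<and> g \<in> \<int> \<and> g > 0 \<and> f r = (\<lambda>_. 0)(n := g)"
  using assms
proof (induction "nat \<lfloor>\<Sum>l<Suc n. \<bar>r l\<bar>\<rfloor>" arbitrary: r rule: less_induct)
  case less
  have int: "\<And>i. r i \<in> \<int>" and Rn: "r \<in> Rn (Suc n)" using less.prems by (auto simp: Zn_iff)
  show ?case
  proof (cases "\<exists>i<Suc n. \<exists>j<Suc n. i \<noteq> j \<and> r i \<noteq> 0 \<and> r j \<noteq> 0")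
    case True
    then obtain i j where ij: "i < Suc n" "j < Suc n" "i \<noteq> j" "r i \<noteq> 0" "r j \<noteq> 0" "\<bar>r j\<bar> \<le> \<bar>r i\<bar>"
      by (metis linorder_linear)
    define k :: real where "k = (if (r i > 0) = (r j > 0) then -1 else 1)"
    have k: "k \<in> \<int>" by (simp add: k_def)
    define s where "s = shear i j k r"
    have um: "unimod (Suc n) (shear i j k) (shear i j (- k)) (shear j i k) (shear j i (- k))"
      using ij k by (intro unimod_shear)
    have s: "s \<in> Zn (Suc n)" unfolding s_def by (rule unimod_Zn[OF um less.prems(1)])
    have "\<bar>s i\<bar> < \<bar>r i\<bar>" using ij by (auto simp: s_def shear_def k_def split: if_splits)
    then have "(\<Sum>l<Suc n. \<bar>s l\<bar>) < (\<Sum>l<Suc n. \<bar>r l\<bar>)"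
      using ij by (intro sum_strict_mono_ex1) (auto simp: s_def shear_def)
    moreover have "(\<Sum>l<Suc n. \<bar>s l\<bar>) \<in> \<int>" "(\<Sum>l<Suc n. \<bar>r l\<bar>) \<in> \<int>"
      using s int by (auto simp: Zn_iff intro!: Ints_sum Ints_abs simp del: sum.lessThan_Suc)
    then obtain a b where ab: "(\<Sum>l<Suc n. \<bar>s l\<bar>) = of_int a" "(\<Sum>l<Suc n. \<bar>r l\<bar>) = of_int b"
      by (auto elim!: Ints_cases simp del: sum.lessThan_Suc)
    moreover have "(\<Sum>l<Suc n. \<bar>s l\<bar>) \<ge> 0" by (intro sum_nonneg) auto
    then have "a \<ge> 0" unfolding ab by simp
    ultimately have "nat \<lfloor>\<Sum>l<Suc n. \<bar>s l\<bar>\<rfloor> < nat \<lfloor>\<Sum>l<Suc n. \<bar>r l\<bar>\<rfloor>"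
      by (simp del: sum.lessThan_Suc)
    moreover have "s j \<noteq> 0" using ij by (simp add: s_def shear_def)
    then have "s \<noteq> (\<lambda>_. 0)" by auto
    ultimately obtain f f' t t' g where "unimod (Suc n) f f' t t'" "g \<in> \<int>" "g > 0" "f s = (\<lambda>_. 0)(n := g)"
      using less.hyps[of s] s by blast
    moreover from this have "(f \<circ> shear i j k) r = (\<lambda>_. 0)(n := g)" by (simp add: s_def)
    ultimately show ?thesis using unimod_comp[OF _ um] by blast
  next
    case False
    obtain i where i: "r i \<noteq> 0" using less.prems(2) by blast
    then have iS: "i < Suc n" using Rn by (cases "i < Suc n") (auto simp: Rn_def)
    have r0: "r l = 0" if "l \<noteq> i" for l
      using False i iS Rn that by (cases "l < Suc n") (auto simp: Rn_def)
    then have ri: "r = (\<lambda>_. 0)(i := r i)" by auto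
    have "\<exists>f f' t t'. unimod (Suc n) f f' t t' \<and> f r = (\<lambda>_. 0)(n := r i)"
    proof (cases "i = n")
      case True
      then show ?thesis using unimod_id ri by blast
    next
      case False
      \<comment> \<open>In place of a transposition: entry \<open>i\<close> is first added to
        position \<open>n\<close>, which holds zero, and then cancelled in position
        \<open>i\<close>.\<close>
      have "unimod (Suc n) (shear n i 1) (shear n i (- 1)) (shear i n 1) (shear i n (- 1))"
        "unimod (Suc n) (shear i n (- 1)) (shear i n 1) (shear n i (- 1)) (shear n i 1)"
        using False iS unimod_shear[of n "Suc n" i 1] unimod_shear[of i "Suc n" n "-1"] by auto
      from unimod_comp[OF this(2,1)] show ?thesis
      proof (intro exI conjI)
        show "(shear i n (- 1) \<circ> shear n i 1) r = (\<lambda>_. 0)(n := r i)"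
          using False by (auto simp: shear_def fun_eq_iff r0)
      qed
    qed
    then obtain f f' t t' where f: "unimod (Suc n) f f' t t'" "f r = (\<lambda>_. 0)(n := r i)" by blast
    show ?thesis
    proof (cases "r i > 0")
      case True
      then show ?thesis using f int by blast
    next
      case False
      then have "- r i > 0" "- r i \<in> \<int>" using i int by auto
      moreover have "(neg_at n \<circ> f) r = (\<lambda>_. 0)(n := - r i)" using f(2) by (simp add: neg_at_def)
      ultimately show ?thesis using unimod_comp[OF unimod_neg_at[of n "Suc n"] f(1)] by blast
    qed
  qed
qed

text \<open>The reduction of the vector \<open>c\<close>, transposed. The factor \<open>g\<close> is
  the gcd of the entries of \<open>c\<close>; \<open>g \<ge> 1\<close> turns a bound on
  \<open>c\<close> into the same bound on the last coordinate.\<close>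

lemma unimod_reduce_functional:
  assumes "c \<in> Zn (Suc n)" "c \<noteq> (\<lambda>_. 0)"
  obtains f f' t t' g where "unimod (Suc n) f f' t t'" "g \<ge> 1"
    "\<And>x. x \<in> Rn (Suc n) \<Longrightarrow> dotn (Suc n) c (f x) = g * x n"
proof -
  obtain f f' t t' g where f: "unimod (Suc n) f f' t t'" "g \<in> \<int>" "g > 0" "f c = (\<lambda>_. 0)(n := g)"
    using unimod_reduce_vector[OF assms] by blast
  have "dotn (Suc n) c (t x) = g * x n" if "x \<in> Rn (Suc n)" for x
    using unimod_adjoint[OF unimod_transpose[OF f(1)] _ that, of c] assms(1) f(4)
    by (simp add: Zn_iff dotn_Suc)
  moreover have "g \<ge> 1" using f(2,3) by (auto elim!: Ints_cases)
  ultimately show ?thesis using that unimod_transpose[OF f(1)] by blast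
qed

section \<open>Transport along unimodular maps\<close>

lemma unimod_coord:
  assumes "unimod n f f' t t'" "i < n" "x \<in> Rn n"
  shows "f x i = dotn n (t (unit_vec i)) x"
  using assms unimod_adjoint[OF assms(1), of "unit_vec i" x] unit_vec_in_Zn[of i n] Zn_subset_Rn
  by (auto simp: dotn_unit_vec)

lemma unimod_lincomb:
  assumes "unimod n f f' t t'" "x \<in> Rn n" "y \<in> Rn n"
  shows "f (lincomb a x b y) = lincomb a (f x) b (f y)"
proof
  fix i
  show "f (lincomb a x b y) i = lincomb a (f x) b (f y) i"
  proof (cases "i < n")
    case True
    then show ?thesis
      using assms unimod_coord[OF assms(1) True] by (simp add: lincomb_in_Rn dotn_lincomb) (simp add: lincomb_def)
  next
    case False
    then show ?thesis
      using assms unimod_Rn[OF assms(1)] lincomb_in_Rn by (simp add: Rn_def lincomb_def)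
  qed
qed

lemma unimod_zero: "unimod n f f' t t' \<Longrightarrow> f (\<lambda>_. 0) = (\<lambda>_. 0)"
  using unimod_lincomb[of n f f' t t' "\<lambda>_. 0" "\<lambda>_. 0" 0 0] by (simp add: lincomb_def)

abbreviation preimg :: "nat \<Rightarrow> ((nat \<Rightarrow> real) \<Rightarrow> nat \<Rightarrow> real) \<Rightarrow> (nat \<Rightarrow> real) set \<Rightarrow> (nat \<Rightarrow> real) set" where
  "preimg n f Q \<equiv> {x \<in> Rn n. f x \<in> Q}"

lemma unimod_dot_inverse:
  assumes "unimod n f f' t t'" "x \<in> Rn n"
  shows "dotn n c x = dotn n (t' (trunc n c)) (f x)"
  using unimod_adjoint[OF unimod_inverse[OF assms(1)] trunc_in_Rn unimod_Rn[OF assms]]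
  by (simp add: unimod_left_inv[OF assms] dotn_trunc)

lemma unimod_rational_polyhedron:
  assumes "unimod n f f' t t'" "rational_polyhedron n Q"
  shows "rational_polyhedron n (preimg n f Q)"
proof -
  obtain S where S: "finite S" "\<forall>p\<in>S. rat_ineq n p" "Q = sols n S"
    using assms(2) by (rule rational_polyhedronE)
  let ?g = "\<lambda>p. (t (trunc n (fst p)), snd p)"
  have "dotn n (fst p) (f x) = dotn n (t (trunc n (fst p))) x" if "x \<in> Rn n" for p x
    using unimod_adjoint[OF assms(1) trunc_in_Rn that] by (simp add: dotn_trunc)
  then have "preimg n f Q = sols n (?g ` S)"
    using unimod_Rn[OF assms(1)] unfolding S(3) by (auto simp: sols_def)
  moreover have "rat_ineq n (?g p)" if "p \<in> S" for p
  proof -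
    have "\<forall>i. trunc n (fst p) i \<in> \<rat>" using S that by (auto simp: rat_ineq_def trunc_def)
    then show ?thesis
      using S that unimod_rat[OF unimod_transpose[OF assms(1)] trunc_in_Rn] by (auto simp: rat_ineq_def)
  qed
  ultimately show ?thesis
    using S by (intro rational_polyhedronI[of "?g ` S"]) auto
qed

lemma unimod_convexn:
  assumes "unimod n f f' t t'" "convexn Q" shows "convexn (preimg n f Q)"
  using assms by (auto simp: convexn_def unimod_lincomb lincomb_in_Rn)

lemma unimod_boundedn:
  assumes "unimod n f f' t t'" "boundedn n Q" shows "boundedn n (preimg n f Q)"
proof -
  have "\<exists>B. \<forall>x\<in>preimg n f Q. \<bar>dotn n c x\<bar> \<le> B" for c
  proof -
    obtain B where "\<forall>x\<in>Q. \<bar>dotn n (t' (trunc n c)) x\<bar> \<le> B"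
      using assms(2) unfolding boundedn_def by blast
    then show ?thesis using unimod_dot_inverse[OF assms(1), of _ c] by (intro exI[of _ B]) auto
  qed
  then show ?thesis by (simp add: boundedn_def)
qed

lemma unimod_preimg_Zn:
  assumes "unimod n f f' t t'"
  shows "preimg n f Q \<inter> Zn n = preimg n f (Q \<inter> Zn n)"
  using unimod_Zn[OF assms] unimod_Zn[OF unimod_inverse[OF assms]] unimod_left_inv[OF assms]
  by (auto simp: Zn_iff) (metis Zn_iff)

lemma unimod_preimg_image:
  assumes "unimod n f f' t t'" "Q \<subseteq> Rn n" shows "preimg n f Q = f' ` Q"
  using assms unimod_left_inv[OF assms(1)] unimod_right_inv[OF assms(1)]
    unimod_Rn[OF unimod_inverse[OF assms(1)]]
  by (auto simp: image_iff) (metis subsetD)+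

lemma cg_red_unimod:
  assumes f: "unimod n f f' t t'" and "cg_red n k (preimg n f Q) {x. f x \<in> C}" "Q \<subseteq> Rn n"
  shows "cg_red n k Q C"
proof -
  have inv: "unimod n f' f t' t" by (rule unimod_inverse[OF f])
  have "integral_affine n n f'"
  proof -
    have "dotn n c (f' x) = dotn n (t' c) x + 0" if "c \<in> Zn n" "x \<in> Rn n" for c x
      using unimod_adjoint[OF inv _ that(2)] that(1) Zn_subset_Rn by auto
    then show ?thesis
      using unimod_Zn[OF unimod_transpose[OF inv]] unfolding integral_affine_def by (metis Ints_0)
  qed
  from cg_red_pullback[OF this assms(2)]
  have "cg_red n k (preimg n f' (preimg n f Q)) {x. f (f' x) \<in> C}" by simp
  moreover have "preimg n f' (preimg n f Q) = Q"
    using unimod_Rn[OF inv] unimod_right_inv[OF f] assms(3) by auto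
  ultimately have "cg_red n k Q {x. f (f' x) \<in> C}" by simp
  then have "cg_red n k Q ({x. f (f' x) \<in> C} \<inter> Q)" by (rule cg_red_Int)
  moreover have "{x. f (f' x) \<in> C} \<inter> Q \<subseteq> C" using unimod_right_inv[OF f] assms(3) by auto
  ultimately show ?thesis using cg_red_mono by blast
qed

section \<open>Flatness\<close>

definition width_le :: "nat \<Rightarrow> (nat \<Rightarrow> real) set \<Rightarrow> (nat \<Rightarrow> real) \<Rightarrow> real \<Rightarrow> bool" where
  "width_le n K c w \<longleftrightarrow> (\<forall>x\<in>K. \<forall>y\<in>K. dotn n c x - dotn n c y \<le> w)"

lemma width_leD: "width_le n K c w \<Longrightarrow> x \<in> K \<Longrightarrow> y \<in> K \<Longrightarrow> dotn n c x - dotn n c y \<le> w"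
  by (simp add: width_le_def)

text \<open>If the last coordinate nearly realises the lattice width \<open>N\<close> of \<open>K\<close>, then a flat direction \<open>c'\<close> of an
  integral slice through the middle of \<open>K\<close> becomes, after adding a suitable real multiple of the last
  coordinate, a direction of width at most \<open>8w\<close>. Rounding this multiple costs at most \<open>N/2\<close>, so
  \<open>N \<le> 8w + N/2\<close> up to rounding.\<close>

lemma flatness_step:
  assumes IH: "\<And>L. convexn L \<Longrightarrow> boundedn n L \<Longrightarrow> L \<subseteq> Rn n \<Longrightarrow> L \<noteq> {} \<Longrightarrow> L \<inter> Zn n = {} \<Longrightarrow>
      \<exists>c\<in>Zn n. c \<noteq> (\<lambda>_. 0) \<and> width_le n L c (real w)"
    and K: "convexn K" "boundedn (Suc n) K" "K \<subseteq> Rn (Suc n)" "K \<inter> Zn (Suc n) = {}"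
    and coord: "\<And>x y. x \<in> K \<Longrightarrow> y \<in> K \<Longrightarrow> x n - y n \<le> real N"
    and min: "\<And>c M. c \<in> Zn (Suc n) \<Longrightarrow> c \<noteq> (\<lambda>_. 0) \<Longrightarrow> width_le (Suc n) K c (real M) \<Longrightarrow> N \<le> M"
  shows "N \<le> 16 * w + 4"
proof (rule ccontr)
  assume "\<not> N \<le> 16 * w + 4"
  then have N: "N > 16 * w + 4" by simp
  then have N4: "real N > 4" by simp
  have "\<not> width_le (Suc n) K (unit_vec n) (real (N - 1))"
  proof
    assume "width_le (Suc n) K (unit_vec n) (real (N - 1))"
    moreover have "unit_vec n \<noteq> (\<lambda>_. 0)" by (auto simp: unit_vec_def fun_eq_iff)
    ultimately show False
      using min[of "unit_vec n" "N - 1"] unit_vec_in_Zn[of n "Suc n"] N by auto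
  qed
  then obtain a b where ab: "a \<in> K" "b \<in> K" "a n - b n > real N - 1"
    using N by (auto simp: width_le_def dotn_unit_vec of_nat_diff not_le)
  define h where "h = a n - b n"
  have h: "h > real N - 1" "h \<le> real N" "h > 0" using ab coord[OF ab(1,2)] N by (auto simp: h_def)
  \<comment> \<open>The integer level nearest to the middle is more than
    \<open>(N - 1) / 2 - 1 / 2\<close> away from both ends, and this is at least
    \<open>N / 4\<close> because \<open>N > 4\<close>.\<close>
  define k :: real where "k = of_int (round ((a n + b n) / 2))"
  have "\<bar>k - (a n + b n) / 2\<bar> \<le> 1 / 2" unfolding k_def by (rule of_int_round_abs_le)
  then have k: "a n - k \<ge> real N / 4" "k - b n \<ge> real N / 4"
    using h N4 unfolding h_def by (simp_all add: abs_le_iff field_simps)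
  have k_int: "k \<in> \<int>" by (simp add: k_def)
  define L where "L = {x \<in> Rn n. x(n := k) \<in> K}"
  have L_I: "x(n := 0) \<in> L" if "x \<in> K" "x n = k" for x
    using that K(3) Rn_Suc_iff by (auto simp: L_def)
  define p where "p = lincomb ((a n - k) / h) b ((k - b n) / h) a"
  have hh: "(a n - k) / h + (k - b n) / h = 1"
    using h by (simp add: add_divide_distrib[symmetric] h_def)
  have p: "p \<in> K"
    unfolding p_def using k h N hh by (intro convexnD[OF K(1)] ab) auto
  have pn: "p n = k"
  proof -
    have "p n = ((a n - k) * b n + (k - b n) * a n) / h"
      by (simp add: p_def lincomb_def add_divide_distrib)
    also have "(a n - k) * b n + (k - b n) * a n = k * h" by (simp add: h_def algebra_simps)
    finally show ?thesis using h by simp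
  qed
  have "convexn L"
    unfolding convexn_def
  proof (intro ballI allI impI)
    fix x y and s t :: real assume xy: "x \<in> L" "y \<in> L" "0 \<le> s" "0 \<le> t" "s + t = 1"
    have "lincomb s (x(n := k)) t (y(n := k)) \<in> K"
      using xy by (intro convexnD[OF K(1)]) (auto simp: L_def)
    moreover have "s * k + t * k = k" using xy(5) by (metis distrib_right mult_1)
    then have "lincomb s (x(n := k)) t (y(n := k)) = (lincomb s x t y)(n := k)"
      by (auto simp: lincomb_def)
    ultimately show "lincomb s x t y \<in> L" using xy by (auto simp: L_def lincomb_in_Rn)
  qed
  moreover have "boundedn n L"
    unfolding boundedn_def
  proof
    fix c
    obtain B where "\<forall>x\<in>K. \<bar>dotn (Suc n) (c(n := 0)) x\<bar> \<le> B" using K(2) by (auto simp: boundedn_def)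
    then show "\<exists>B. \<forall>x\<in>L. \<bar>dotn n c x\<bar> \<le> B"
      by (intro exI[of _ B]) (force simp: L_def dotn_Suc)
  qed
  moreover have "L \<inter> Zn n = {}" using K(4) Zn_upd[OF _ k_int] by (auto simp: L_def)
  moreover have "L \<noteq> {}" using L_I[OF p pn] by blast
  moreover have "L \<subseteq> Rn n" by (auto simp: L_def)
  ultimately obtain c' where c': "c' \<in> Zn n" "c' \<noteq> (\<lambda>_. 0)" "width_le n L c' (real w)"
    using IH[of L] by blast
  have slice: "\<bar>dotn n c' y - dotn n c' p\<bar> \<le> real w" if "y \<in> K" "y n = k" for y
    using width_leD[OF c'(3) L_I[OF that] L_I[OF p pn]] width_leD[OF c'(3) L_I[OF p pn] L_I[OF that]]
    by simp
  \<comment> \<open>Chosen so that \<open>v\<close> agrees at \<open>a\<close> and \<open>b\<close>,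
    hence is constant on the segment between them, including its point \<open>p\<close> in the
    slice.\<close>
  define t where "t = - (dotn n c' a - dotn n c' b) / h"
  define v where "v = (\<lambda>x. dotn n c' x + t * x n)"
  have v_lin: "v (lincomb s x s' y) = s * v x + s' * v y" for s s' x y
    by (simp add: v_def dotn_lincomb) (simp add: lincomb_def algebra_simps)
  have "t * (a n - b n) = - (dotn n c' a - dotn n c' b)"
    using h unfolding t_def h_def[symmetric] by simp
  then have va: "v a = v b" by (simp add: v_def algebra_simps)
  have vp: "v p = v b"
    unfolding p_def v_lin va using hh by (metis distrib_right mult_1)
  \<comment> \<open>The segment from \<open>x\<close> to the endpoint \<open>e\<close> on the other
    side of level \<open>k\<close> meets the slice in \<open>y\<close>. The weight
    \<open>\<nu>\<close> of \<open>x\<close> in \<open>y\<close> is at least \<open>1 / 4\<close>,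
    since \<open>e\<close> is at least \<open>N / 4\<close> from the level and at most
    \<open>N\<close> from \<open>x\<close> in the last coordinate. So the slice bound
    \<open>w\<close> grows at most fourfold.\<close>
  have key: "\<bar>v x - v b\<bar> \<le> 4 * real w"
    if x: "x \<in> K" and e: "e \<in> K" "v e = v b" "\<bar>e n - k\<bar> \<ge> real N / 4"
      and between: "x n \<le> k \<and> k \<le> e n \<or> e n \<le> k \<and> k \<le> x n" for x e
  proof -
    define \<nu> where "\<nu> = (e n - k) / (e n - x n)"
    have ne: "e n \<noteq> x n" using e(3) between N by auto
    have diff: "\<bar>e n - x n\<bar> \<le> real N" using coord[OF x e(1)] coord[OF e(1) x] by simp
    have "\<bar>e n - k\<bar> \<le> \<bar>e n - x n\<bar>" using between by auto
    moreover have nu_abs: "\<nu> = \<bar>e n - k\<bar> / \<bar>e n - x n\<bar>"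
      using between ne by (auto simp: \<nu>_def abs_if divide_simps) (simp add: algebra_simps)
    ultimately have "\<nu> \<le> 1" "0 \<le> \<nu>" using ne by (auto simp: divide_le_eq)
    have "real N / 4 / real N \<le> \<bar>e n - k\<bar> / \<bar>e n - x n\<bar>"
      using e(3) diff ne N by (intro frac_le) auto
    then have nu4: "\<nu> \<ge> 1 / 4" using N unfolding nu_abs by simp
    define y where "y = lincomb \<nu> x (1 - \<nu>) e"
    have y: "y \<in> K" unfolding y_def using x e \<open>\<nu> \<le> 1\<close> \<open>0 \<le> \<nu>\<close> by (intro convexnD[OF K(1)]) auto
    have "\<nu> * (e n - x n) = e n - k" using ne by (simp add: \<nu>_def)
    then have yn: "y n = k" by (simp add: y_def lincomb_def algebra_simps)
    have "v y - v b = \<nu> * (v x - v b)" by (simp add: y_def v_lin e(2) algebra_simps)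
    moreover have "v y - v b = dotn n c' y - dotn n c' p"
      unfolding vp[symmetric] by (simp add: v_def yn pn)
    ultimately have "\<nu> * \<bar>v x - v b\<bar> \<le> real w"
      using slice[OF y yn] \<open>0 \<le> \<nu>\<close> by (simp add: abs_mult)
    moreover have "1 / 4 * \<bar>v x - v b\<bar> \<le> \<nu> * \<bar>v x - v b\<bar>"
      using nu4 by (intro mult_right_mono) auto
    ultimately show ?thesis by simp
  qed
  have near: "\<bar>v x - v b\<bar> \<le> 4 * real w" if "x \<in> K" for x
  proof (cases "x n \<le> k")
    case True
    then show ?thesis using k N by (intro key[OF that ab(1) va]) auto
  next
    case False
    then show ?thesis using k N by (intro key[OF that ab(2) refl]) auto
  qed
  define c where "c = c'(n := of_int (round t))"
  have "c \<in> Zn (Suc n)" unfolding c_def using c'(1) by (intro Zn_upd) auto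
  moreover have "c \<noteq> (\<lambda>_. 0)"
  proof
    assume "c = (\<lambda>_. 0)"
    then have "c' i = 0" if "i \<noteq> n" for i
      using that by (auto simp: c_def fun_eq_iff split: if_splits)
    then have "c' i = 0" for i
      using Rn_at[of c' n] c'(1) by (cases "i = n") (auto simp: Zn_iff)
    then show False using c'(2) by auto
  qed
  moreover have "width_le (Suc n) K c (real (8 * w + (N + 1) div 2))"
    unfolding width_le_def
  proof (intro ballI)
    fix x y assume xy: "x \<in> K" "y \<in> K"
    have "dotn (Suc n) c x - dotn (Suc n) c y = (v x - v y) + (of_int (round t) - t) * (x n - y n)"
      by (simp add: dotn_Suc c_def v_def algebra_simps)
    moreover have "v x - v y \<le> 8 * real w" using near[OF xy(1)] near[OF xy(2)] by linarith
    moreover have "(of_int (round t) - t) * (x n - y n) \<le> 1 / 2 * real N"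
    proof -
      have "\<bar>of_int (round t) - t\<bar> \<le> 1 / 2" by (rule of_int_round_abs_le)
      moreover have "\<bar>x n - y n\<bar> \<le> real N" using coord[OF xy] coord[OF xy(2,1)] by simp
      ultimately have "\<bar>of_int (round t) - t\<bar> * \<bar>x n - y n\<bar> \<le> 1 / 2 * real N"
        by (intro mult_mono) auto
      then show ?thesis by (metis abs_ge_self abs_mult order_trans)
    qed
    moreover have "real N / 2 \<le> real ((N + 1) div 2)" by linarith
    ultimately show "dotn (Suc n) c x - dotn (Suc n) c y \<le> real (8 * w + (N + 1) div 2)"
      by simp
  qed
  ultimately have "N \<le> 8 * w + (N + 1) div 2" by (rule min)
  then show False using N by linarith
qed

lemma le_of_scaled_le:
  fixes g d w :: real
  assumes "g * d \<le> w" "g \<ge> 1" "w \<ge> 0" shows "d \<le> w"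
proof (cases "d \<le> 0")
  case False
  then have "1 * d \<le> g * d" using assms(2) by (intro mult_right_mono) auto
  then show ?thesis using assms(1) by simp
qed (use assms in simp)

lemma integer_free_dim_zero:
  assumes "Q \<subseteq> Rn 0" "Q \<inter> Zn 0 = {}" shows "Q = {}"
proof (rule equals0I)
  fix x assume "x \<in> Q"
  then have "x = (\<lambda>_. 0)" using assms(1) by (auto simp: Rn_zero_iff)
  then show False using \<open>x \<in> Q\<close> assms(2) zero_in_Zn[of 0] by blast
qed

lemma unimod_nonzero:
  assumes "unimod n f f' t t'" "x \<in> Rn n" "x \<noteq> (\<lambda>_. 0)" shows "f x \<noteq> (\<lambda>_. 0)"
  using assms(3) unimod_left_inv[OF assms(1,2)] unimod_zero[OF unimod_inverse[OF assms(1)]] by auto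

lemma unimod_functional:
  assumes "unimod n f f' t t'" "d \<in> Zn n" "d \<noteq> (\<lambda>_. 0)"
  shows "t' d \<in> Zn n" "t' d \<noteq> (\<lambda>_. 0)" "\<And>x. x \<in> Rn n \<Longrightarrow> dotn n (t' d) x = dotn n d (f' x)"
proof -
  have inv: "unimod n f' f t' t" by (rule unimod_inverse[OF assms(1)])
  have dRn: "d \<in> Rn n" using assms(2) by (simp add: Zn_iff)
  show "t' d \<in> Zn n" by (rule unimod_Zn[OF unimod_transpose[OF inv] assms(2)])
  show "t' d \<noteq> (\<lambda>_. 0)" by (rule unimod_nonzero[OF unimod_transpose[OF inv] dRn assms(3)])
  show "dotn n (t' d) x = dotn n d (f' x)" if "x \<in> Rn n" for x
    by (rule unimod_adjoint[OF inv dRn that, symmetric])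
qed

lemma unimod_preimg_inverse:
  assumes "unimod n f f' t t'" "x \<in> Q" "Q \<subseteq> Rn n" shows "f' x \<in> preimg n f Q"
  using assms unimod_preimg_image[OF assms(1,3)] by blast

lemma unimod_width:
  assumes f: "unimod n f f' t t'" and "K \<subseteq> Rn n"
    and d: "d \<in> Zn n" "d \<noteq> (\<lambda>_. 0)" "width_le n (preimg n f K) d w"
  shows "\<exists>c\<in>Zn n. c \<noteq> (\<lambda>_. 0) \<and> width_le n K c w"
proof -
  have "width_le n K (t' d) w"
    unfolding width_le_def
  proof (intro ballI)
    fix x y assume xy: "x \<in> K" "y \<in> K"
    then have "dotn n d (f' x) - dotn n d (f' y) \<le> w"
      using unimod_preimg_inverse[OF f _ assms(2)] by (intro width_leD[OF d(3)])
    moreover have "x \<in> Rn n" "y \<in> Rn n" using xy assms(2) by auto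
    ultimately show "dotn n (t' d) x - dotn n (t' d) y \<le> w"
      by (simp add: unimod_functional(3)[OF f d(1,2)])
  qed
  then show ?thesis using unimod_functional[OF f d(1,2)] by blast
qed

text \<open>The lattice width, rounded up to an integer, is realised by some direction; boundedness
  guarantees that it exists. A unimodular map makes this direction a multiple of the last
  coordinate, and \<open>flatness_step\<close> bounds it. A constant \<open>w\<close> for dimension
  \<open>n\<close> yields \<open>16 * w + 4\<close> for the next.\<close>

theorem flatness:
  "\<exists>w::nat. \<forall>K. convexn K \<longrightarrow> boundedn n K \<longrightarrow> K \<subseteq> Rn n \<longrightarrow> K \<noteq> {} \<longrightarrow> K \<inter> Zn n = {} \<longrightarrow>
     (\<exists>c\<in>Zn n. c \<noteq> (\<lambda>_. 0) \<and> width_le n K c (real w))"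
proof (induction n)
  case 0
  have "K = {}" if "K \<subseteq> Rn 0" "K \<inter> Zn 0 = {}" for K
    using that by (rule integer_free_dim_zero)
  then show ?case by blast
next
  case (Suc n)
  then obtain w :: nat where IH: "\<And>L. convexn L \<Longrightarrow> boundedn n L \<Longrightarrow> L \<subseteq> Rn n \<Longrightarrow> L \<noteq> {} \<Longrightarrow>
      L \<inter> Zn n = {} \<Longrightarrow> \<exists>c\<in>Zn n. c \<noteq> (\<lambda>_. 0) \<and> width_le n L c (real w)" by metis
  have "\<exists>c\<in>Zn (Suc n). c \<noteq> (\<lambda>_. 0) \<and> width_le (Suc n) K c (real (16 * w + 4))"
    if K: "convexn K" "boundedn (Suc n) K" "K \<subseteq> Rn (Suc n)" "K \<noteq> {}" "K \<inter> Zn (Suc n) = {}" for K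
  proof -
    define P where "P = (\<lambda>N::nat. \<exists>c\<in>Zn (Suc n). c \<noteq> (\<lambda>_. 0) \<and> width_le (Suc n) K c (real N))"
    have "\<exists>N. P N"
    proof -
      obtain B where B: "\<forall>x\<in>K. \<bar>dotn (Suc n) (unit_vec n) x\<bar> \<le> B"
        using K(2) by (auto simp: boundedn_def)
      obtain N :: nat where "2 * B \<le> real N" using real_arch_simple by blast
      then have "width_le (Suc n) K (unit_vec n) (real N)"
        unfolding width_le_def
      proof (intro ballI)
        fix x y assume "x \<in> K" "y \<in> K"
        with B have "\<bar>dotn (Suc n) (unit_vec n) x\<bar> \<le> B" "\<bar>dotn (Suc n) (unit_vec n) y\<bar> \<le> B" by auto
        then show "dotn (Suc n) (unit_vec n) x - dotn (Suc n) (unit_vec n) y \<le> real N"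
          using \<open>2 * B \<le> real N\<close> by linarith
      qed
      moreover have "unit_vec n \<noteq> (\<lambda>_. 0)" by (auto simp: unit_vec_def fun_eq_iff)
      ultimately show ?thesis using unit_vec_in_Zn[of n "Suc n"] unfolding P_def by blast
    qed
    define N where "N = (LEAST N. P N)"
    have "P N" using \<open>\<exists>N. P N\<close> unfolding N_def by (rule LeastI_ex)
    then obtain c where c: "c \<in> Zn (Suc n)" "c \<noteq> (\<lambda>_. 0)" "width_le (Suc n) K c (real N)"
      by (auto simp: P_def)
    have least: "N \<le> M" if "P M" for M using that unfolding N_def by (rule Least_le)
    obtain f f' t t' g where f: "unimod (Suc n) f f' t t'" "g \<ge> 1"
      "\<And>x. x \<in> Rn (Suc n) \<Longrightarrow> dotn (Suc n) c (f x) = g * x n"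
      using unimod_reduce_functional[OF c(1,2)] by blast
    let ?K = "preimg (Suc n) f K"
    have "N \<le> 16 * w + 4"
    proof (rule flatness_step[OF IH])
      show "convexn ?K" "boundedn (Suc n) ?K" "?K \<subseteq> Rn (Suc n)"
        using unimod_convexn[OF f(1)] unimod_boundedn[OF f(1)] K by auto
      show "?K \<inter> Zn (Suc n) = {}" using unimod_Zn[OF f(1)] K(5) by auto
    next
      fix x y assume xy: "x \<in> ?K" "y \<in> ?K"
      then have "g * (x n - y n) \<le> real N"
        using width_leD[OF c(3), of "f x" "f y"] f(3) by (simp add: algebra_simps)
      then show "x n - y n \<le> real N" using f(2) by (rule le_of_scaled_le) simp
    next
      fix d M assume d: "d \<in> Zn (Suc n)" "d \<noteq> (\<lambda>_. 0)" "width_le (Suc n) ?K d (real M)"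
      show "N \<le> M"
        using unimod_width[OF f(1) K(3) d] least unfolding P_def by blast
    qed
    then have "real N \<le> real (16 * w + 4)" by (rule of_nat_mono)
    then have "width_le (Suc n) K c (real (16 * w + 4))"
      using c(3) order_trans unfolding width_le_def by blast
    then show ?thesis using c by blast
  qed
  then show ?case by blast
qed

section \<open>Polyhedra without integer points\<close>

text \<open>In suitable lattice coordinates the ray is a positive multiple of the last unit vector,
  so the polyhedron is closed under raising the last coordinate.\<close>

lemma integral_ray_normal_form:
  assumes r: "r \<in> Zn (Suc n)" "r \<noteq> (\<lambda>_. 0)" and ray: "\<forall>x\<in>Q. \<forall>t\<ge>0. lincomb 1 x t r \<in> Q"
  shows "\<exists>f f' t t'. unimod (Suc n) f f' t t' \<and> (\<exists>g>0. f ((\<lambda>_. 0)(n := g)) = r) \<and>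
    (\<forall>x\<in>preimg (Suc n) f Q. \<forall>y\<ge>x n. x(n := y) \<in> preimg (Suc n) f Q)"
proof -
  obtain h h' u u' g where h: "unimod (Suc n) h h' u u'" "g > 0" "h r = (\<lambda>_. 0)(n := g)"
    using unimod_reduce_vector[OF r] by blast
  have inv: "unimod (Suc n) h' h u' u" by (rule unimod_inverse[OF h(1)])
  have rRn: "r \<in> Rn (Suc n)" using r(1) by (simp add: Zn_iff)
  have hr: "h' ((\<lambda>_. 0)(n := g)) = r" using unimod_left_inv[OF h(1) rRn] h(3) by simp
  have "x(n := y) \<in> preimg (Suc n) h' Q" if x: "x \<in> preimg (Suc n) h' Q" "x n \<le> y" for x y
  proof -
    have eq: "x(n := y) = lincomb 1 x ((y - x n) / g) ((\<lambda>_. 0)(n := g))"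
      using h(2) by (auto simp: lincomb_def)
    have e: "(\<lambda>_. 0)(n := g) \<in> Rn (Suc n)" by (intro Rn_upd) simp
    have "h' (x(n := y)) = lincomb 1 (h' x) ((y - x n) / g) r"
      unfolding eq using unimod_lincomb[OF inv _ e] x hr by auto
    moreover have "lincomb 1 (h' x) ((y - x n) / g) r \<in> Q" using ray x h(2) by auto
    moreover have "x(n := y) \<in> Rn (Suc n)" using x e unfolding eq by (auto intro: lincomb_in_Rn)
    ultimately show ?thesis by simp
  qed
  then have "\<forall>x\<in>preimg (Suc n) h' Q. \<forall>y\<ge>x n. x(n := y) \<in> preimg (Suc n) h' Q" by blast
  with inv hr h(2) show ?thesis by blast
qed

text \<open>An unbounded polyhedron is projected along an integral ray; an integer point of the
  projection would lift by rounding the last coordinate up. A bounded one is flat, and its integral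
  slices are integer-free of smaller dimension, so they can be removed from the top downwards until
  the polyhedron is exhausted.\<close>

lemma integer_free_cg_red:
  "\<exists>k. \<forall>Q. rational_polyhedron n Q \<longrightarrow> Q \<inter> Zn n = {} \<longrightarrow> cg_red n k Q {}"
proof (induction n)
  case 0
  have "Q = {}" if "Q \<subseteq> Rn 0" "Q \<inter> Zn 0 = {}" for Q
    using that by (rule integer_free_dim_zero)
  then have "cg_red 0 0 Q {}" if "rational_polyhedron 0 Q" "Q \<inter> Zn 0 = {}" for Q
    using that rational_polyhedron_subset by (auto intro: cg_red_triv)
  then show ?case by blast
next
  case (Suc n)
  then obtain k where IH: "\<And>Q. rational_polyhedron n Q \<Longrightarrow> Q \<inter> Zn n = {} \<Longrightarrow> cg_red n k Q {}"
    by blast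
  obtain w :: nat where w: "\<And>K. convexn K \<Longrightarrow> boundedn (Suc n) K \<Longrightarrow> K \<subseteq> Rn (Suc n) \<Longrightarrow> K \<noteq> {} \<Longrightarrow>
      K \<inter> Zn (Suc n) = {} \<Longrightarrow> \<exists>c\<in>Zn (Suc n). c \<noteq> (\<lambda>_. 0) \<and> width_le (Suc n) K c (real w)"
    using flatness[of "Suc n"] by metis
  have "cg_red (Suc n) ((2 * w + 2) * Suc k) Q {}"
    if Q: "rational_polyhedron (Suc n) Q" "Q \<inter> Zn (Suc n) = {}" for Q
  proof (cases "Q = {}")
    case True
    then show ?thesis by (simp add: cg_red_empty)
  next
    case nonempty: False
    have QR: "Q \<subseteq> Rn (Suc n)" by (rule rational_polyhedron_subset[OF Q(1)])
    show ?thesis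
    proof (cases "boundedn (Suc n) Q")
      case False
      then obtain r where r: "r \<in> Zn (Suc n)" "r \<noteq> (\<lambda>_. 0)" "\<forall>x\<in>Q. \<forall>t\<ge>0. lincomb 1 x t r \<in> Q"
        using bounded_or_integral_ray[OF Q(1)] by blast
      obtain f f' t t' where f: "unimod (Suc n) f f' t t'" 
        and up: "\<forall>x\<in>preimg (Suc n) f Q. \<forall>y\<ge>x n. x(n := y) \<in> preimg (Suc n) f Q"
        using integral_ray_normal_form[OF r] by blast
      let ?Q = "preimg (Suc n) f Q"
      let ?P = "{x \<in> Rn n. \<exists>t. x(n := t) \<in> ?Q}"
      have "z \<notin> Zn n" if z: "z \<in> ?P" for z
      proof
        assume zZ: "z \<in> Zn n"
        obtain s where s: "z(n := s) \<in> ?Q" using z by blast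
        have "(z(n := s)) n \<le> of_int \<lceil>s\<rceil>" by simp
        with up s have "(z(n := s))(n := of_int \<lceil>s\<rceil>) \<in> ?Q" by blast
        then have "z(n := of_int \<lceil>s\<rceil>) \<in> ?Q" by simp
        moreover have "z(n := of_int \<lceil>s\<rceil>) \<in> Zn (Suc n)" using zZ by (intro Zn_upd) auto
        ultimately show False using unimod_Zn[OF f] Q(2) by blast
      qed
      then have "cg_red n k ?P {}"
        using rational_polyhedron_projection[OF unimod_rational_polyhedron[OF f Q(1)]]
        by (intro IH) auto
      then have "cg_red (Suc n) k ?Q {x. x(n := 0) \<in> {}}" by (rule cg_red_project) auto
      then have "cg_red (Suc n) k Q {}" using cg_red_unimod[OF f _ QR, of k "{}"] by simp
      then show ?thesis by (rule cg_red_le) simp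
    next
      case True
      obtain c where c: "c \<in> Zn (Suc n)" "c \<noteq> (\<lambda>_. 0)" "width_le (Suc n) Q c (real w)"
        using w[OF rational_polyhedron_convexn[OF Q(1)] True QR nonempty Q(2)] by blast
      obtain f f' t t' g where f: "unimod (Suc n) f f' t t'" "g \<ge> 1"
        "\<And>x. x \<in> Rn (Suc n) \<Longrightarrow> dotn (Suc n) c (f x) = g * x n"
        using unimod_reduce_functional[OF c(1,2)] by blast
      let ?Q = "preimg (Suc n) f Q"
      have Q': "rational_polyhedron (Suc n) ?Q" by (rule unimod_rational_polyhedron[OF f(1) Q(1)])
      have coord: "x n - y n \<le> real w" if "x \<in> ?Q" "y \<in> ?Q" for x y
      proof -
        have "g * (x n - y n) \<le> real w"
          using width_leD[OF c(3), of "f x" "f y"] f(3) that by (simp add: algebra_simps)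
        then show ?thesis using f(2) by (rule le_of_scaled_le) simp
      qed
      have "?Q \<noteq> {}"
        using nonempty unimod_preimg_image[OF f(1) QR] by simp
      then obtain q where q: "q \<in> ?Q" by blast
      \<comment> \<open>Every point of \<open>?Q\<close> is within \<open>w\<close> of
        \<open>q\<close> in the last coordinate. Hence \<open>d0\<close> is strictly below all of
        \<open>?Q\<close>, and \<open>d0 + 2 * w + 2\<close> is above it.\<close>
      define d0 :: real where "d0 = of_int (\<lfloor>q n\<rfloor> - int w - 1)"
      have slice: "cg_red (Suc n) k {x \<in> ?Q. x n = j} {}" if j: "j \<in> \<int>" for j
      proof -
        let ?F = "{x \<in> Rn n. x(n := j) \<in> ?Q}"
        have "?F \<inter> Zn n = {}" using Zn_upd[OF _ j, of _ n] unimod_Zn[OF f(1)] Q(2) by blast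
        moreover have "rational_polyhedron n ?F"
          using j Ints_subset_Rats by (intro rational_polyhedron_slice[OF Q']) auto
        ultimately have "cg_red n k ?F {}" by (intro IH)
        then have "cg_red (Suc n) k {x \<in> ?Q. x n = j} {x. x(n := 0) \<in> {}}"
          by (rule cg_red_slice) auto
        then show ?thesis by simp
      qed
      have "cg_red (Suc n) ((2 * w + 2) * Suc k) ?Q {x. dotn (Suc n) (unit_vec n) x \<le> d0}"
      proof (rule cg_red_push_iter[OF Q'])
        show "unit_vec n \<in> Zn (Suc n)" by (simp add: unit_vec_in_Zn)
        show "d0 \<in> \<int>" unfolding d0_def by (rule Ints_of_int)
        show "dotn (Suc n) (unit_vec n) x \<le> d0 + real (2 * w + 2)" if "x \<in> ?Q" for x
          using coord[OF that q] by (simp add: dotn_unit_vec d0_def) linarith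
        show "cg_red (Suc n) k {x \<in> ?Q. dotn (Suc n) (unit_vec n) x = j} {}" if "j \<in> \<int>" for j
          using slice[OF that] by (simp add: dotn_unit_vec)
      qed
      then have "cg_red (Suc n) ((2 * w + 2) * Suc k) ?Q ({x. dotn (Suc n) (unit_vec n) x \<le> d0} \<inter> ?Q)"
        by (rule cg_red_Int)
      moreover have "x n > d0" if "x \<in> ?Q" for x
        using coord[OF q that] unfolding d0_def by simp linarith
      then have "{x. dotn (Suc n) (unit_vec n) x \<le> d0} \<inter> ?Q = {}"
        by (force simp: dotn_unit_vec)
      ultimately have "cg_red (Suc n) ((2 * w + 2) * Suc k) ?Q {x. f x \<in> {}}" by simp
      then show ?thesis by (rule cg_red_unimod[OF f(1) _ QR])
    qed
  qed
  then show ?case by blast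
qed

section \<open>Directions in which the polyhedron is thin\<close>

definition perp :: "nat \<Rightarrow> (nat \<Rightarrow> real) set \<Rightarrow> (nat \<Rightarrow> real) set" where
  "perp n X = {c \<in> Zn n. \<forall>v\<in>X. dotn n c v = 0}"

text \<open>For a set of integer vectors this is the real linear span. Describing it by integral
  functionals suits cuts and changes of the lattice basis.\<close>

definition perp_perp :: "nat \<Rightarrow> (nat \<Rightarrow> real) set \<Rightarrow> (nat \<Rightarrow> real) set" where
  "perp_perp n X = {x \<in> Rn n. \<forall>c\<in>perp n X. dotn n c x = 0}"

text \<open>This is how the origin being a relative interior point of the convex hull of \<open>X\<close> is used.\<close>

definition balanced :: "nat \<Rightarrow> (nat \<Rightarrow> real) set \<Rightarrow> bool" where
  "balanced n X \<longleftrightarrow> (\<forall>c. (\<exists>v\<in>X. dotn n c v > 0) \<longrightarrow> (\<exists>v\<in>X. dotn n c v < 0))"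

lemma balancedD: "balanced n X \<Longrightarrow> v \<in> X \<Longrightarrow> dotn n c v > 0 \<Longrightarrow> \<exists>v\<in>X. dotn n c v < 0"
  unfolding balanced_def by blast

lemma balancedD':
  assumes "balanced n X" "v \<in> X" "dotn n c v < 0" shows "\<exists>v\<in>X. dotn n c v > 0"
proof -
  have neg: "dotn n (\<lambda>i. - c i) x = - dotn n c x" for x by (simp add: dotn_def sum_negf)
  show ?thesis using balancedD[OF assms(1,2), of "\<lambda>i. - c i"] assms(3) by (simp add: neg)
qed

lemma unimod_balanced:
  assumes "unimod n f f' t t'" "X \<subseteq> Rn n" "balanced n X"
  shows "balanced n (preimg n f X)"
proof -
  have eq: "dotn n c x = dotn n (t' (trunc n c)) (f x)" if "x \<in> preimg n f X" for c x
    using unimod_dot_inverse[OF assms(1)] that by auto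
  have "\<exists>v\<in>preimg n f X. dotn n c v < 0" if v: "v \<in> preimg n f X" "dotn n c v > 0" for c v
  proof -
    obtain x where x: "x \<in> X" "dotn n (t' (trunc n c)) x < 0"
      using balancedD[OF assms(3), of "f v" "t' (trunc n c)"] v eq[OF v(1), of c] by auto
    have fx: "f' x \<in> preimg n f X" by (rule unimod_preimg_inverse[OF assms(1) x(1) assms(2)])
    have "f (f' x) = x" using unimod_right_inv[OF assms(1)] x(1) assms(2) by auto
    then have "dotn n c (f' x) < 0" using eq[OF fx, of c] x(2) by simp
    then show ?thesis using fx by blast
  qed
  then show ?thesis unfolding balanced_def by blast
qed

lemma unimod_perp:
  assumes "unimod n f f' t t'" "c \<in> perp n X" shows "t c \<in> perp n (preimg n f X)"
  using assms(2) unimod_Zn[OF unimod_transpose[OF assms(1)]] unimod_adjoint[OF assms(1), of c]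
  by (auto simp: perp_def Zn_iff)

lemma unimod_perp_inverse:
  assumes "unimod n f f' t t'" "X \<subseteq> Rn n" "c \<in> perp n (preimg n f X)" shows "t' c \<in> perp n X"
proof -
  have inv: "unimod n f' f t' t" by (rule unimod_inverse[OF assms(1)])
  have "dotn n (t' c) v = 0" if "v \<in> X" for v
  proof -
    have "f' v \<in> preimg n f X" "v \<in> Rn n"
      using unimod_preimg_inverse[OF assms(1) that assms(2)] that assms(2) by auto
    then show ?thesis
      using unimod_adjoint[OF inv, of c v] assms(3) by (auto simp: perp_def Zn_iff)
  qed
  then show ?thesis
    using assms(3) unimod_Zn[OF unimod_transpose[OF inv]] by (simp add: perp_def)
qed

lemma unimod_perp_perp:
  assumes "unimod n f f' t t'" "x \<in> Rn n" "X \<subseteq> Rn n" "f x \<in> perp_perp n X"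
  shows "x \<in> perp_perp n (preimg n f X)"
proof -
  have "dotn n c x = 0" if c: "c \<in> perp n (preimg n f X)" for c
  proof -
    have "c \<in> Rn n" using c by (simp add: perp_def Zn_iff)
    then have "dotn n c x = dotn n (t' c) (f x)"
      using unimod_adjoint[OF unimod_inverse[OF assms(1)] _ unimod_Rn[OF assms(1,2)], of c]
        unimod_left_inv[OF assms(1,2)] by simp
    then show ?thesis
      using unimod_perp_inverse[OF assms(1,3) c] assms(4) by (simp add: perp_perp_def)
  qed
  then show ?thesis using assms(2) by (simp add: perp_perp_def)
qed

text \<open>Flatness is applied here with respect to the coset of integer vectors whose last coordinate is
  odd: it avoids \<open>Q\<close>, although \<open>Q\<close> itself may contain integer points.\<close>

lemma flat_if_integer_points_in_hyperplane:
  "\<exists>w::nat. \<forall>Q c0. convexn Q \<longrightarrow> boundedn n Q \<longrightarrow> Q \<subseteq> Rn n \<longrightarrow> Q \<noteq> {} \<longrightarrow> c0 \<in> Zn n \<longrightarrow>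
     c0 \<noteq> (\<lambda>_. 0) \<longrightarrow> (\<forall>z\<in>Q \<inter> Zn n. dotn n c0 z = 0) \<longrightarrow>
     (\<exists>c\<in>Zn n. c \<noteq> (\<lambda>_. 0) \<and> width_le n Q c (real w))"
proof (cases n)
  case 0
  then show ?thesis by (auto simp: Zn_iff Rn_zero_iff)
next
  case n: (Suc m)
  obtain w :: nat where w: "\<And>K. convexn K \<Longrightarrow> boundedn n K \<Longrightarrow> K \<subseteq> Rn n \<Longrightarrow> K \<noteq> {} \<Longrightarrow>
      K \<inter> Zn n = {} \<Longrightarrow> \<exists>c\<in>Zn n. c \<noteq> (\<lambda>_. 0) \<and> width_le n K c (real w)"
    using flatness[of n] by metis
  have "\<exists>c\<in>Zn n. c \<noteq> (\<lambda>_. 0) \<and> width_le n Q c (real (2 * w))"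
    if Q: "convexn Q" "boundedn n Q" "Q \<subseteq> Rn n" "Q \<noteq> {}"
      and c0: "c0 \<in> Zn n" "c0 \<noteq> (\<lambda>_. 0)" "\<forall>z\<in>Q \<inter> Zn n. dotn n c0 z = 0" for Q c0
  proof -
    obtain f f' t t' g where f: "unimod n f f' t t'" "g \<ge> 1"
      "\<And>x. x \<in> Rn n \<Longrightarrow> dotn n c0 (f x) = g * x m"
      using unimod_reduce_functional[of c0 m] c0(1,2) unfolding n by blast
    let ?Q = "preimg n f Q"
    \<comment> \<open>Sends integer vectors to integer vectors whose coordinate \<open>m\<close> is
      odd, whereas that coordinate is zero at the integer points of \<open>?Q\<close>.\<close>
    define \<psi> where "\<psi> = (\<lambda>x::nat \<Rightarrow> real. x(m := 2 * x m + 1))"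
    define K where "K = {x \<in> Rn n. \<psi> x \<in> ?Q}"
    have Q': "convexn ?Q" "boundedn n ?Q" "?Q \<noteq> {}"
      using unimod_convexn[OF f(1) Q(1)] unimod_boundedn[OF f(1) Q(2)] unimod_preimg_image[OF f(1) Q(3)] Q(4)
      by auto
    have \<psi>_inv: "\<exists>x\<in>K. \<psi> x = y" if "y \<in> ?Q" for y
    proof -
      define x where "x = y(m := (y m - 1) / 2)"
      have "\<psi> x = y" by (simp add: x_def \<psi>_def diff_divide_distrib)
      moreover have "x \<in> Rn n" using that by (simp add: x_def n Rn_Suc_iff)
      ultimately show ?thesis using that by (auto simp: K_def)
    qed
    have \<psi>_dot: "dotn n c (\<psi> x) = dotn m c x + c m * (2 * x m + 1)" for c x
      by (simp add: n dotn_Suc \<psi>_def)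
    have "convexn K"
      unfolding convexn_def
    proof (intro ballI allI impI)
      fix x y and s t :: real assume xy: "x \<in> K" "y \<in> K" "0 \<le> s" "0 \<le> t" "s + t = 1"
      have "lincomb s (\<psi> x) t (\<psi> y) \<in> ?Q"
        using xy by (intro convexnD[OF Q'(1)]) (auto simp: K_def)
      moreover have "lincomb s (\<psi> x) t (\<psi> y) = \<psi> (lincomb s x t y)"
        using xy(5) by (auto simp: lincomb_def \<psi>_def algebra_simps)
      ultimately show "lincomb s x t y \<in> K" using xy by (auto simp: K_def lincomb_in_Rn)
    qed
    moreover have "boundedn n K"
      unfolding boundedn_def
    proof
      fix c :: "nat \<Rightarrow> real"
      let ?c = "c(m := c m / 2)"
      obtain B where B: "\<forall>x\<in>?Q. \<bar>dotn n ?c x\<bar> \<le> B" using Q'(2) unfolding boundedn_def by blast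
      have "\<bar>dotn n c x\<bar> \<le> B + \<bar>c m / 2\<bar>" if "x \<in> K" for x
      proof -
        have "dotn n c x = dotn n ?c (\<psi> x) - c m / 2"
          unfolding \<psi>_dot by (simp add: n dotn_Suc algebra_simps)
        moreover have "\<bar>dotn n ?c (\<psi> x)\<bar> \<le> B" using B that by (simp add: K_def)
        ultimately show ?thesis by linarith
      qed
      then show "\<exists>B. \<forall>x\<in>K. \<bar>dotn n c x\<bar> \<le> B" by blast
    qed
    moreover have "K \<inter> Zn n = {}"
    proof (rule equals0I)
      fix z assume z: "z \<in> K \<inter> Zn n"
      then obtain k where k: "z m = of_int k" by (auto simp: Zn_iff elim: Ints_cases)
      have "\<psi> z \<in> Zn n"
        using z by (auto simp: Zn_iff \<psi>_def Rn_def n)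
      then have "g * \<psi> z m = 0"
        using z c0(3) f(3)[of "\<psi> z"] unimod_Zn[OF f(1)] by (auto simp: K_def)
      then have "of_int (2 * k + 1) = (0 :: real)" using f(2) by (simp add: \<psi>_def k)
      then have "2 * k + 1 = 0" unfolding of_int_eq_0_iff .
      then show False by presburger
    qed
    moreover have "K \<noteq> {}" using \<psi>_inv Q'(3) by blast
    moreover have "K \<subseteq> Rn n" by (auto simp: K_def)
    ultimately obtain c where c: "c \<in> Zn n" "c \<noteq> (\<lambda>_. 0)" "width_le n K c (real w)"
      using w[of K] by blast
    \<comment> \<open>With this choice \<open>d (\<psi> u) = 2 * c u + c m\<close>, so passing back
      from \<open>K\<close> to \<open>?Q\<close> doubles the width.\<close>
    define d where "d = (\<lambda>i. if i = m then c m else 2 * c i)"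
    have "d \<in> Zn n" using c(1) by (auto simp: d_def Zn_iff Rn_def)
    moreover have "d \<noteq> (\<lambda>_. 0)" using c(2) by (auto simp: d_def fun_eq_iff split: if_splits)
    moreover have "width_le n ?Q d (real (2 * w))"
      unfolding width_le_def
    proof (intro ballI)
      fix x y assume "x \<in> ?Q" "y \<in> ?Q"
      then obtain x' y' where xy: "x' \<in> K" "y' \<in> K" "\<psi> x' = x" "\<psi> y' = y" using \<psi>_inv by metis
      have "dotn n d (\<psi> u) = 2 * dotn n c u + c m" for u
      proof -
        have "dotn m d u = 2 * dotn m c u"
          by (simp add: dotn_def d_def sum_distrib_left mult.assoc)
        then show ?thesis unfolding \<psi>_dot by (simp add: n dotn_Suc d_def algebra_simps)
      qed
      then show "dotn n d x - dotn n d y \<le> real (2 * w)"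
        using width_leD[OF c(3) xy(1,2)] xy(3,4) by auto
    qed
    ultimately show ?thesis by (rule unimod_width[OF f(1) Q(3)])
  qed
  then show ?thesis by blast
qed

text \<open>The intersection of the line through \<open>v\<close> and \<open>v'\<close> with the hyperplane \<open>x\<^sub>n = 0\<close>.\<close>

definition level_point :: "nat \<Rightarrow> (nat \<Rightarrow> real) \<Rightarrow> (nat \<Rightarrow> real) \<Rightarrow> nat \<Rightarrow> real" where
  "level_point n v v' = lincomb (- v' n / (v n - v' n)) v (v n / (v n - v' n)) v'"

lemma level_point_at: "level_point n v v' n = 0"
  by (simp add: level_point_def lincomb_def)

lemma level_point_weights:
  fixes a b :: real
  assumes "a * b < 0"
  shows "- b / (a - b) > 0" "a / (a - b) > 0" "- b / (a - b) + a / (a - b) = 1"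
proof -
  have "a > 0 \<and> b < 0 \<or> a < 0 \<and> b > 0" using assms by (auto simp: mult_less_0_iff)
  then show "- b / (a - b) > 0" "a / (a - b) > 0" "- b / (a - b) + a / (a - b) = 1"
    unfolding zero_less_divide_iff add_divide_distrib[symmetric] by auto
qed

lemma level_point_in:
  assumes "convexn Q" "v \<in> Q" "v' \<in> Q" "v n * v' n < 0" shows "level_point n v v' \<in> Q"
  unfolding level_point_def using level_point_weights[OF assms(4)] assms by (intro convexnD[OF assms(1)]) auto

text \<open>These points generate the section of the convex hull of \<open>X\<close> by the
  hyperplane; the hull itself is never formed.\<close>

definition level_set :: "nat \<Rightarrow> (nat \<Rightarrow> real) set \<Rightarrow> (nat \<Rightarrow> real) set" where
  "level_set n X = {v \<in> X. v n = 0} \<union>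
     {level_point n v v' | v v'. v \<in> X \<and> v' \<in> X \<and> v n > 0 \<and> v' n < 0}"

lemma level_setI: "v \<in> X \<Longrightarrow> v' \<in> X \<Longrightarrow> v n > 0 \<Longrightarrow> v' n < 0 \<Longrightarrow> level_point n v v' \<in> level_set n X"
  unfolding level_set_def by blast

lemma mult_weights_cancel:
  fixes k :: real
  assumes "k \<noteq> 0" shows "k * (p / k * x + q / k * y) = p * x + q * y"
  using assms by (simp add: field_simps)

lemma dotn_level_point:
  assumes "v n > 0" "v' n < 0"
  shows "(v n - v' n) * dotn m c (level_point n v v') = - v' n * dotn m c v + v n * dotn m c v'"
proof -
  have "v n - v' n \<noteq> 0" using assms by simp
  then show ?thesis unfolding level_point_def dotn_lincomb by (rule mult_weights_cancel)
qed

lemma level_set_subset: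
  assumes "convexn Q" "X \<subseteq> Q" "Q \<subseteq> Rn (Suc n)" shows "level_set n X \<subseteq> {x \<in> Q. x n = 0}"
proof
  fix x assume "x \<in> level_set n X"
  then consider "x \<in> X" "x n = 0" | v v' where "x = level_point n v v'" "v \<in> X" "v' \<in> X" "v n > 0" "v' n < 0"
    by (auto simp: level_set_def)
  then show "x \<in> {x \<in> Q. x n = 0}"
  proof cases
    case 1
    then show ?thesis using assms(2) by auto
  next
    case 2
    then have "v n * v' n < 0" by (simp add: mult_pos_neg)
    then have "x \<in> Q" using 2 assms by (auto intro: level_point_in)
    then show ?thesis using 2 by (simp add: level_point_at)
  qed
qed

text \<open>With \<open>a = N v_n\<close> and \<open>b = - N v'_n\<close> the level point is
  \<open>(b v + a v') / (a + b)\<close>. Both numbers are positive integers at most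
  \<open>N w\<close>, so \<open>a + b\<close> divides \<open>fact (2 * N * w)\<close>; the extra
  factor \<open>N\<close> clears \<open>v\<close> and \<open>v'\<close>.\<close>

lemma level_set_integral:
  fixes N w :: nat
  assumes int: "\<And>v. v \<in> X \<Longrightarrow> (\<lambda>i. real N * v i) \<in> Zn (Suc n)" and N: "N \<ge> 1"
    and bnd: "\<And>v. v \<in> X \<Longrightarrow> \<bar>v n\<bar> \<le> real w" and x: "x \<in> level_set n X" "x \<in> Rn n"
  shows "(\<lambda>i. real (N * fact (2 * N * w)) * x i) \<in> Zn n"
proof -
  let ?F = "real (fact (2 * N * w))"
  have coord: "real N * v i \<in> \<int>" if "v \<in> X" for v i using int[OF that] by (simp add: Zn_iff)
  have abs_nat: "\<exists>j::nat. j \<ge> 1 \<and> j \<le> N * w \<and> real N * \<bar>v n\<bar> = real j" if v: "v \<in> X" "v n \<noteq> 0" for v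
  proof -
    obtain k where k: "real N * v n = of_int k" using coord[OF v(1)] by (auto elim: Ints_cases)
    then have "k \<noteq> 0" using v(2) N by auto
    have kabs: "real N * \<bar>v n\<bar> = real (nat \<bar>k\<bar>)"
    proof -
      have "real N * \<bar>v n\<bar> = \<bar>real N * v n\<bar>" by (simp add: abs_mult)
      then show ?thesis using k by simp
    qed
    have "real N * \<bar>v n\<bar> \<le> real N * real w" using bnd[OF v(1)] by (intro mult_left_mono) auto
    then have "real (nat \<bar>k\<bar>) \<le> real (N * w)" unfolding kabs by simp
    then have "nat \<bar>k\<bar> \<le> N * w" by (simp only: of_nat_le_iff)
    then show ?thesis using kabs \<open>k \<noteq> 0\<close> by (intro exI[of _ "nat \<bar>k\<bar>"]) auto
  qed
  have "real (N * fact (2 * N * w)) * x i \<in> \<int>" for i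
  proof -
    consider "x \<in> X" | v v' where "x = level_point n v v'" "v \<in> X" "v' \<in> X" "v n > 0" "v' n < 0"
      using x(1) by (auto simp: level_set_def)
    then show ?thesis
    proof cases
      case 1
      have "?F * (real N * x i) \<in> \<int>" by (rule Ints_mult[OF Ints_of_nat coord[OF 1]])
      moreover have "real (N * fact (2 * N * w)) * x i = ?F * (real N * x i)" by (simp add: mult_ac)
      ultimately show ?thesis by (simp only:)
    next
      case 2
      obtain a where a: "a \<ge> 1" "a \<le> N * w" "real N * v n = real a"
        using abs_nat[OF 2(2)] 2(4) by auto
      obtain b where b: "b \<ge> 1" "b \<le> N * w" "real N * - v' n = real b"
        using abs_nat[OF 2(3)] 2(5) by auto
      have "a + b dvd fact (2 * N * w)" using a b by (intro dvd_fact) auto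
      then obtain q where q: "fact (2 * N * w) = (a + b) * q" by (auto simp: dvd_def)
      have "real N * (v n - v' n) * x i = real b * v i + real a * v' i"
      proof -
        have "(v n - v' n) * x i = - v' n * v i + v n * v' i"
          using 2(4,5) unfolding 2(1) level_point_def lincomb_def by (intro mult_weights_cancel) simp
        then have "real N * ((v n - v' n) * x i) = real N * (- v' n * v i + v n * v' i)"
          by (simp only:)
        also have "\<dots> = (real N * - v' n) * v i + (real N * v n) * v' i"
          by (simp add: algebra_simps)
        finally show ?thesis unfolding a b by (simp only: mult.assoc)
      qed
      moreover have "real N * (v n - v' n) = real (a + b)" using a b by (simp add: algebra_simps)
      ultimately have eq: "real (a + b) * x i = real b * v i + real a * v' i" by simp
      have "real (N * fact (2 * N * w)) * x i = real N * real q * (real (a + b) * x i)"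
        unfolding q by (simp add: mult_ac)
      also have "\<dots> = real q * (real b * (real N * v i) + real a * (real N * v' i))"
        unfolding eq by (simp add: algebra_simps)
      also have "\<dots> \<in> \<int>" 
        by (intro Ints_mult[OF Ints_of_nat] Ints_add coord 2)
      finally show ?thesis .
    qed
  qed
  then show ?thesis using x(2) by (auto simp: Zn_iff Rn_def)
qed

text \<open>As in the Hahn-Banach theorem, a functional nonnegative on the section extends to one
  nonnegative on \<open>X\<close>. Balance of \<open>X\<close> makes the extension vanish on
  \<open>X\<close>, hence on the section.\<close>

lemma level_set_balanced:
  assumes bal: "balanced (Suc n) X" and v0: "v0 \<in> X" "v0 n \<noteq> 0"
  shows "balanced n (level_set n X)"
  unfolding balanced_def
proof (intro allI impI, rule ccontr)
  fix c assume "\<exists>x\<in>level_set n X. dotn n c x > 0"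
  then obtain x0 where x0: "x0 \<in> level_set n X" "dotn n c x0 > 0" by blast
  assume "\<not> (\<exists>x\<in>level_set n X. dotn n c x < 0)"
  then have nonneg: "dotn n c x \<ge> 0" if "x \<in> level_set n X" for x using that by (meson not_le)
  have un: "dotn (Suc n) (unit_vec n) x = x n" for x by (simp add: dotn_unit_vec)
  obtain vp vn where vp: "vp \<in> X" "vp n > 0" and vn: "vn \<in> X" "vn n < 0"
    using balancedD[OF bal v0(1), of "unit_vec n"] balancedD'[OF bal v0(1), of "unit_vec n"] v0
    unfolding un by (metis linorder_neqE_linordered_idom)
  \<comment> \<open>The lower bounds on the last coefficient \<open>s\<close> imposed by points with
    \<open>v n > 0\<close>. Points with \<open>v' n < 0\<close> impose upper bounds, and the two are
    compatible exactly because \<open>c\<close> is nonnegative at the level points.\<close>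
  let ?A = "{- dotn n c v / v n | v. v \<in> X \<and> v n > 0}"
  have ub: "a \<le> dotn n c v' / - v' n" if a: "a \<in> ?A" and v': "v' \<in> X" "v' n < 0" for a v'
  proof -
    obtain v where v: "v \<in> X" "v n > 0" "a = - dotn n c v / v n" using a by blast
    have "0 \<le> (v n - v' n) * dotn n c (level_point n v v')"
      using nonneg[OF level_setI[OF v(1) v'(1) v(2) v'(2)]] v v' by (intro mult_nonneg_nonneg) auto
    then have "0 \<le> - v' n * dotn n c v + v n * dotn n c v'"
      
      using dotn_level_point[where v = v and n = n and v' = v' and m = n and c = c] v v' by simp
    moreover have "v n * (a * - v' n) = v' n * dotn n c v" using v by simp
    ultimately have "v n * (a * - v' n) \<le> v n * dotn n c v'" by simp
    then have "a * - v' n \<le> dotn n c v'" using v(2) by (simp only: mult_le_cancel_left_pos)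
    then show ?thesis using v'(2) by (simp only: pos_le_divide_eq neg_0_less_iff_less)
  qed
  define s where "s = Sup ?A"
  have bdd: "bdd_above ?A" using ub[OF _ vn] by (rule bdd_aboveI)
  have ne: "?A \<noteq> {}" using vp by blast
  define d where "d = c(n := s)"
  have d: "dotn (Suc n) d x = dotn n c x + s * x n" for x by (simp add: d_def dotn_Suc)
  have d_nonneg: "dotn (Suc n) d v \<ge> 0" if v: "v \<in> X" for v
  proof (cases "v n" "0 :: real" rule: linorder_cases)
    case less
    have "s \<le> dotn n c v / - v n" unfolding s_def using ub[OF _ v less] by (intro cSup_least[OF ne])
    then show ?thesis using less unfolding d by (simp add: field_simps)
  next
    case equal
    then have "v \<in> level_set n X" using v by (simp add: level_set_def)
    then show ?thesis using nonneg equal unfolding d by simp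
  next
    case greater
    have "- dotn n c v / v n \<le> s" unfolding s_def using v greater by (intro cSup_upper bdd) blast
    then show ?thesis using greater unfolding d by (simp add: field_simps)
  qed
  have d_zero: "dotn (Suc n) d v = 0" if v: "v \<in> X" for v
  proof (rule ccontr)
    assume "dotn (Suc n) d v \<noteq> 0"
    then have "dotn (Suc n) d v > 0" using d_nonneg[OF v] by simp
    then obtain v' where "v' \<in> X" "dotn (Suc n) d v' < 0" using balancedD[OF bal v] by blast
    then show False using d_nonneg by (meson not_le)
  qed
  have x0n: "x0 n = 0" using x0(1) by (auto simp: level_set_def level_point_at)
  have "dotn (Suc n) d x0 = 0"
    using x0(1) d_zero by (auto simp: level_set_def level_point_def dotn_lincomb)
  then show False using x0(2) x0n unfolding d by simp
qed

text \<open>A functional vanishing on the section \<open>x\<^sub>n = 0\<close> extends to one vanishing on \<open>X\<close>; the extension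
  involves dividing by \<open>v\<^sub>n\<close> for some \<open>v \<in> X\<close>, whence the bounded denominator \<open>D\<close>.\<close>

lemma perp_level_set_extend:
  fixes N w :: nat
  assumes int: "\<And>v. v \<in> X \<Longrightarrow> (\<lambda>i. real N * v i) \<in> Zn (Suc n)" and N: "N \<ge> 1"
    and bnd: "\<And>v. v \<in> X \<Longrightarrow> \<bar>v n\<bar> \<le> real w"
    and vp: "vp \<in> X" "vp n > 0" and vn: "vn \<in> X" "vn n < 0"
    and c: "c \<in> perp n (level_set n X)"
  shows "\<exists>D s. D \<in> \<int> \<and> 0 < D \<and> D \<le> real N * real w \<and> (\<lambda>i. D * c i)(n := s) \<in> perp (Suc n) X"
proof -
  have cZ: "c \<in> Zn n" and c0: "\<And>x. x \<in> level_set n X \<Longrightarrow> dotn n c x = 0"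
    using c by (auto simp: perp_def)
  \<comment> \<open>An extension vanishing at \<open>vp\<close> must have last coefficient
    \<open>- c vp / vp n\<close>; multiplication by \<open>N * vp n\<close> makes all coefficients
    integral.\<close>
  define D where "D = real N * vp n"
  define s where "s = - dotn n c (\<lambda>i. real N * vp i)"
  have D: "D \<in> \<int>" "0 < D" "D \<le> real N * real w"
    using int[OF vp(1)] N vp(2) bnd[OF vp(1)] by (auto simp: D_def Zn_iff intro!: mult_left_mono)
  have s: "s = - real N * dotn n c vp" by (simp add: s_def dotn_scale)
  have "dotn (Suc n) (c(n := 0)) (\<lambda>i. real N * vp i) \<in> \<int>"
    using int[OF vp(1)] cZ by (intro dotn_Ints) (auto simp: Zn_upd)
  then have "s \<in> \<int>" by (simp add: s_def dotn_Suc)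
  moreover have "(\<lambda>i. D * c i) \<in> Zn n" using cZ D(1) by (auto simp: Zn_iff Rn_def)
  ultimately have dZ: "(\<lambda>i. D * c i)(n := s) \<in> Zn (Suc n)" by (intro Zn_upd)
  have rel: "v n * dotn n c v' = v' n * dotn n c v"
    if "v \<in> X" "v' \<in> X" "v n > 0" "v' n < 0" for v v'
    using dotn_level_point[where v = v and n = n and v' = v' and m = n and c = c]
      c0[OF level_setI[OF that]] that by simp
  have "vp n * dotn n c v = v n * dotn n c vp" if v: "v \<in> X" for v
  proof (cases "v n" "0 :: real" rule: linorder_cases)
    case less
    then show ?thesis using rel[OF vp(1) v vp(2)] by simp
  next
    case equal
    then have "v \<in> level_set n X" using v by (simp add: level_set_def)
    then show ?thesis using c0 equal by simp
  next
    case greater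
    \<comment> \<open>\<open>v\<close> and \<open>vp\<close> lie on the same side of the hyperplane
      and are compared through \<open>vn\<close> on the other side.\<close>
    have "vn n * (vp n * dotn n c v) = vp n * (v n * dotn n c vn)"
      using rel[OF v vn(1) greater vn(2)] by simp
    also have "\<dots> = v n * (vp n * dotn n c vn)" by simp
    also have "\<dots> = vn n * (v n * dotn n c vp)"
      unfolding rel[OF vp(1) vn(1) vp(2) vn(2)] by simp
    finally show ?thesis using vn(2) by simp
  qed
  then have "dotn (Suc n) ((\<lambda>i. D * c i)(n := s)) v = 0" if "v \<in> X" for v
    using that by (simp add: dotn_Suc dotn_scale_left D_def s mult.assoc)
  then show ?thesis using D dZ unfolding perp_def by blast
qed

text \<open>The set \<open>X\<close> is independent of the integer points of \<open>Q\<close>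
  because sections produce fractional generators; only the inclusion in \<open>perp_perp n X\<close>
  ties the two together. The bound \<open>W\<close> may depend on \<open>n\<close> and
  \<open>N\<close> alone. As the origin lies in \<open>Q\<close>, widths give absolute
  bounds.\<close>

definition slab_bound :: "nat \<Rightarrow> nat \<Rightarrow> real \<Rightarrow> bool" where
  "slab_bound n N W \<longleftrightarrow> (\<forall>Q X. convexn Q \<longrightarrow> boundedn n Q \<longrightarrow> Q \<subseteq> Rn n \<longrightarrow> X \<subseteq> Q \<longrightarrow> (\<lambda>_. 0) \<in> X \<longrightarrow>
     (\<forall>v\<in>X. (\<lambda>i. real N * v i) \<in> Zn n) \<longrightarrow> balanced n X \<longrightarrow> Q \<inter> Zn n \<subseteq> perp_perp n X \<longrightarrow>
     (\<exists>c\<in>perp n X. c \<noteq> (\<lambda>_. 0)) \<longrightarrow>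
     (\<exists>c\<in>perp n X. c \<noteq> (\<lambda>_. 0) \<and> (\<forall>x\<in>Q. \<bar>dotn n c x\<bar> \<le> W)))"

lemma slab_boundD:
  assumes "slab_bound n N W" "convexn Q" "boundedn n Q" "Q \<subseteq> Rn n" "X \<subseteq> Q" "(\<lambda>_. 0) \<in> X"
    and "\<forall>v\<in>X. (\<lambda>i. real N * v i) \<in> Zn n" "balanced n X" "Q \<inter> Zn n \<subseteq> perp_perp n X"
    and "\<exists>c\<in>perp n X. c \<noteq> (\<lambda>_. 0)"
  shows "\<exists>c\<in>perp n X. c \<noteq> (\<lambda>_. 0) \<and> (\<forall>x\<in>Q. \<bar>dotn n c x\<bar> \<le> W)"
  using assms unfolding slab_bound_def by simp

text \<open>The case of a flat direction, here the last coordinate, that does not vanish on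
  \<open>X\<close>. The direction found for the section is extended to \<open>X\<close>, which costs
  a factor \<open>N * w\<close>; transferring its bound from the section to \<open>Q\<close> costs a
  further \<open>1 + w * N\<close>.\<close>

lemma slab_step:
  fixes N w :: nat
  assumes IH: "slab_bound n (N * fact (2 * N * w)) W" and W: "W \<ge> 0" and N: "N \<ge> 1"
    and Q: "convexn Q" "boundedn (Suc n) Q" "Q \<subseteq> Rn (Suc n)" and X: "X \<subseteq> Q" "(\<lambda>_. 0) \<in> X"
    and int: "\<And>v. v \<in> X \<Longrightarrow> (\<lambda>i. real N * v i) \<in> Zn (Suc n)" and bal: "balanced (Suc n) X"
    and pp: "Q \<inter> Zn (Suc n) \<subseteq> perp_perp (Suc n) X"
    and c0: "c0 \<in> perp (Suc n) X" "c0 \<noteq> (\<lambda>_. 0)"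
    and bnd: "\<And>x. x \<in> Q \<Longrightarrow> \<bar>x n\<bar> \<le> real w" and v0: "v0 \<in> X" "v0 n \<noteq> 0"
  shows "\<exists>c\<in>perp (Suc n) X. c \<noteq> (\<lambda>_. 0) \<and>
    (\<forall>x\<in>Q. \<bar>dotn (Suc n) c x\<bar> \<le> (1 + real w * real N) * (real N * real w * W))"
proof -
  define Q0 where "Q0 = {x \<in> Q. x n = 0}"
  define X0 where "X0 = level_set n X"
  have un: "dotn (Suc n) (unit_vec n) x = x n" for x by (simp add: dotn_unit_vec)
  obtain vp vn where vp: "vp \<in> X" "vp n > 0" and vn: "vn \<in> X" "vn n < 0"
    using balancedD[OF bal v0(1), of "unit_vec n"] balancedD'[OF bal v0(1), of "unit_vec n"] v0
    unfolding un by (metis linorder_neqE_linordered_idom)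
  have bX: "\<And>v. v \<in> X \<Longrightarrow> \<bar>v n\<bar> \<le> real w" using bnd X(1) by blast
  have Q0R: "Q0 \<subseteq> Rn n"
  proof
    fix x assume "x \<in> Q0"
    then have "x(n := 0) \<in> Rn n" "x n = 0" using Q(3) by (auto simp: Q0_def Rn_Suc_iff[symmetric])
    then show "x \<in> Rn n" by (metis fun_upd_triv)
  qed
  have X0Q: "X0 \<subseteq> Q0" unfolding X0_def Q0_def by (rule level_set_subset[OF Q(1) X(1) Q(3)])
  have conv: "convexn Q0"
    using Q(1) unfolding convexn_def Q0_def by (auto simp: lincomb_def)
  have "\<exists>B. \<forall>x\<in>Q0. \<bar>dotn n c x\<bar> \<le> B" for c
  proof -
    obtain B where "\<forall>x\<in>Q. \<bar>dotn (Suc n) c x\<bar> \<le> B" using Q(2) unfolding boundedn_def by blast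
    then show ?thesis by (intro exI[of _ B]) (auto simp: Q0_def dotn_Suc)
  qed
  then have bdd: "boundedn n Q0" by (simp add: boundedn_def)
  have extend: "\<exists>D s. D \<in> \<int> \<and> 0 < D \<and> D \<le> real N * real w \<and> (\<lambda>i. D * c i)(n := s) \<in> perp (Suc n) X"
    if "c \<in> perp n (level_set n X)" for c
    by (rule perp_level_set_extend[where X = X and n = n and N = N and w = w and vp = vp and vn = vn])
      (use int N bX vp vn that in auto)
  \<comment> \<open>A functional vanishing on \<open>X0\<close> extends, up to a positive factor, to
    one vanishing on \<open>X\<close> and thus at \<open>z\<close>; since \<open>z n = 0\<close>,
    the original vanishes at \<open>z\<close> as well.\<close>
  have pp0: "Q0 \<inter> Zn n \<subseteq> perp_perp n X0"
  proof
    fix z assume z: "z \<in> Q0 \<inter> Zn n"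
    have "dotn n c z = 0" if c: "c \<in> perp n X0" for c
    proof -
      obtain D s where D: "0 < D" "(\<lambda>i. D * c i)(n := s) \<in> perp (Suc n) X"
        using extend c unfolding X0_def by blast
      have "z \<in> perp_perp (Suc n) X" using z pp Zn_mono by (auto simp: Q0_def)
      then have "dotn (Suc n) ((\<lambda>i. D * c i)(n := s)) z = 0" using D(2) by (simp add: perp_perp_def)
      then show ?thesis using z D(1) by (simp add: dotn_Suc dotn_scale_left Q0_def)
    qed
    then show "z \<in> perp_perp n X0" using z by (simp add: perp_perp_def Zn_iff)
  qed
  have nontriv: "\<exists>c\<in>perp n X0. c \<noteq> (\<lambda>_. 0)"
  proof (intro bexI)
    have c0Z: "c0 \<in> Zn (Suc n)" and c0X: "\<And>v. v \<in> X \<Longrightarrow> dotn (Suc n) c0 v = 0"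
      using c0(1) by (auto simp: perp_def)
    \<comment> \<open>Otherwise \<open>c0\<close> would be a nonzero multiple of the last
      coordinate, which does not vanish at \<open>v0\<close>.\<close>
    show "c0(n := 0) \<noteq> (\<lambda>_. 0)"
    proof
      assume eq: "c0(n := 0) = (\<lambda>_. 0)"
      have z: "c0 i = 0" if "i \<noteq> n" for i using fun_cong[OF eq, of i] that by simp
      then have "c0 n \<noteq> 0" using c0(2) by (metis ext)
      moreover have "dotn (Suc n) c0 v0 = c0 n * v0 n" using z by (simp add: dotn_Suc dotn_def)
      ultimately show False using c0X[OF v0(1)] v0(2) by simp
    qed
    have "dotn n c0 x = 0" if x: "x \<in> X0" for x
    proof -
      have "x n = 0" using X0Q x by (auto simp: Q0_def)
      moreover have "dotn (Suc n) c0 x = 0"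
        using x c0X by (auto simp: X0_def level_set_def level_point_def dotn_lincomb)
      ultimately show ?thesis by (simp add: dotn_Suc)
    qed
    then show "c0(n := 0) \<in> perp n X0" using Zn_drop[OF c0Z] by (simp add: perp_def)
  qed
  have int0: "\<forall>v\<in>X0. (\<lambda>i. real (N * fact (2 * N * w)) * v i) \<in> Zn n"
  proof
    fix v assume v: "v \<in> X0"
    show "(\<lambda>i. real (N * fact (2 * N * w)) * v i) \<in> Zn n"
    proof (rule level_set_integral[where X = X and n = n and N = N and w = w])
      show "v \<in> Rn n" using v X0Q Q0R by blast
    qed (use int N bX v in \<open>auto simp: X0_def\<close>)
  qed
  have bal0: "balanced n X0" unfolding X0_def by (rule level_set_balanced[OF bal v0])
  have zero0: "(\<lambda>_. 0) \<in> X0" using X(2) by (simp add: X0_def level_set_def)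
  obtain c where c: "c \<in> perp n X0" "c \<noteq> (\<lambda>_. 0)" "\<forall>x\<in>Q0. \<bar>dotn n c x\<bar> \<le> W"
    using slab_boundD[OF IH conv bdd Q0R X0Q zero0 int0 bal0 pp0 nontriv] by blast
  obtain D s where D: "0 < D" "D \<le> real N * real w" "(\<lambda>i. D * c i)(n := s) \<in> perp (Suc n) X"
    using extend c(1) unfolding X0_def by blast
  define d where "d = (\<lambda>i. D * c i)(n := s)"
  have dX: "\<And>v. v \<in> X \<Longrightarrow> dotn (Suc n) d v = 0" using D(3) by (simp add: perp_def d_def)
  have d0: "\<bar>dotn (Suc n) d x\<bar> \<le> real N * real w * W" if "x \<in> Q0" for x
  proof -
    have "\<bar>dotn (Suc n) d x\<bar> = D * \<bar>dotn n c x\<bar>"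
      using that D(1) by (simp add: d_def dotn_Suc dotn_scale_left Q0_def abs_mult)
    also have "\<dots> \<le> real N * real w * W" using D c(3) W that by (intro mult_mono) auto
    finally show ?thesis .
  qed
  have "\<bar>dotn (Suc n) d x\<bar> \<le> (1 + real w * real N) * (real N * real w * W)" if x: "x \<in> Q" for x
  proof (cases "x n = 0")
    case True
    then have "\<bar>dotn (Suc n) d x\<bar> \<le> 1 * (real N * real w * W)" using d0 x by (simp add: Q0_def)
    also have "\<dots> \<le> (1 + real w * real N) * (real N * real w * W)"
      using W by (intro mult_right_mono) auto
    finally show ?thesis .
  next
    case False
    \<comment> \<open>A point across the hyperplane at which \<open>d\<close> vanishes. The segment
      from \<open>x\<close> to \<open>e\<close> meets \<open>Q0\<close> in \<open>y\<close> with
      \<open>d x = (1 - x n / e n) * d y\<close>, and \<open>\<bar>e n\<bar> \<ge> 1 / N\<close>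
      because \<open>N * e n\<close> is a nonzero integer.\<close>
    obtain e where e: "e \<in> X" "x n * e n < 0"
    proof (cases "x n > 0")
      case True
      then show ?thesis using that[OF vn(1)] vn(2) by (simp add: mult_pos_neg)
    next
      case False
      then show ?thesis using that[OF vp(1)] vp(2) \<open>x n \<noteq> 0\<close> by (simp add: mult_neg_pos)
    qed
    have en: "e n \<noteq> 0" "x n \<noteq> e n" using e(2) by (auto simp: mult_less_0_iff)
    define y where "y = level_point n x e"
    have "y \<in> Q0"
      using level_point_in[where v = x and v' = e and n = n, OF Q(1) x _ e(2)] X(1) e(1)
      by (auto simp: y_def Q0_def level_point_at)
    have "dotn (Suc n) d y = - e n / (x n - e n) * dotn (Suc n) d x"
      using dX[OF e(1)] by (simp add: y_def level_point_def dotn_lincomb)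
    then have "dotn (Suc n) d x = (1 - x n / e n) * dotn (Suc n) d y"
      using en by (simp add: field_simps)
    then have eq: "\<bar>dotn (Suc n) d x\<bar> = \<bar>1 - x n / e n\<bar> * \<bar>dotn (Suc n) d y\<bar>" by (simp add: abs_mult)
    have "real N * e n \<in> \<int>" using int[OF e(1)] by (simp add: Zn_iff)
    moreover have "real N * e n \<noteq> 0" using N en by simp
    ultimately have "1 \<le> \<bar>real N * e n\<bar>" by (rule Ints_nonzero_abs_ge1)
    then have "1 / \<bar>e n\<bar> \<le> real N" using en(1) by (simp add: abs_mult field_simps)
    then have "\<bar>x n\<bar> * (1 / \<bar>e n\<bar>) \<le> real w * real N" using bnd[OF x] by (intro mult_mono) auto
    then have "\<bar>1 - x n / e n\<bar> \<le> 1 + real w * real N"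
      by (intro order_trans[OF abs_triangle_ineq4]) (simp add: abs_divide)
    then show ?thesis
      unfolding eq using d0[OF \<open>y \<in> Q0\<close>] W by (intro mult_mono) auto
  qed
  moreover have "d \<noteq> (\<lambda>_. 0)"
  proof
    assume eq: "d = (\<lambda>_. 0)"
    have "c i = 0" if "i \<noteq> n" for i using fun_cong[OF eq, of i] that D(1) by (simp add: d_def)
    moreover have "c n = 0" using c(1) by (simp add: perp_def Zn_iff Rn_at)
    ultimately have "c i = 0" for i by metis
    then show False using c(2) by auto
  qed
  ultimately show ?thesis using D(3) unfolding d_def by blast
qed

text \<open>A flat direction that vanishes on \<open>X\<close> is already as desired; any other is
  made the last coordinate for \<open>slab_step\<close>. Since a section enlarges the denominator,
  \<open>N\<close> has to vary in the induction.\<close>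

lemma slab: "N \<ge> 1 \<Longrightarrow> \<exists>W\<ge>0. slab_bound n N W"
proof (induction n arbitrary: N)
  case 0
  show ?case by (auto simp: slab_bound_def perp_def Zn_iff Rn_zero_iff intro!: exI[of _ 0])
next
  case (Suc n)
  obtain w :: nat where w: "\<And>Q c0. convexn Q \<Longrightarrow> boundedn (Suc n) Q \<Longrightarrow> Q \<subseteq> Rn (Suc n) \<Longrightarrow> Q \<noteq> {} \<Longrightarrow>
     c0 \<in> Zn (Suc n) \<Longrightarrow> c0 \<noteq> (\<lambda>_. 0) \<Longrightarrow> \<forall>z\<in>Q \<inter> Zn (Suc n). dotn (Suc n) c0 z = 0 \<Longrightarrow>
     \<exists>c\<in>Zn (Suc n). c \<noteq> (\<lambda>_. 0) \<and> width_le (Suc n) Q c (real w)"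
    using flat_if_integer_points_in_hyperplane[of "Suc n"] by metis
  have "N * fact (2 * N * w) \<ge> 1" using Suc.prems by simp
  then obtain W where W: "W \<ge> 0" "slab_bound n (N * fact (2 * N * w)) W" using Suc.IH by blast
  define W' where "W' = real w + (1 + real w * real N) * (real N * real w * W)"
  have W'_ge: "real w \<le> W'" "(1 + real w * real N) * (real N * real w * W) \<le> W'"
    using W(1) by (simp_all add: W'_def)
  have "slab_bound (Suc n) N W'"
    unfolding slab_bound_def
  proof (intro allI impI)
    fix Q X
    assume Q: "convexn Q" "boundedn (Suc n) Q" "Q \<subseteq> Rn (Suc n)" and X: "X \<subseteq> Q" "(\<lambda>_. 0) \<in> X"
      and int: "\<forall>v\<in>X. (\<lambda>i. real N * v i) \<in> Zn (Suc n)" and bal: "balanced (Suc n) X"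
      and pp: "Q \<inter> Zn (Suc n) \<subseteq> perp_perp (Suc n) X"
      and "\<exists>c\<in>perp (Suc n) X. c \<noteq> (\<lambda>_. 0)"
    then obtain c0 where c0: "c0 \<in> perp (Suc n) X" "c0 \<noteq> (\<lambda>_. 0)" by blast
    have XR: "X \<subseteq> Rn (Suc n)" using X(1) Q(3) by blast
    have "\<forall>z\<in>Q \<inter> Zn (Suc n). dotn (Suc n) c0 z = 0" using pp c0(1) by (auto simp: perp_perp_def)
    moreover have "Q \<noteq> {}" "c0 \<in> Zn (Suc n)" using X c0 by (auto simp: perp_def)
    ultimately obtain c where c: "c \<in> Zn (Suc n)" "c \<noteq> (\<lambda>_. 0)" "width_le (Suc n) Q c (real w)"
      using w[OF Q _ _ c0(2)] by blast
    have cw: "\<bar>dotn (Suc n) c x\<bar> \<le> real w" if "x \<in> Q" for x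
      using width_leD[OF c(3) that, of "\<lambda>_. 0"] width_leD[OF c(3) _ that, of "\<lambda>_. 0"] X by auto
    show "\<exists>c\<in>perp (Suc n) X. c \<noteq> (\<lambda>_. 0) \<and> (\<forall>x\<in>Q. \<bar>dotn (Suc n) c x\<bar> \<le> W')"
    proof (cases "c \<in> perp (Suc n) X")
      case True
      then show ?thesis using c(2) cw W'_ge(1) by (meson order_trans)
    next
      case False
      then obtain v where v: "v \<in> X" "dotn (Suc n) c v \<noteq> 0" using c(1) by (auto simp: perp_def)
      obtain f f' t t' g where f: "unimod (Suc n) f f' t t'" "g \<ge> 1"
        "\<And>x. x \<in> Rn (Suc n) \<Longrightarrow> dotn (Suc n) c (f x) = g * x n"
        using unimod_reduce_functional[OF c(1,2)] by blast
      let ?Q = "preimg (Suc n) f Q" and ?X = "preimg (Suc n) f X"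
      have "\<exists>d\<in>perp (Suc n) ?X. d \<noteq> (\<lambda>_. 0) \<and>
          (\<forall>x\<in>?Q. \<bar>dotn (Suc n) d x\<bar> \<le> (1 + real w * real N) * (real N * real w * W))"
      proof (rule slab_step[OF W(2,1) Suc.prems])
        show "convexn ?Q" "boundedn (Suc n) ?Q" "?Q \<subseteq> Rn (Suc n)" "?X \<subseteq> ?Q"
          using unimod_convexn[OF f(1) Q(1)] unimod_boundedn[OF f(1) Q(2)] X(1) by auto
        show "(\<lambda>_. 0) \<in> ?X" using X(2) unimod_zero[OF f(1)] by simp
        show "balanced (Suc n) ?X" by (rule unimod_balanced[OF f(1) XR bal])
        show "?Q \<inter> Zn (Suc n) \<subseteq> perp_perp (Suc n) ?X"
        proof
          fix x assume x: "x \<in> ?Q \<inter> Zn (Suc n)"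
          then have "f x \<in> perp_perp (Suc n) X" using pp unimod_Zn[OF f(1)] by blast
          then show "x \<in> perp_perp (Suc n) ?X" using unimod_perp_perp[OF f(1) _ XR] x by blast
        qed
        show "t c0 \<in> perp (Suc n) ?X" by (rule unimod_perp[OF f(1) c0(1)])
        show "t c0 \<noteq> (\<lambda>_. 0)"
          using c0 by (intro unimod_nonzero[OF unimod_transpose[OF f(1)]]) (auto simp: perp_def Zn_iff)
        show "\<bar>x n\<bar> \<le> real w" if "x \<in> ?Q" for x
        proof -
          have "g * \<bar>x n\<bar> \<le> real w" using cw[of "f x"] f(2,3) that by (simp add: abs_mult)
          then show ?thesis using f(2) by (rule le_of_scaled_le) simp
        qed
        have v': "f' v \<in> ?X" by (rule unimod_preimg_inverse[OF f(1) v(1) XR])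
        then show "f' v \<in> ?X" .
        have "f (f' v) = v" using unimod_right_inv[OF f(1)] v(1) XR by blast
        then show "f' v n \<noteq> 0" using f(3)[of "f' v"] v' v(2) by auto
        show "(\<lambda>i. real N * u i) \<in> Zn (Suc n)" if u: "u \<in> ?X" for u
        proof -
          have inv: "unimod (Suc n) f' f t' t" by (rule unimod_inverse[OF f(1)])
          have sc: "(\<lambda>i. real N * y i) = lincomb (real N) y 0 y" for y by (simp add: lincomb_def)
          have uR: "u \<in> Rn (Suc n)" "f u \<in> Rn (Suc n)" using u XR by auto
          have "f' (\<lambda>i. real N * f u i) = (\<lambda>i. real N * u i)"
            unfolding sc unimod_lincomb[OF inv uR(2,2)] unimod_left_inv[OF f(1) uR(1)] ..
          moreover have "(\<lambda>i. real N * f u i) \<in> Zn (Suc n)" using int u by auto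
          ultimately show ?thesis using unimod_Zn[OF inv] by metis
        qed
      qed
      then obtain d where d: "d \<in> perp (Suc n) ?X" "d \<noteq> (\<lambda>_. 0)"
        "\<forall>x\<in>?Q. \<bar>dotn (Suc n) d x\<bar> \<le> (1 + real w * real N) * (real N * real w * W)" by blast
      have dZ: "d \<in> Zn (Suc n)" using d(1) by (simp add: perp_def)
      have "\<bar>dotn (Suc n) (t' d) x\<bar> \<le> W'" if x: "x \<in> Q" for x
      proof -
        have "\<bar>dotn (Suc n) d (f' x)\<bar> \<le> (1 + real w * real N) * (real N * real w * W)"
          using d(3) unimod_preimg_inverse[OF f(1) x Q(3)] by blast
        moreover have "x \<in> Rn (Suc n)" using x Q(3) by blast
        ultimately show ?thesis using unimod_functional(3)[OF f(1) dZ d(2)] W'_ge(2) by simp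
      qed
      then show ?thesis
        using unimod_perp_inverse[OF f(1) XR d(1)] unimod_functional(2)[OF f(1) dZ d(2)] by blast
    qed
  qed
  moreover have "W' \<ge> 0" using W'_ge(1) by linarith
  ultimately show ?case by blast
qed

section \<open>Reduction to the affine hull\<close>

lemma balanced_drop:
  assumes "balanced (Suc n) X" "\<And>x. x \<in> X \<Longrightarrow> x(n := 0) \<in> Y" "\<And>y. y \<in> Y \<Longrightarrow> \<exists>x\<in>X. y = x(n := 0)"
  shows "balanced n Y"
proof -
  have eq: "dotn n c (x(n := 0)) = dotn (Suc n) (c(n := 0)) x" for c x by (simp add: dotn_Suc)
  have "\<exists>y\<in>Y. dotn n c y < 0" if y: "y \<in> Y" "dotn n c y > 0" for c y
  proof -
    obtain x where "x \<in> X" "y = x(n := 0)" using assms(3)[OF y(1)] by blast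
    then obtain x' where "x' \<in> X" "dotn (Suc n) (c(n := 0)) x' < 0"
      using balancedD[OF assms(1), of x "c(n := 0)"] y(2) eq by metis
    then show ?thesis using assms(2)[of x'] eq[of c x'] by metis
  qed
  then show ?thesis unfolding balanced_def by blast
qed

lemma rational_polyhedron_hyperplane:
  assumes "rational_polyhedron n Q" "c \<in> Zn n" "j \<in> \<int>"
  shows "rational_polyhedron n {x \<in> Q. dotn n c x = j}"
proof -
  have neg: "dotn n (\<lambda>i. - c i) x = - dotn n c x" for x by (simp add: dotn_def sum_negf)
  have "rational_polyhedron n (Q \<inter> sols n {(c, j), (\<lambda>i. - c i, - j)})"
    using assms Ints_subset_Rats
    by (intro rational_polyhedron_Int_sols) (auto simp: rat_ineq_def Zn_iff)
  also have "Q \<inter> sols n {(c, j), (\<lambda>i. - c i, - j)} = {x \<in> Q. dotn n c x = j}"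
    using rational_polyhedron_subset[OF assms(1)] by (auto simp: sols_def neg)
  finally show ?thesis .
qed

text \<open>Integer points of the projection along the ray lift by rounding up, so the projection is
  again balanced. Functionals vanishing at the integer points of \<open>Q\<close> vanish on the ray
  and therefore descend.\<close>

lemma integral_ray_reduction:
  assumes IH: "\<And>Q. rational_polyhedron n Q \<Longrightarrow> (\<lambda>_. 0) \<in> Q \<Longrightarrow> balanced n (Q \<inter> Zn n) \<Longrightarrow>
      cg_red n k Q (perp_perp n (Q \<inter> Zn n))"
    and Q: "rational_polyhedron (Suc n) Q" "(\<lambda>_. 0) \<in> Q" "balanced (Suc n) (Q \<inter> Zn (Suc n))"
    and r: "r \<in> Zn (Suc n)" "r \<noteq> (\<lambda>_. 0)" "\<forall>x\<in>Q. \<forall>t\<ge>0. lincomb 1 x t r \<in> Q"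
  shows "cg_red (Suc n) k Q (perp_perp (Suc n) (Q \<inter> Zn (Suc n)))"
proof -
  let ?X = "Q \<inter> Zn (Suc n)"
  have QR: "Q \<subseteq> Rn (Suc n)" by (rule rational_polyhedron_subset[OF Q(1)])
  obtain f f' t t' where f: "unimod (Suc n) f f' t t'"
    and up: "\<forall>x\<in>preimg (Suc n) f Q. \<forall>y\<ge>x n. x(n := y) \<in> preimg (Suc n) f Q"
    using integral_ray_normal_form[OF r] by blast
  let ?Q = "preimg (Suc n) f Q"
  let ?P = "{x \<in> Rn n. \<exists>t. x(n := t) \<in> ?Q}"
  have Q': "rational_polyhedron (Suc n) ?Q" by (rule unimod_rational_polyhedron[OF f Q(1)])
  have X': "?Q \<inter> Zn (Suc n) = preimg (Suc n) f ?X" by (rule unimod_preimg_Zn[OF f])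
  have zero: "(\<lambda>_. 0) \<in> ?Q" using Q(2) unimod_zero[OF f] by simp
  have lift: "\<exists>x\<in>?Q \<inter> Zn (Suc n). z = x(n := 0)" if z: "z \<in> ?P \<inter> Zn n" for z
  proof -
    obtain s where s: "z(n := s) \<in> ?Q" using z by blast
    have "(z(n := s)) n \<le> of_int \<lceil>s\<rceil>" by simp
    with up s have "(z(n := s))(n := of_int \<lceil>s\<rceil>) \<in> ?Q" by blast
    then have "z(n := of_int \<lceil>s\<rceil>) \<in> ?Q \<inter> Zn (Suc n)"
      using Zn_upd[of z n "of_int \<lceil>s\<rceil>"] z by simp
    moreover have "z = (z(n := of_int \<lceil>s\<rceil>))(n := 0)"
      using z Rn_at[of z n] by (auto simp: fun_eq_iff)
    ultimately show ?thesis by blast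
  qed
  have drop: "x(n := 0) \<in> ?P \<inter> Zn n" if "x \<in> ?Q \<inter> Zn (Suc n)" for x
  proof -
    have "(x(n := 0))(n := x n) \<in> ?Q" using that by simp
    then show ?thesis using Zn_drop[of x n] that Zn_iff by blast
  qed
  have "balanced (Suc n) (?Q \<inter> Zn (Suc n))"
    unfolding X' by (rule unimod_balanced[OF f _ Q(3)]) (use QR in blast)
  then have "balanced n (?P \<inter> Zn n)" by (rule balanced_drop[OF _ drop lift])
  moreover have "(\<lambda>_. 0) \<in> ?P"
  proof -
    have "(\<lambda>_. 0)(n := 0) \<in> ?Q" using zero by (simp add: fun_upd_idem)
    then show ?thesis using zero_in_Rn[of n] by blast
  qed
  ultimately have "cg_red n k ?P (perp_perp n (?P \<inter> Zn n))"
    by (intro IH rational_polyhedron_projection[OF Q'])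
  then have "cg_red (Suc n) k ?Q {x. x(n := 0) \<in> perp_perp n (?P \<inter> Zn n)}"
    by (rule cg_red_project) auto
  then have red: "cg_red (Suc n) k ?Q ({x. x(n := 0) \<in> perp_perp n (?P \<inter> Zn n)} \<inter> ?Q)"
    by (rule cg_red_Int)
  have incl: "f x \<in> perp_perp (Suc n) ?X"
    if x: "x \<in> ?Q" "x(n := 0) \<in> perp_perp n (?P \<inter> Zn n)" for x
  proof -
    have "dotn (Suc n) c (f x) = 0" if c: "c \<in> perp (Suc n) ?X" for c
    proof -
      define d where "d = t c"
      have dp: "d \<in> perp (Suc n) (?Q \<inter> Zn (Suc n))"
        unfolding d_def X' by (rule unimod_perp[OF f c])
      \<comment> \<open>The origin lies in \<open>?Q\<close>, and so does the unit vector above it.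
        As \<open>d\<close> vanishes at this integer point, it has no last coefficient.\<close>
      have "(\<lambda>_. 0)(n := 1 :: real) \<in> ?Q" 
        using up[THEN bspec, OF zero, THEN spec, of 1] by simp
      moreover have "(\<lambda>_. 0)(n := 1 :: real) \<in> Zn (Suc n)" by (intro Zn_upd) auto
      ultimately have "dotn (Suc n) d ((\<lambda>_. 0)(n := 1)) = 0" using dp unfolding perp_def by blast
      then have dn: "d n = 0" by (simp add: dotn_Suc)
      have dZ: "d \<in> Zn (Suc n)" using dp by (simp add: perp_def)
      have "d(n := 0) = d" using dn by auto
      then have "d \<in> Zn n" using Zn_drop[OF dZ] by simp
      moreover have "dotn n d z = 0" if z: "z \<in> ?P \<inter> Zn n" for z
      proof -
        obtain y where y: "y \<in> ?Q \<inter> Zn (Suc n)" "z = y(n := 0)" using lift[OF z] by blast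
        then have "dotn (Suc n) d y = 0" using dp unfolding perp_def by blast
        then show ?thesis using y(2) dn by (simp add: dotn_Suc)
      qed
      ultimately have "d \<in> perp n (?P \<inter> Zn n)" unfolding perp_def by blast
      then have "dotn n d (x(n := 0)) = 0" using x(2) unfolding perp_perp_def by blast
      then have "dotn (Suc n) d x = 0" using dn by (simp add: dotn_Suc)
      moreover have "dotn (Suc n) c (f x) = dotn (Suc n) d x"
        using unimod_adjoint[OF f, of c x] c x(1) by (simp add: d_def perp_def Zn_iff)
      ultimately show ?thesis by simp
    qed
    then show ?thesis using x(1) unimod_Rn[OF f] by (simp add: perp_perp_def)
  qed
  have "cg_red (Suc n) k ?Q {x. f x \<in> perp_perp (Suc n) ?X}"
    by (rule cg_red_mono[OF red]) (use incl in auto)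
  then show ?thesis by (rule cg_red_unimod[OF f _ QR])
qed

lemma hyperplane_reduction:
  assumes IH: "\<And>Q. rational_polyhedron n Q \<Longrightarrow> (\<lambda>_. 0) \<in> Q \<Longrightarrow> balanced n (Q \<inter> Zn n) \<Longrightarrow>
      cg_red n k Q (perp_perp n (Q \<inter> Zn n))"
    and Q: "rational_polyhedron (Suc n) Q" "(\<lambda>_. 0) \<in> Q" "balanced (Suc n) (Q \<inter> Zn (Suc n))"
    and c0: "c0 \<in> Zn (Suc n)" "c0 \<noteq> (\<lambda>_. 0)" "\<And>x. x \<in> Q \<Longrightarrow> dotn (Suc n) c0 x = 0"
  shows "cg_red (Suc n) k Q (perp_perp (Suc n) (Q \<inter> Zn (Suc n)))"
proof -
  let ?X = "Q \<inter> Zn (Suc n)"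
  have QR: "Q \<subseteq> Rn (Suc n)" by (rule rational_polyhedron_subset[OF Q(1)])
  obtain f f' t t' g where f: "unimod (Suc n) f f' t t'" "g \<ge> 1"
    "\<And>x. x \<in> Rn (Suc n) \<Longrightarrow> dotn (Suc n) c0 (f x) = g * x n"
    using unimod_reduce_functional[OF c0(1,2)] by blast
  let ?Q = "preimg (Suc n) f Q"
  let ?P = "{x \<in> Rn n. x(n := 0) \<in> ?Q}"
  have Q': "rational_polyhedron (Suc n) ?Q" by (rule unimod_rational_polyhedron[OF f(1) Q(1)])
  have X': "?Q \<inter> Zn (Suc n) = preimg (Suc n) f ?X" by (rule unimod_preimg_Zn[OF f(1)])
  have xn: "x n = 0" if "x \<in> ?Q" for x
  proof -
    have "g * x n = 0" using f(3)[of x] c0(3)[of "f x"] that by simp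
    then show ?thesis using f(2) by simp
  qed
  have idem: "x(n := 0) = x" if "x \<in> Rn n" for x using Rn_at[OF that] by auto
  have lift: "\<exists>x\<in>?Q \<inter> Zn (Suc n). z = x(n := 0)" if z: "z \<in> ?P \<inter> Zn n" for z
  proof -
    have "z(n := 0) = z" using z by (intro idem) blast
    then have "z \<in> ?Q \<inter> Zn (Suc n)" using z Zn_mono[of z n] by simp
    then show ?thesis using \<open>z(n := 0) = z\<close> by (intro bexI[of _ z]) simp
  qed
  have drop: "x(n := 0) \<in> ?P \<inter> Zn n" if "x \<in> ?Q \<inter> Zn (Suc n)" for x
  proof -
    have "x(n := 0) = x" using xn that by (auto simp: fun_eq_iff)
    then show ?thesis using Zn_drop[of x n] that Zn_iff[of x n] by simp
  qed
  have "balanced (Suc n) (?Q \<inter> Zn (Suc n))"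
    unfolding X' by (rule unimod_balanced[OF f(1) _ Q(3)]) (use QR in blast)
  then have "balanced n (?P \<inter> Zn n)" by (rule balanced_drop[OF _ drop lift])
  moreover have "(\<lambda>_. 0) \<in> ?P"
    using Q(2) unimod_zero[OF f(1)] by (simp add: fun_upd_idem)
  moreover have "rational_polyhedron n ?P" by (rule rational_polyhedron_slice[OF Q']) simp
  ultimately have "cg_red n k ?P (perp_perp n (?P \<inter> Zn n))" by (intro IH)
  then have "cg_red (Suc n) k {x \<in> ?Q. x n = 0} {x. x(n := 0) \<in> perp_perp n (?P \<inter> Zn n)}"
    by (rule cg_red_slice) auto
  moreover have "{x \<in> ?Q. x n = 0} = ?Q" using xn by blast
  ultimately have "cg_red (Suc n) k ?Q {x. x(n := 0) \<in> perp_perp n (?P \<inter> Zn n)}" by (simp only:)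
  then have red: "cg_red (Suc n) k ?Q ({x. x(n := 0) \<in> perp_perp n (?P \<inter> Zn n)} \<inter> ?Q)"
    by (rule cg_red_Int)
  have incl: "f x \<in> perp_perp (Suc n) ?X"
    if x: "x \<in> ?Q" "x(n := 0) \<in> perp_perp n (?P \<inter> Zn n)" for x
  proof -
    have "dotn (Suc n) c (f x) = 0" if c: "c \<in> perp (Suc n) ?X" for c
    proof -
      define d where "d = t c"
      have dp: "d \<in> perp (Suc n) (?Q \<inter> Zn (Suc n))"
        unfolding d_def X' by (rule unimod_perp[OF f(1) c])
      have "dotn n (d(n := 0)) z = 0" if z: "z \<in> ?P \<inter> Zn n" for z
      proof -
        obtain y where y: "y \<in> ?Q \<inter> Zn (Suc n)" "z = y(n := 0)" using lift[OF z] by blast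
        then have "dotn (Suc n) d y = 0" using dp unfolding perp_def by blast
        then show ?thesis using y xn[of y] by (simp add: dotn_Suc)
      qed
      moreover have "d(n := 0) \<in> Zn n" using dp by (intro Zn_drop) (simp add: perp_def)
      ultimately have "d(n := 0) \<in> perp n (?P \<inter> Zn n)" unfolding perp_def by blast
      then have "dotn n (d(n := 0)) (x(n := 0)) = 0" using x(2) unfolding perp_perp_def by blast
      then have "dotn (Suc n) d x = 0" using xn[OF x(1)] by (simp add: dotn_Suc)
      moreover have "dotn (Suc n) c (f x) = dotn (Suc n) d x"
        using unimod_adjoint[OF f(1), of c x] c x(1) by (simp add: d_def perp_def Zn_iff)
      ultimately show ?thesis by simp
    qed
    then show ?thesis using x(1) unimod_Rn[OF f(1)] by (simp add: perp_perp_def)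
  qed
  have "cg_red (Suc n) k ?Q {x. f x \<in> perp_perp (Suc n) ?X}"
    by (rule cg_red_mono[OF red]) (use incl in auto)
  then show ?thesis by (rule cg_red_unimod[OF f(1) _ QR])
qed

lemma balanced_cg_red:
  "\<exists>k. \<forall>Q. rational_polyhedron n Q \<longrightarrow> (\<lambda>_. 0) \<in> Q \<longrightarrow> balanced n (Q \<inter> Zn n) \<longrightarrow>
     cg_red n k Q (perp_perp n (Q \<inter> Zn n))"
proof (induction n)
  case 0
  have "Q \<subseteq> perp_perp 0 X" if "rational_polyhedron 0 Q" for Q X
    using rational_polyhedron_subset[OF that] by (auto simp: perp_perp_def dotn_def)
  then have "cg_red 0 0 Q (perp_perp 0 (Q \<inter> Zn 0))" if "rational_polyhedron 0 Q" for Q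
    using that by simp
  then show ?case by blast
next
  case (Suc n)
  then obtain k where IH: "\<And>Q. rational_polyhedron n Q \<Longrightarrow> (\<lambda>_. 0) \<in> Q \<Longrightarrow> balanced n (Q \<inter> Zn n) \<Longrightarrow>
      cg_red n k Q (perp_perp n (Q \<inter> Zn n))" by blast
  obtain l where l: "\<And>Q. rational_polyhedron (Suc n) Q \<Longrightarrow> Q \<inter> Zn (Suc n) = {} \<Longrightarrow> cg_red (Suc n) l Q {}"
    using integer_free_cg_red[of "Suc n"] by blast
  \<comment> \<open>The recursion on denominators starts at 1, with \<open>X\<close> the set of
    integer points of \<open>Q\<close>.\<close>
  obtain W where W: "W \<ge> 0" "slab_bound (Suc n) 1 W" using slab[of 1 "Suc n"] by auto
  define m where "m = nat \<lceil>W\<rceil>"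
  have m: "W \<le> real m" unfolding m_def by (rule real_nat_ceiling_ge)
  \<comment> \<open>\<open>m * Suc l\<close> rounds bring \<open>c\<close> from \<open>m\<close>
    down to 0, as many do so for \<open>- c\<close>, and \<open>k\<close> rounds remain for the
    polyhedron inside the hyperplane.\<close>
  let ?K = "m * Suc l + (m * Suc l + k)"
  have "cg_red (Suc n) ?K Q (perp_perp (Suc n) (Q \<inter> Zn (Suc n)))"
    if Q: "rational_polyhedron (Suc n) Q" "(\<lambda>_. 0) \<in> Q" "balanced (Suc n) (Q \<inter> Zn (Suc n))" for Q
  proof (cases "boundedn (Suc n) Q")
    case False
    then obtain r where r: "r \<in> Zn (Suc n)" "r \<noteq> (\<lambda>_. 0)" "\<forall>x\<in>Q. \<forall>t\<ge>0. lincomb 1 x t r \<in> Q"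
      using bounded_or_integral_ray[OF Q(1)] by blast
    have "cg_red (Suc n) k Q (perp_perp (Suc n) (Q \<inter> Zn (Suc n)))"
      by (rule integral_ray_reduction[OF IH Q r])
    then show ?thesis by (rule cg_red_le) simp
  next
    case True
    let ?X = "Q \<inter> Zn (Suc n)"
    have QR: "Q \<subseteq> Rn (Suc n)" by (rule rational_polyhedron_subset[OF Q(1)])
    show ?thesis
    proof (cases "\<exists>c\<in>perp (Suc n) ?X. c \<noteq> (\<lambda>_. 0)")
      case False
      then have "Q \<subseteq> perp_perp (Suc n) ?X" using QR by (auto simp: perp_perp_def)
      then show ?thesis by (rule cg_red_triv)
    next
      case nontriv: True
      have "?X \<subseteq> perp_perp (Suc n) ?X"
        using QR by (auto simp: perp_perp_def perp_def)
      moreover have "\<forall>v\<in>?X. (\<lambda>i. real 1 * v i) \<in> Zn (Suc n)" by simp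
      ultimately obtain c where c: "c \<in> perp (Suc n) ?X" "c \<noteq> (\<lambda>_. 0)" "\<forall>x\<in>Q. \<bar>dotn (Suc n) c x\<bar> \<le> W"
        using slab_boundD[OF W(2) rational_polyhedron_convexn[OF Q(1)] True QR _ _ _ Q(3) _ nontriv] Q(2)
        by auto
      have push: "cg_red (Suc n) (m * Suc l) R {x. dotn (Suc n) d x \<le> 0}"
        if R: "rational_polyhedron (Suc n) R" "R \<inter> Zn (Suc n) = ?X"
          and d: "d \<in> perp (Suc n) ?X" "\<And>x. x \<in> R \<Longrightarrow> dotn (Suc n) d x \<le> real m" for R d
      proof (rule cg_red_push_iter[OF R(1)])
        show dZ: "d \<in> Zn (Suc n)" using d(1) by (simp add: perp_def)
        show "dotn (Suc n) d x \<le> 0 + real m" if "x \<in> R" for x using d(2)[OF that] by simp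
        show "cg_red (Suc n) l {x \<in> R. dotn (Suc n) d x = j} {}" if "0 < j" "j \<in> \<int>" for j
        proof (rule l[OF rational_polyhedron_hyperplane[OF R(1) dZ that(2)]])
          have "dotn (Suc n) d x = 0" if "x \<in> R \<inter> Zn (Suc n)" for x
            using d(1) that unfolding R(2) perp_def by blast
          then show "{x \<in> R. dotn (Suc n) d x = j} \<inter> Zn (Suc n) = {}" using \<open>0 < j\<close> by force
        qed
      qed simp
      have neg: "dotn (Suc n) (\<lambda>i. - c i) x = - dotn (Suc n) c x" for x
        by (simp add: dotn_def sum_negf)
      have c_neg: "(\<lambda>i. - c i) \<in> perp (Suc n) ?X"
        using c(1) by (auto simp: perp_def neg Zn_iff Rn_def)
      have cm: "\<bar>dotn (Suc n) c x\<bar> \<le> real m" if "x \<in> Q" for x using c(3) m that by force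
      have "dotn (Suc n) c x \<le> real m" if "x \<in> Q" for x using cm[OF that] by simp
      then have "cg_red (Suc n) (m * Suc l) Q {x. dotn (Suc n) c x \<le> 0}"
        by (intro push[OF Q(1) refl c(1)])
      then show ?thesis
      proof (rule cg_red_trans[OF Q(1)])
        fix R assume R: "rational_polyhedron (Suc n) R" "R \<subseteq> Q" "R \<subseteq> {x. dotn (Suc n) c x \<le> 0}"
          "R \<inter> Zn (Suc n) = Q \<inter> Zn (Suc n)"
        have "dotn (Suc n) (\<lambda>i. - c i) x \<le> real m" if "x \<in> R" for x
          using cm[of x] that R(2) by (auto simp: neg abs_le_iff)
        then have "cg_red (Suc n) (m * Suc l) R {x. dotn (Suc n) (\<lambda>i. - c i) x \<le> 0}"
          by (intro push[OF R(1,4) c_neg])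
        then show "cg_red (Suc n) (m * Suc l + k) R (perp_perp (Suc n) ?X)"
        proof (rule cg_red_trans[OF R(1)])
          fix S assume S: "rational_polyhedron (Suc n) S" "S \<subseteq> R"
            "S \<subseteq> {x. dotn (Suc n) (\<lambda>i. - c i) x \<le> 0}" "S \<inter> Zn (Suc n) = R \<inter> Zn (Suc n)"
          have SX: "S \<inter> Zn (Suc n) = ?X" using S(4) R(4) by simp
          have "(\<lambda>_. 0) \<in> S" using SX Q(2) zero_in_Zn by blast
          moreover have "dotn (Suc n) c x = 0" if "x \<in> S" for x
            using S(2,3) R(3) that by (force simp: neg)
          moreover have "c \<in> Zn (Suc n)" using c(1) by (simp add: perp_def)
          ultimately have "cg_red (Suc n) k S (perp_perp (Suc n) (S \<inter> Zn (Suc n)))"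
            using Q(3) c(2) unfolding SX[symmetric] by (intro hyperplane_reduction[OF IH S(1)])
          then show "cg_red (Suc n) k S (perp_perp (Suc n) ?X)" unfolding SX .
        qed
      qed
    qed
  qed
  then show ?case by blast
qed

section \<open>Rational subspaces and affine hulls\<close>

inductive_set lin_span :: "(nat \<Rightarrow> real) set \<Rightarrow> (nat \<Rightarrow> real) set" for X where
  zero: "(\<lambda>_. 0) \<in> lin_span X"
| add: "x \<in> lin_span X \<Longrightarrow> v \<in> X \<Longrightarrow> lincomb 1 x t v \<in> lin_span X"

lemma lin_span_base: "v \<in> X \<Longrightarrow> v \<in> lin_span X"
  using lin_span.add[OF lin_span.zero, of v X 1] by (simp add: lincomb_def)

lemma lin_span_lincomb:
  assumes "y \<in> lin_span X" "x \<in> lin_span X" shows "lincomb s x t y \<in> lin_span X"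
proof -
  have sx: "lincomb s x 0 y \<in> lin_span X"
    using assms(2)
  proof induction
    case zero
    then show ?case using lin_span.zero by (simp add: lincomb_def)
  next
    case (add x v t)
    have "lincomb s (lincomb 1 x t v) 0 y = lincomb 1 (lincomb s x 0 y) (s * t) v"
      by (auto simp: lincomb_def algebra_simps)
    then show ?case using lin_span.add[OF add.IH add.hyps(2)] by simp
  qed
  from assms(1) show ?thesis
  proof induction
    case zero
    then show ?case using sx by (simp add: lincomb_def)
  next
    case (add z v u)
    have "lincomb s x t (lincomb 1 z u v) = lincomb 1 (lincomb s x t z) (t * u) v"
      by (auto simp: lincomb_def algebra_simps)
    then show ?case using lin_span.add[OF add.IH add.hyps(2)] by simp
  qed
qed

lemma lin_span_trans:
  assumes "x \<in> lin_span X" "X \<subseteq> lin_span Y" shows "x \<in> lin_span Y"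
  using assms(1)
proof induction
  case (add x v t)
  then show ?case using assms(2) by (intro lin_span_lincomb) auto
qed (rule lin_span.zero)

text \<open>Gaussian elimination. Integrality of \<open>X\<close> is essential: a span in irrational
  directions may be annihilated by no nonzero integral functional.\<close>

lemma perp_perp_subset_lin_span:
  assumes "X \<subseteq> Zn n" shows "perp_perp n X \<subseteq> lin_span X"
  using assms
proof (induction n arbitrary: X)
  case 0
  then show ?case using lin_span.zero by (auto simp: perp_perp_def Rn_zero_iff)
next
  case (Suc n)
  show ?case
  proof
    fix x assume x: "x \<in> perp_perp (Suc n) X"
    then have xR: "x \<in> Rn (Suc n)" by (simp add: perp_perp_def)
    show "x \<in> lin_span X"
    proof (cases "\<forall>v\<in>X. v n = 0")
      case True
      have drop: "v(n := 0) = v" if "v n = 0" for v :: "nat \<Rightarrow> real" using that by auto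
      have XZ: "X \<subseteq> Zn n"
      proof
        fix v assume "v \<in> X"
        then show "v \<in> Zn n" using Zn_drop[of v n] drop[of v] True Suc.prems by auto
      qed
      have "unit_vec n \<in> perp (Suc n) X"
        using True by (simp add: perp_def unit_vec_in_Zn dotn_unit_vec)
      then have "dotn (Suc n) (unit_vec n) x = 0" using x unfolding perp_perp_def by blast
      then have xn: "x n = 0" by (simp add: dotn_unit_vec)
      have "dotn n c x = 0" if c: "c \<in> perp n X" for c
      proof -
        have "c \<in> perp (Suc n) X" using c True Zn_mono by (auto simp: perp_def dotn_Suc)
        then have "dotn (Suc n) c x = 0" using x unfolding perp_perp_def by blast
        then show ?thesis using xn by (simp add: dotn_Suc)
      qed
      moreover have "x \<in> Rn n" using xR drop[of x] xn by (simp add: Rn_Suc_iff)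
      ultimately have "x \<in> perp_perp n X" by (simp add: perp_perp_def)
      then show ?thesis using Suc.IH[OF XZ] by blast
    next
      case False
      then obtain v where v: "v \<in> X" "v n \<noteq> 0" by blast
      \<comment> \<open>Elimination with pivot \<open>v\<close> and without division, so that
        \<open>elim\<close> preserves integrality and a functional \<open>c\<close> on its image
        pulls back to the integral functional \<open>d\<close> with
        \<open>d y = c (elim y)\<close>.\<close>
      define elim where "elim = (\<lambda>y. lincomb (v n) y (- y n) v)"
      have vZ: "v \<in> Zn (Suc n)" using v(1) Suc.prems by blast
      have elim_n: "elim y n = 0" for y by (simp add: elim_def lincomb_def)
      have elim_drop: "(elim y)(n := 0) = elim y" for y using elim_n by (simp add: fun_upd_idem)
      have "elim y \<in> Zn n" if "y \<in> X" for y
      proof -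
        have "y \<in> Zn (Suc n)" using that Suc.prems by blast
        then have "elim y \<in> Zn (Suc n)"
          unfolding elim_def using vZ by (intro lincomb_in_Zn) (auto simp: Zn_iff)
        then show ?thesis using Zn_drop elim_drop by metis
      qed
      then have EZ: "elim ` X \<subseteq> Zn n" by blast
      have "dotn n c (elim x) = 0" if c: "c \<in> perp n (elim ` X)" for c
      proof -
        define d where "d = (\<lambda>i. v n * c i)(n := - dotn n c v)"
        have cZ: "c \<in> Zn n" using c by (simp add: perp_def)
        have d_dot: "dotn (Suc n) d y = dotn n c (elim y)" for y
          by (simp add: d_def dotn_Suc dotn_scale_left elim_def dotn_lincomb)
        have "(\<lambda>i. v n * c i) \<in> Zn n" using cZ vZ by (auto simp: Zn_iff Rn_def)
        moreover have "dotn n c v \<in> \<int>"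
          using dotn_Ints[of "c(n := 0)" "Suc n" v] Zn_upd[OF cZ, of 0] vZ by (simp add: dotn_Suc)
        ultimately have "d \<in> Zn (Suc n)" unfolding d_def by (intro Zn_upd) auto
        moreover have "dotn (Suc n) d y = 0" if "y \<in> X" for y
          using c that unfolding d_dot perp_def by blast
        ultimately have "d \<in> perp (Suc n) X" unfolding perp_def by blast
        then have "dotn (Suc n) d x = 0" using x unfolding perp_perp_def by blast
        then show ?thesis unfolding d_dot .
      qed
      moreover have "elim x \<in> Rn n"
      proof -
        have "elim x \<in> Rn (Suc n)" unfolding elim_def using xR vZ by (intro lincomb_in_Rn) (auto simp: Zn_iff)
        then show ?thesis using Rn_Suc_iff elim_drop by metis
      qed
      ultimately have "elim x \<in> perp_perp n (elim ` X)" by (simp add: perp_perp_def)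
      then have "elim x \<in> lin_span (elim ` X)" using Suc.IH[OF EZ] by blast
      moreover have "elim ` X \<subseteq> lin_span X"
        unfolding elim_def using v(1) by (auto intro: lin_span_lincomb lin_span_base)
      ultimately have "elim x \<in> lin_span X" by (rule lin_span_trans)
      then have "lincomb (1 / v n) (elim x) (x n / v n) v \<in> lin_span X"
        by (rule lin_span_lincomb[OF lin_span_base[OF v(1)]])
      moreover have "lincomb (1 / v n) (elim x) (x n / v n) v = x"
        using v(2) by (auto simp: elim_def lincomb_def field_simps)
      ultimately show ?thesis by simp
    qed
  qed
qed

section \<open>Affine combinations and the relative interior\<close>

lemma aff_superset: "S \<subseteq> aff S"
proof
  fix x assume "x \<in> S"
  then show "x \<in> aff S"
    unfolding aff_def by (intro CollectI exI[of _ "{x}"] exI[of _ "\<lambda>_. 1"]) auto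
qed

lemma aff_mono: "S \<subseteq> T \<Longrightarrow> aff S \<subseteq> aff T"
  unfolding aff_def by blast

lemma aff_add_direction:
  assumes "x \<in> aff S" "v \<in> S" "z \<in> S"
  shows "lincomb 1 x t (lincomb 1 v (-1) z) \<in> aff S"
proof -
  obtain F u where F: "x = (\<lambda>i. \<Sum>y\<in>F. u y * y i)" "finite F" "F \<subseteq> S" "F \<noteq> {}" "sum u F = 1"
    using assms(1) unfolding aff_def by blast
  define G where "G = insert v (insert z F)"
  \<comment> \<open>Added contributions allow \<open>v\<close>, \<open>z\<close> and members of
    \<open>F\<close> to coincide. The identity \<open>split\<close> is used for the coordinates and,
    with \<open>h\<close> constant 1, for the total weight.\<close>
  define w where "w = (\<lambda>y. (if y \<in> F then u y else 0) + (if y = v then t else 0) - (if y = z then t else 0))"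
  have finG: "finite G" using F(2) by (simp add: G_def)
  have FG: "G \<inter> F = F" by (auto simp: G_def)
  have split: "(\<Sum>y\<in>G. w y * h y) = (\<Sum>y\<in>F. u y * h y) + t * h v - t * h z" for h :: "(nat \<Rightarrow> real) \<Rightarrow> real"
  proof -
    have "w y * h y = (if y \<in> F then u y * h y else 0) + (if y = v then t * h v else 0) - (if y = z then t * h z else 0)" for y
      by (simp add: w_def algebra_simps)
    then have "(\<Sum>y\<in>G. w y * h y) = (\<Sum>y\<in>G. if y \<in> F then u y * h y else 0) + (\<Sum>y\<in>G. if y = v then t * h v else 0)
       - (\<Sum>y\<in>G. if y = z then t * h z else 0)"
      by (simp only: sum.distrib sum_subtractf)
    also have "(\<Sum>y\<in>G. if y \<in> F then u y * h y else 0) = (\<Sum>y\<in>F. u y * h y)"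
      using finG FG by (simp add: sum.inter_restrict[symmetric])
    also have "(\<Sum>y\<in>G. if y = v then t * h v else 0) = t * h v"
      using finG by (simp add: G_def)
    also have "(\<Sum>y\<in>G. if y = z then t * h z else 0) = t * h z"
      using finG by (simp add: G_def)
    finally show ?thesis .
  qed
  have "lincomb 1 x t (lincomb 1 v (-1) z) = (\<lambda>i. \<Sum>y\<in>G. w y * y i)"
    by (rule ext) (simp add: split[of "\<lambda>y. y _"] lincomb_def F(1) right_diff_distrib)
  moreover have "sum w G = 1" using split[of "\<lambda>_. 1"] F(5) by simp
  moreover have "G \<subseteq> S" "G \<noteq> {}" using F(3) assms by (auto simp: G_def)
  ultimately show ?thesis using finG unfolding aff_def by blast
qed

lemma translate_lin_span_aff:
  assumes "x \<in> lin_span ((\<lambda>v. lincomb 1 v (-1) z) ` S)" "z \<in> S"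
  shows "lincomb 1 z 1 x \<in> aff S"
  using assms(1)
proof induction
  case zero
  show ?case using aff_superset[of S] assms(2) by (auto simp: lincomb_def)
next
  case (add x v t)
  then obtain p where p: "p \<in> S" "v = lincomb 1 p (-1) z" by blast
  have "lincomb 1 z 1 (lincomb 1 x t v) = lincomb 1 (lincomb 1 z 1 x) t (lincomb 1 p (-1) z)"
    by (auto simp: lincomb_def p(2))
  then show ?case using aff_add_direction[OF add.IH p(1) assms(2)] by simp
qed

text \<open>If \<open>c\<close> is larger at \<open>p\<close> than at \<open>z\<close>, a short step
  from \<open>z\<close> away from \<open>p\<close> stays in \<open>P\<close> and lowers
  \<open>c\<close>. The point reached is a convex combination of points of \<open>S\<close>, so one
  of these has a value below that at \<open>z\<close>.\<close>

lemma relint_balanced: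
  assumes P: "P \<subseteq> conv S" "S \<subseteq> P" and z: "z \<in> relint n P"
  shows "balanced n ((\<lambda>v. lincomb 1 v (-1) z) ` S)"
  unfolding balanced_def
proof (intro allI impI)
  fix c assume "\<exists>v\<in>(\<lambda>v. lincomb 1 v (-1) z) ` S. dotn n c v > 0"
  then obtain p where p: "p \<in> P" "dotn n c p > dotn n c z"
    using P(2) by (auto simp: dotn_lincomb)
  obtain e where zP: "z \<in> P" and e: "e > 0" "\<And>y. y \<in> aff P \<Longrightarrow> (\<Sum>i<n. (y i - z i)^2) < e^2 \<Longrightarrow> y \<in> P"
    using z unfolding relint_def by blast
  define q where "q = (\<Sum>i<n. (p i - z i)^2)"
  have q: "q \<ge> 0" unfolding q_def by (intro sum_nonneg) auto
  \<comment> \<open>Since \<open>q\<close> is a squared distance and \<open>q < (1 + q)^2\<close>,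
    this step length stays within radius \<open>e\<close> without a square root.\<close>
  define s where "s = e / (1 + q)"
  have s: "s > 0" using e(1) q by (simp add: s_def)
  define y where "y = lincomb 1 z (- s) (lincomb 1 p (-1) z)"
  have "y \<in> aff P"
    unfolding y_def using aff_superset[of P] zP p(1) by (intro aff_add_direction) auto
  moreover have "(\<Sum>i<n. (y i - z i)^2) < e^2"
  proof -
    have "(\<Sum>i<n. (y i - z i)^2) = s^2 * q"
      by (simp add: y_def lincomb_def q_def sum_distrib_left power2_eq_square algebra_simps)
    also have "\<dots> < s^2 * (1 + q)^2"
      using s q by (intro mult_strict_left_mono) (auto simp: power2_eq_square algebra_simps intro: add_pos_nonneg)
    also have "\<dots> = e^2" using q by (simp add: s_def power_divide)
    finally show ?thesis .
  qed
  ultimately have "y \<in> conv S" using e(2) P(1) by blast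
  then obtain F u where F: "y = (\<lambda>i. \<Sum>w\<in>F. u w * w i)" "finite F" "F \<subseteq> S" "\<forall>w\<in>F. 0 \<le> u w" "sum u F = 1"
    unfolding conv_def by blast
  have cy: "dotn n c y = (\<Sum>w\<in>F. u w * dotn n c w)"
    unfolding F(1) dotn_def sum_distrib_left by (subst sum.swap) (simp add: mult_ac)
  have "\<exists>w\<in>F. dotn n c w < dotn n c z"
  proof (rule ccontr)
    assume "\<not> (\<exists>w\<in>F. dotn n c w < dotn n c z)"
    then have "(\<Sum>w\<in>F. u w * dotn n c z) \<le> dotn n c y"
      unfolding cy using F(4) by (intro sum_mono mult_left_mono) (auto simp: not_less)
    then have "dotn n c z \<le> dotn n c y" using F(5) by (simp add: sum_distrib_right[symmetric])
    moreover have "dotn n c y = dotn n c z - s * (dotn n c p - dotn n c z)"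
      by (simp add: y_def dotn_lincomb algebra_simps)
    moreover have "s * (dotn n c p - dotn n c z) > 0" using s p(2) by simp
    ultimately show False by linarith
  qed
  then show "\<exists>v\<in>(\<lambda>v. lincomb 1 v (-1) z) ` S. dotn n c v < 0"
    using F(3) by (force simp: dotn_lincomb)
qed

lemma rational_polyhedron_translate:
  assumes "rational_polyhedron n Q" "z \<in> Zn n"
  shows "rational_polyhedron n {x \<in> Rn n. lincomb 1 x 1 z \<in> Q}"
proof -
  obtain S where S: "finite S" "\<forall>p\<in>S. rat_ineq n p" "Q = sols n S"
    using assms(1) by (rule rational_polyhedronE)
  let ?g = "\<lambda>p. (fst p, snd p - dotn n (fst p) z)"
  have zR: "z \<in> Rn n" using assms(2) by (simp add: Zn_iff)
  have "{x \<in> Rn n. lincomb 1 x 1 z \<in> Q} = sols n (?g ` S)"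
    unfolding S(3) using zR by (auto simp: sols_def lincomb_in_Rn dotn_lincomb algebra_simps)
  moreover have "rat_ineq n (?g p)" if "p \<in> S" for p
  proof -
    have "dotn n (fst p) z \<in> \<rat>"
      unfolding dotn_def
    proof (intro Rats_sum Rats_mult)
      fix i assume "i \<in> {..<n}"
      then show "fst p i \<in> \<rat>" using S(2) that by (auto simp: rat_ineq_def)
      show "z i \<in> \<rat>" using assms(2) Ints_subset_Rats by (auto simp: Zn_iff)
    qed
    then show ?thesis using S(2) that by (auto simp: rat_ineq_def)
  qed
  ultimately show ?thesis using S(1) by (intro rational_polyhedronI[of "?g ` S"]) auto
qed

theorem theorem1:
  shows "\<exists>\<beta>::nat \<Rightarrow> nat. \<forall>(n::nat) P Q. 1 \<le> n \<longrightarrow> integral_polyhedron n P \<longrightarrow>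
           relint n P \<inter> Zn n \<noteq> {} \<longrightarrow> relaxation n P Q \<longrightarrow>
           cg_iter n (\<beta> n) Q \<subseteq> aff P"
proof -
  obtain \<beta> where \<beta>: "\<And>n Q. rational_polyhedron n Q \<Longrightarrow> (\<lambda>_. 0) \<in> Q \<Longrightarrow> balanced n (Q \<inter> Zn n) \<Longrightarrow>
      cg_red n (\<beta> n) Q (perp_perp n (Q \<inter> Zn n))"
  proof -
    have "\<forall>n. \<exists>k. \<forall>Q. rational_polyhedron n Q \<longrightarrow> (\<lambda>_. 0) \<in> Q \<longrightarrow> balanced n (Q \<inter> Zn n) \<longrightarrow>
        cg_red n k Q (perp_perp n (Q \<inter> Zn n))"
      using balanced_cg_red by blast
    from choice[OF this] show ?thesis using that by blast
  qed
  have "cg_iter n (\<beta> n) Q \<subseteq> aff P"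
    if P: "integral_polyhedron n P" "relint n P \<inter> Zn n \<noteq> {}" and Q: "relaxation n P Q" for n P Q
  proof -
    obtain z where z: "z \<in> relint n P" "z \<in> Zn n" using P(2) by blast
    have zR: "z \<in> Rn n" using z(2) by (simp add: Zn_iff)
    have zP: "z \<in> P" using z(1) by (simp add: relint_def)
    have QP: "Q \<inter> Zn n = P \<inter> Zn n" and rQ: "rational_polyhedron n Q"
      using Q by (simp_all add: relaxation_def)
    have QR: "Q \<subseteq> Rn n" by (rule rational_polyhedron_subset[OF rQ])
    let ?sub = "\<lambda>v. lincomb 1 v (-1) z"
    define R where "R = {x \<in> Rn n. lincomb 1 x 1 z \<in> Q}"
    have sub_inv: "?sub (lincomb 1 x 1 z) = x" "lincomb 1 (?sub x) 1 z = x" for x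
      by (auto simp: lincomb_def)
    have RX: "R \<inter> Zn n = ?sub ` (P \<inter> Zn n)"
    proof
      show "R \<inter> Zn n \<subseteq> ?sub ` (P \<inter> Zn n)"
      proof
        fix x assume x: "x \<in> R \<inter> Zn n"
        then have "lincomb 1 x 1 z \<in> Q \<inter> Zn n" using z(2) by (auto simp: R_def intro!: lincomb_in_Zn)
        then have "lincomb 1 x 1 z \<in> P \<inter> Zn n" unfolding QP .
        then show "x \<in> ?sub ` (P \<inter> Zn n)" using sub_inv(1)[of x] by (metis imageI)
      qed
      show "?sub ` (P \<inter> Zn n) \<subseteq> R \<inter> Zn n"
      proof
        fix x assume "x \<in> ?sub ` (P \<inter> Zn n)"
        then obtain p where p: "p \<in> P \<inter> Zn n" "x = ?sub p" by blast
        then have "x \<in> Zn n" using z(2) by (auto intro!: lincomb_in_Zn)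
        moreover have "lincomb 1 x 1 z \<in> Q" using p sub_inv(2)[of p] QP by auto
        ultimately show "x \<in> R \<inter> Zn n" by (simp add: R_def Zn_iff)
      qed
    qed
    have "P \<subseteq> conv (P \<inter> Zn n)" using P(1) by (simp add: integral_polyhedron_def integer_hull_def)
    then have "balanced n (R \<inter> Zn n)" unfolding RX by (rule relint_balanced[OF _ _ z(1)]) simp
    moreover have "(\<lambda>_. 0) \<in> R"
      using zP z(2) QP by (auto simp: R_def lincomb_def)
    moreover have "rational_polyhedron n R"
      unfolding R_def by (rule rational_polyhedron_translate[OF rQ z(2)])
    ultimately have "cg_red n (\<beta> n) R (perp_perp n (R \<inter> Zn n))" by (intro \<beta>)
    from cg_red_pullback[OF integral_affine_translate[OF z(2)] this]
    have "cg_red n (\<beta> n) {x \<in> Rn n. ?sub x \<in> R} {x. ?sub x \<in> perp_perp n (R \<inter> Zn n)}" .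
    moreover have "Q \<subseteq> {x \<in> Rn n. ?sub x \<in> R}"
      using QR zR by (auto simp: R_def sub_inv intro!: lincomb_in_Rn)
    ultimately have "cg_red n (\<beta> n) Q {x. ?sub x \<in> perp_perp n (R \<inter> Zn n)}"
      using cg_red_mono by blast
    then have "cg_iter n (\<beta> n) Q \<subseteq> {x. ?sub x \<in> perp_perp n (R \<inter> Zn n)}" by (rule cg_red_cg_iter)
    also have "\<dots> \<subseteq> aff P"
    proof
      fix x assume "x \<in> {x. ?sub x \<in> perp_perp n (R \<inter> Zn n)}"
      \<comment> \<open>The span of the differences of integer points of \<open>P\<close> from
        \<open>z\<close>, moved back by \<open>z\<close>, consists of affine combinations of integer
        points of \<open>P\<close>.\<close>
      then have "?sub x \<in> lin_span (R \<inter> Zn n)"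
        using perp_perp_subset_lin_span[of "R \<inter> Zn n" n] by blast
      then have "lincomb 1 z 1 (?sub x) \<in> aff (P \<inter> Zn n)"
        unfolding RX using zP z(2) by (intro translate_lin_span_aff) auto
      moreover have "lincomb 1 z 1 (?sub x) = x" by (auto simp: lincomb_def)
      ultimately show "x \<in> aff P" using aff_mono[of "P \<inter> Zn n" P] by auto
    qed
    finally show ?thesis .
  qed
  then show ?thesis by blast
qed

end
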